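(* Let $u$ be a harmonic function on $\mathbb{R}^n$ such that for every $x\in\mathbb{R}^n$ the series $$\sum_{|\beta|=0}^\infty\frac{\partial^\beta u(x)}{\sqrt{\beta!}}\,y^\beta$$ converges absolutely for any $y\in\mathbb{R}^n$. Let $h>0$, $\mathcal{D}>0$ with $\sqrt{\mathcal{D}}\,h<1$. Then the quasi-interpolant $$\mathcal{M}u(x)=(\pi\mathcal{D})^{-n/2}\sum_{m\in\mathbb{Z}^n}u(hm)\,e^{-|x-hm|^2/(h^2\mathcal{D})}$$ approximates $u$ with $$\mathcal{M}u(x)-u(x)=\lim_{M\to\infty}\mathcal{E}_{h,2M}(x)=\sum_{m\in\mathbb{Z}^n\setminus\{0\}}\tilde u(x+\pi i h\mathcal{D}m)\,e^{-\pi^2\mathcal{D}|m|^2}\,e^{2\pi i\langle m,x\rangle/h}$$ for $x\in\mathbb{R}^n$, where $\tilde u$ is the analytic extension of $u$ onto $\mathbb{C}^n$ and $\mathcal{E}_{h,2M}$ is the saturation error defined in the context.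
   Context: Greek letters denote multi-indices in $\mathbb{Z}_{\ge0}^n$; $\alpha\le\beta$ is meant componentwise. A function harmonic on all of $\mathbb{R}^n$ has the analytic extension $\tilde u(\zeta)=\sum_{|\beta|=0}^\infty\frac{\partial^\beta u(x)}{\beta!}(\zeta-x)^\beta$, $\zeta\in\mathbb{C}^n$ (for any $x\in\mathbb{R}^n$). For a positive integer $M$ the saturation error is $$\mathcal{E}_{h,2M}(x)=u(x)\Big((\pi\mathcal{D})^{-n/2}\sum_{m\in\mathbb{Z}^n}e^{-|x-hm|^2/(h^2\mathcal{D})}-1\Big)$$ $$+(\pi\mathcal{D})^{-n/2}\sum_{|\beta|=1}^{2M-1}(-h\sqrt{\mathcal{D}})^{|\beta|}\partial^\beta u(x)\sum_{m\in\mathbb{Z}^n}e^{-|x-hm|^2/(h^2\mathcal{D})}\sum_{\alpha\le\beta}\frac{a_{\beta-\alpha}}{\alpha!}\Big(\frac{x-hm}{h\sqrt{\mathcal{D}}}\Big)^\alpha,$$ where $a_\gamma=0$ if $\gamma$ has at least one odd component, and $a_{2\gamma}=\dfrac{(-1)^{|\gamma|}}{\gamma!\,4^{|\gamma|}}$ for $0\le|\gamma|\le M-1$. *)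

theory Defs
  imports "HOL-Analysis.Analysis"
begin

text \<open>Multi-indices are vectors \<open>\<beta> :: nat ^ 'n\<close>; the library order \<open>\<le>\<close> and
  the subtraction on vectors are componentwise.\<close>

definition mi_abs :: "nat ^ 'n \<Rightarrow> nat"
  where "mi_abs \<beta> = (\<Sum>i\<in>UNIV. \<beta> $ i)"

definition mi_fact :: "nat ^ 'n \<Rightarrow> real"
  where "mi_fact \<beta> = (\<Prod>i\<in>UNIV. fact (\<beta> $ i))"

definition mi_pow :: "'a::comm_monoid_mult ^ 'n \<Rightarrow> nat ^ 'n \<Rightarrow> 'a"
  where "mi_pow y \<beta> = (\<Prod>i\<in>UNIV. (y $ i) ^ (\<beta> $ i))"


text \<open>Functions on \<open>real ^ 'n\<close> are complex-valued; a real-valued function \<open>v\<close> is covered as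
  \<open>\<lambda>x. complex_of_real (v x)\<close>.\<close>

definition partial_deriv :: "'n \<Rightarrow> (real ^ 'n \<Rightarrow> complex) \<Rightarrow> real ^ 'n \<Rightarrow> complex"
  where "partial_deriv i f x = vector_derivative (\<lambda>t. f (x + t *\<^sub>R axis i 1)) (at 0)"

text \<open>The index type carries no order, so the coordinates are processed in an arbitrary fixed
  enumeration; for smooth functions the choice is irrelevant because partial derivatives commute.\<close>

definition coord_list :: "'n::finite list"
  where "coord_list = (SOME is. distinct is \<and> set is = UNIV)"

definition mi_deriv :: "nat ^ 'n \<Rightarrow> (real ^ 'n \<Rightarrow> complex) \<Rightarrow> real ^ 'n \<Rightarrow> complex"
  where "mi_deriv \<beta> f = foldr (\<lambda>i g. (partial_deriv i ^^ (\<beta> $ i)) g) coord_list f"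

primrec C_diff :: "nat \<Rightarrow> (real ^ 'n \<Rightarrow> complex) \<Rightarrow> bool"
  where
    "C_diff 0 f \<longleftrightarrow> continuous_on UNIV f"
  | "C_diff (Suc k) f \<longleftrightarrow> (\<forall>x. f differentiable (at x)) \<and> (\<forall>i. C_diff k (partial_deriv i f))"

definition laplacian :: "(real ^ 'n \<Rightarrow> complex) \<Rightarrow> real ^ 'n \<Rightarrow> complex"
  where "laplacian f x = (\<Sum>i\<in>UNIV. partial_deriv i (partial_deriv i f) x)"

definition harmonic :: "(real ^ 'n \<Rightarrow> complex) \<Rightarrow> bool"
  where "harmonic u \<longleftrightarrow> C_diff 2 u \<and> (\<forall>x. laplacian u x = 0)"


definition complex_vec :: "real ^ 'n \<Rightarrow> complex ^ 'n"
  where "complex_vec x = (\<chi> i. complex_of_real (x $ i))"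

definition taylor_term ::
    "(real ^ 'n \<Rightarrow> complex) \<Rightarrow> real ^ 'n \<Rightarrow> complex ^ 'n \<Rightarrow> nat ^ 'n \<Rightarrow> complex"
  where "taylor_term u p \<zeta> \<beta> =
    mi_deriv \<beta> u p / complex_of_real (mi_fact \<beta>) * mi_pow (\<zeta> - complex_vec p) \<beta>"

text \<open>The analytic extension of \<open>u\<close> at \<open>\<zeta>\<close>, computed from the expansion about the real
  point \<open>p\<close>. The value does not depend on \<open>p\<close> for entire harmonic \<open>u\<close>, so statements about the
  extension are made for every \<open>p\<close>. As \<^const>\<open>infsum\<close> is 0 on divergent families, they come with a
  separate summability claim.\<close>

definition analytic_ext ::
    "(real ^ 'n \<Rightarrow> complex) \<Rightarrow> real ^ 'n \<Rightarrow> complex ^ 'n \<Rightarrow> complex"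
  where "analytic_ext u p \<zeta> = (\<Sum>\<^sub>\<infinity>\<beta>. taylor_term u p \<zeta> \<beta>)"


definition int_vec :: "int ^ 'n \<Rightarrow> real ^ 'n"
  where "int_vec m = (\<chi> i. real_of_int (m $ i))"

definition gauss :: "real \<Rightarrow> real \<Rightarrow> real ^ 'n \<Rightarrow> int ^ 'n \<Rightarrow> real"
  where "gauss h D x m = exp (- ((norm (x - h *\<^sub>R int_vec m))\<^sup>2 / (h\<^sup>2 * D)))"

definition quasi_interp ::
    "real \<Rightarrow> real \<Rightarrow> (real ^ 'n \<Rightarrow> complex) \<Rightarrow> real ^ 'n \<Rightarrow> complex"
  where "quasi_interp h D u x =
    complex_of_real ((pi * D) powr (- (real CARD('n) / 2))) *
    (\<Sum>\<^sub>\<infinity>m. u (h *\<^sub>R int_vec m) * complex_of_real (gauss h D x m))"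

text \<open>\<open>a\<^sub>\<gamma>\<close>. The restriction \<open>\<bar>\<gamma>\<bar> \<le> 2 * (M - 1)\<close> under which these coefficients are prescribed
  is not needed here: in the saturation error \<open>a\<^sub>\<gamma>\<close> occurs only for \<open>\<bar>\<gamma>\<bar> \<le> 2 * M - 1\<close>, and all
  components even forces \<open>\<bar>\<gamma>\<bar> \<le> 2 * (M - 1)\<close>.\<close>

definition a_coeff :: "nat ^ 'n \<Rightarrow> real"
  where "a_coeff \<gamma> =
    (if \<exists>i. odd (\<gamma> $ i) then 0
     else let \<delta> = (\<chi> i. \<gamma> $ i div 2) in (- 1) ^ mi_abs \<delta> / (mi_fact \<delta> * 4 ^ mi_abs \<delta>))"

text \<open>\<open>saturation_error h D M\<close> is the error with index \<open>2 * M\<close>, meant for \<open>M \<ge> 1\<close>.\<close>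

definition saturation_error ::
    "real \<Rightarrow> real \<Rightarrow> nat \<Rightarrow> (real ^ 'n \<Rightarrow> complex) \<Rightarrow> real ^ 'n \<Rightarrow> complex"
  where "saturation_error h D M u x =
    u x * complex_of_real
      ((pi * D) powr (- (real CARD('n) / 2)) * (\<Sum>\<^sub>\<infinity>m::int ^ 'n. gauss h D x m) - 1) +
    complex_of_real ((pi * D) powr (- (real CARD('n) / 2))) *
    (\<Sum>\<beta> | 1 \<le> mi_abs \<beta> \<and> mi_abs \<beta> \<le> 2 * M - 1.
       complex_of_real ((- h * sqrt D) ^ mi_abs \<beta>) * mi_deriv \<beta> u x *
       complex_of_real
         (\<Sum>\<^sub>\<infinity>m. gauss h D x m *
            (\<Sum>\<alpha> | \<alpha> \<le> \<beta>. a_coeff (\<beta> - \<alpha>) / mi_fact \<alpha> *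
               mi_pow ((1 / (h * sqrt D)) *\<^sub>R (x - h *\<^sub>R int_vec m)) \<alpha>)))"

end

theory Submission
  imports Defs "HOL-Library.Periodic_Fun" "HOL-Probability.Characteristic_Functions"
    "HOL-Complex_Analysis.Conformal_Mappings"
begin

text \<open>Fix \<open>x\<close> and write \<open>d\<^sub>\<beta>\<close> for \<open>\<partial>\<^sup>\<beta> u(x)\<close>. The proof rests on a linear relation that
harmonicity imposes on the family \<open>d\<close>, on a growth bound for it, and on the transformation formula of the theta function.

\<^emph>\<open>Regularity.\<close> A twice continuously differentiable harmonic function is reproduced by averaging against
every rescaling of one compactly supported radial bump (\<open>harmonic_mean_value\<close>). Continuous functions with this
property form a class \<open>mean_value\<close> in which everything needed is elementary: derivatives can be moved onto the
bump, so partial derivatives exist, stay in the class, commute, and are bounded on the scale \<open>R\<close> by \<open>A / R\<close> times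
the supremum of the function. As \<open>R\<close> is arbitrary, the Taylor series at any point converges to the function
everywhere (\<open>mean_value_taylor\<close>), and \<open>\<Sum>\<^sub>i d\<^bsub>\<beta> + 2 e\<^sub>i\<^esub> = 0\<close> (\<open>harmonic_derivs_sum_zero\<close>). Hence the formal heat
operator \<open>exp (c \<Delta>) = \<Sum>\<^sub>\<gamma> c\<^bsup>|\<gamma>|\<^esup> \<partial>\<^bsup>2 \<gamma>\<^esup> / \<gamma>!\<close> fixes every \<open>d\<^sub>\<alpha>\<close>, for negative and for positive \<open>c\<close>.

\<^emph>\<open>The quasi-interpolant.\<close> Let \<open>P\<^sub>\<beta>\<close> be the sum over \<open>m\<close> of the Gaussian weight times \<open>(h m - x)\<^sup>\<beta> / \<beta>!\<close>; it is a
product of one-dimensional sums (\<open>poisson_moment\<close>). Expanding \<open>u(h m)\<close> at \<open>x\<close> turns \<open>\<Sum>\<^sub>m u(h m) gauss(m)\<close> into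
\<open>\<Sum>\<^sub>\<beta> d\<^sub>\<beta> P\<^sub>\<beta>\<close> (\<open>gauss_side\<close>). The exchange of sums is allowed because the growth hypothesis says that
\<open>|d\<^sub>\<beta>| \<le> C (\<beta>!)\<^bsup>1/2\<^esup> \<rho>\<^bsup>|\<beta>|\<^esup>\<close> for every \<open>\<rho> > 0\<close>, which makes the expansion grow slower than any Gaussian decays.

\<^emph>\<open>The saturation error.\<close> The coefficients \<open>a\<^sub>\<gamma>\<close> are those of \<open>exp (- |s|\<^sup>2 / 4)\<close>, that is, of \<open>exp (- \<Delta> / 4)\<close>; on
harmonic functions only \<open>\<gamma> = 0\<close> survives, even after truncation (\<open>a_coeff_sum\<close>). So the error with index \<open>2 M\<close> is the
normalised partial sum of \<open>\<Sum>\<^sub>\<beta> d\<^sub>\<beta> P\<^sub>\<beta>\<close> over \<open>|\<beta>| \<le> 2 M - 1\<close>, minus \<open>u(x)\<close>, and its limit is immediate.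

\<^emph>\<open>Poisson summation.\<close> The theta identity at the real point \<open>\<xi> + 2 c s\<close>, \<open>c = h\<^sup>2 D / 4\<close>, is an identity between
generating functions in \<open>s\<close>: on one side of the \<open>P\<^sub>b\<close>, on the other of terms \<open>exp (c s\<^sup>2 + \<pi> i h D k s)\<close>. Comparing
coefficients (\<open>poisson_monomial\<close>) rewrites \<open>\<Sum>\<^sub>\<beta> d\<^sub>\<beta> P\<^sub>\<beta>\<close> as a sum over \<open>k \<in> \<int>\<^sup>n\<close> in which \<open>exp (c \<Delta>)\<close> acts on \<open>d\<close> and
hence disappears; what is left is the Taylor series of the analytic extension at \<open>x + \<pi> i h D k\<close> (\<open>dual_side\<close>). The
term \<open>k = 0\<close> is \<open>u(x)\<close>. Expansion points other than \<open>x\<close> give the same extension by the identity theorem on complex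
lines (\<open>analytic_ext_independent\<close>).\<close>

(* Two constants share this notation; below it stands for summability of the norms. *)
no_notation Infinite_Set_Sum.abs_summable_on (infix "abs'_summable'_on" 50)

section \<open>Averaging kernels and integration by parts\<close>

text \<open>The kernel is an explicit power rather than a smooth bump function: two continuous derivatives suffice,
and each derivative is again a polynomial times a lower power.\<close>
definition bump :: "nat \<Rightarrow> real ^ 'n \<Rightarrow> real"
  where "bump k y = max 0 (1 - (norm y)\<^sup>2) ^ k"

text \<open>A box containing the support of the kernel and of all its translates by vectors of norm at most 1,
so that small shifts do not change integrals over it.\<close>
definition big_box :: "(real ^ 'n) set"
  where "big_box = cbox (\<chi> i. - 2) (\<chi> i. 2)"

abbreviation average :: "(real ^ 'n \<Rightarrow> real) \<Rightarrow> (real ^ 'n \<Rightarrow> complex) \<Rightarrow> real ^ 'n \<Rightarrow> real \<Rightarrow> complex"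
  where "average w f x r \<equiv> integral big_box (\<lambda>y. w y *\<^sub>R f (x + r *\<^sub>R y))"

lemma has_real_derivative_pos_part_power:
  fixes s :: real
  shows "((\<lambda>s. max 0 s ^ Suc (Suc k)) has_real_derivative real (k + 2) * max 0 s ^ Suc k) (at s)"
proof -
  consider "s > 0" | "s < 0" | "s = 0" by linarith
  then show ?thesis
  proof cases
    case 1
    have "((\<lambda>s. s ^ Suc (Suc k)) has_real_derivative real (k + 2) * max 0 s ^ Suc k) (at s)"
      using DERIV_pow[of "Suc (Suc k)" s] 1 by (simp add: max_def)
    then show ?thesis
      by (rule has_field_derivative_transform_within_open[where S = "{0<..}"]) (use 1 in auto)
  next
    case 2
    have "((\<lambda>s. 0) has_real_derivative real (k + 2) * max 0 s ^ Suc k) (at s)"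
      using 2 by (auto intro!: derivative_eq_intros simp: max_def)
    then show ?thesis
      by (rule has_field_derivative_transform_within_open[where S = "{..<0}"]) (use 2 in auto)
  next
    case 3
    show ?thesis unfolding CARAT_DERIV
    proof (intro exI[of _ "\<lambda>z. max 0 z ^ Suc k"] conjI allI)
      show "isCont (\<lambda>z. max 0 z ^ Suc k) s"
        by (intro continuous_intros)
    qed (auto simp: 3 max_def)
  qed
qed

lemma continuous_on_bump [continuous_intros]:
  "continuous_on S g \<Longrightarrow> continuous_on S (\<lambda>x. bump k (g x))"
  unfolding bump_def by (intro continuous_intros)

lemma bump_eq_0: "norm y \<ge> 1 \<Longrightarrow> k > 0 \<Longrightarrow> bump k y = 0"
  using power_mono[of 1 "norm y" 2] by (simp add: bump_def max_absorb1)

lemma bump_nonneg: "bump k y \<ge> 0"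
  by (simp add: bump_def)

lemma has_derivative_bump:
  fixes y :: "real ^ 'n"
  shows "((\<lambda>t. bump (Suc (Suc k)) (y + t *\<^sub>R axis i 1)) has_real_derivative
     - 2 * real (k + 2) * ((y + t *\<^sub>R axis i 1) $ i * bump (Suc k) (y + t *\<^sub>R axis i 1))) (at t)"
proof -
  have n: "(norm (y + t *\<^sub>R axis i 1))\<^sup>2 = (norm y)\<^sup>2 + 2 * t * y $ i + t\<^sup>2" for t :: real
  proof -
    have "(norm (y + t *\<^sub>R axis i 1))\<^sup>2 = (norm y)\<^sup>2 + 2 * (y \<bullet> (t *\<^sub>R axis i 1)) + (norm (t *\<^sub>R axis i 1 :: real^'n))\<^sup>2"
      by (simp add: power2_norm_eq_inner inner_add_left inner_add_right inner_commute power2_eq_square[of t])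
    moreover have "(norm (t *\<^sub>R axis i 1 :: real^'n))\<^sup>2 = t\<^sup>2" by simp
    moreover have "y \<bullet> (t *\<^sub>R axis i 1) = t * y $ i" by (simp add: inner_axis)
    ultimately show ?thesis by (simp only: mult.assoc)
  qed
  have "((\<lambda>t. 1 - ((norm y)\<^sup>2 + 2 * t * y $ i + t\<^sup>2)) has_real_derivative - 2 * (y $ i + t)) (at t)"
    by (auto intro!: derivative_eq_intros)
  from DERIV_chain2[OF has_real_derivative_pos_part_power this]
  show ?thesis unfolding bump_def n by (simp add: algebra_simps)
qed

lemma norm_less_2_in_big_box: 
  assumes "norm y \<le> 2" shows "y \<in> big_box"
proof -
  have "\<bar>y $ i\<bar> \<le> 2" for i using component_le_norm_cart[of y i] assms by linarith
  then show ?thesis by (auto simp: big_box_def mem_box_cart abs_le_iff minus_le_iff)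
qed

lemma integral_shift_supported:
  fixes w :: "real ^ 'n \<Rightarrow> complex"
  assumes w: "continuous_on UNIV w" and z: "\<And>y. norm y \<ge> 1 \<Longrightarrow> w y = 0" and c: "norm c \<le> 1"
  shows "integral big_box (\<lambda>y. w (y + c)) = integral big_box w"
proof -
  have "w integrable_on big_box" unfolding big_box_def
    by (intro integrable_continuous continuous_on_subset[OF w]) auto
  then have "(w has_integral integral big_box w) big_box" by (rule integrable_integral)
  from has_integral_shift_cbox[OF this[unfolded big_box_def], of c]
  have 1: "((\<lambda>y. w (y + c)) has_integral integral big_box w) UNIV"
    unfolding big_box_def[symmetric]
    apply (rule has_integral_on_superset)
    subgoal for x
    proof -
      assume a: "x \<notin> cbox ((\<chi> i. - 2) - c) ((\<chi> i. 2) - c)"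
      have "x + c \<notin> big_box" using a unfolding big_box_def
        by (auto simp: mem_box_cart algebra_simps)
      then show "w (x + c) = 0" using z[of "x + c"] norm_less_2_in_big_box[of "x + c"] by force
    qed
    unfolding big_box_def by auto
  have "continuous_on UNIV (\<lambda>y. w (y + c))"
    by (rule continuous_on_compose2[OF w]) (auto intro!: continuous_intros)
  then have "(\<lambda>y. w (y + c)) integrable_on big_box" unfolding big_box_def
    by (intro integrable_continuous) (auto elim: continuous_on_subset)
  then have "((\<lambda>y. w (y + c)) has_integral integral big_box (\<lambda>y. w (y + c))) big_box"
    by (rule integrable_integral)
  then have 2: "((\<lambda>y. w (y + c)) has_integral integral big_box (\<lambda>y. w (y + c))) UNIV"
    apply (rule has_integral_on_superset)
    subgoal for x
    proof -
      assume a: "x \<notin> big_box"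
      then have "norm x > 2" using norm_less_2_in_big_box by force
      moreover have "norm x \<le> norm (x + c) + norm c"
        using norm_triangle_ineq4[of "x + c" c] by simp
      ultimately have "norm (x + c) \<ge> 1" using c by simp
      then show "w (x + c) = 0" using z by auto
    qed
    by auto
  from has_integral_unique[OF 2 1] show ?thesis .
qed

lemma has_vector_derivative_shift_axis:
  fixes v :: "'a::real_normed_vector"
  assumes "\<And>x. ((\<lambda>t. f (x + t *\<^sub>R v)) has_vector_derivative f' x) (at 0)"
  shows "((\<lambda>t. f (x + t *\<^sub>R v)) has_vector_derivative f' (x + s *\<^sub>R v)) (at s)"
proof -
  have g: "((\<lambda>t. t - s) has_vector_derivative 1) (at s)"
    by (auto intro!: derivative_eq_intros simp: has_vector_derivative_def)
  have "((\<lambda>t. f (x + s *\<^sub>R v + t *\<^sub>R v)) has_vector_derivative f' (x + s *\<^sub>R v)) (at (s - s))"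
    using assms[of "x + s *\<^sub>R v"] by simp
  from vector_diff_chain_at[OF g this]
  have "((\<lambda>t. f (x + s *\<^sub>R v + (t - s) *\<^sub>R v)) has_vector_derivative f' (x + s *\<^sub>R v)) (at s)"
    by (simp add: o_def)
  moreover have "x + s *\<^sub>R v + (t - s) *\<^sub>R v = x + t *\<^sub>R v" for t
    by (simp add: scaleR_left_diff_distrib)
  ultimately show ?thesis by simp
qed

text \<open>After the shift \<open>y \<mapsto> y - (t / r) e\<^sub>i\<close> the parameter \<open>t\<close> sits in the kernel instead of \<open>f\<close>. Hence only the kernel needs
to be differentiable, which is the source of all regularity results below.\<close>
lemma kernel_derivative:
  fixes f :: "real ^ 'n \<Rightarrow> complex"
  assumes \<psi>: "continuous_on UNIV \<psi>" and \<psi>': "continuous_on UNIV \<psi>'"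
    and z: "\<And>y. norm y \<ge> 1 \<Longrightarrow> \<psi> y = 0"
    and d: "\<And>y t. ((\<lambda>t. \<psi> (y + t *\<^sub>R axis i 1)) has_real_derivative \<psi>' (y + t *\<^sub>R axis i 1)) (at t)"
    and f: "continuous_on UNIV f" and r: "r > 0"
  shows "((\<lambda>t. average \<psi> f (x + t *\<^sub>R axis i 1) r) has_vector_derivative
     (- (1 / r)) *\<^sub>R average \<psi>' f x r) (at 0)"
proof -
  have cf: "continuous_on S g \<Longrightarrow> continuous_on S (\<lambda>x. f (g x))" for S and g :: "'c::topological_space \<Rightarrow> _"
    by (rule continuous_on_compose2[OF f]) auto
  have c\<psi>: "continuous_on S g \<Longrightarrow> continuous_on S (\<lambda>x. \<psi> (g x))" for S and g :: "'c::topological_space \<Rightarrow> _"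
    by (rule continuous_on_compose2[OF \<psi>]) auto
  have c\<psi>': "continuous_on S g \<Longrightarrow> continuous_on S (\<lambda>x. \<psi>' (g x))" for S and g :: "'c::topological_space \<Rightarrow> _"
    by (rule continuous_on_compose2[OF \<psi>']) auto
  note [continuous_intros] = cf c\<psi> c\<psi>'
  let ?e = "axis i 1 :: real ^ 'n"
  define F where "F t = integral big_box (\<lambda>y. \<psi> (y + (- t / r) *\<^sub>R ?e) *\<^sub>R f (x + r *\<^sub>R y))" for t
  have "((\<lambda>t. \<psi> (y + (- t / r) *\<^sub>R ?e)) has_real_derivative - (1 / r) * \<psi>' (y + (- t / r) *\<^sub>R ?e)) (at t)" for y t
  proof -
    have "((\<lambda>t. - t / r) has_real_derivative - (1 / r)) (at t)"
      using r by (auto intro!: derivative_eq_intros)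
    from DERIV_chain2[OF d this] show ?thesis by (simp add: mult.commute)
  qed
  then have "((\<lambda>t. \<psi> (y + (- t / r) *\<^sub>R ?e) *\<^sub>R f (x + r *\<^sub>R y)) has_vector_derivative
      (- (1 / r) * \<psi>' (y + (- t / r) *\<^sub>R ?e)) *\<^sub>R f (x + r *\<^sub>R y)) (at t)" for y t
    using has_vector_derivative_scaleR[OF _ has_vector_derivative_const] by fastforce
  then have "(F has_vector_derivative 
     integral big_box (\<lambda>y. (- (1 / r) * \<psi>' (y + (- 0 / r) *\<^sub>R ?e)) *\<^sub>R f (x + r *\<^sub>R y))) (at 0)"
    unfolding F_def big_box_def
    by (intro leibniz_rule_vector_derivative[where U = UNIV]) 
      (auto intro!: integrable_continuous continuous_intros simp: split_beta r less_imp_neq[OF r, symmetric])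
  also have "integral big_box (\<lambda>y. (- (1 / r) * \<psi>' (y + (- 0 / r) *\<^sub>R ?e)) *\<^sub>R f (x + r *\<^sub>R y))
    = (- (1 / r)) *\<^sub>R average \<psi>' f x r"
    by (subst integral_cmul[symmetric]) (simp add: scaleR_scaleR)
  finally have F: "(F has_vector_derivative (- (1 / r)) *\<^sub>R average \<psi>' f x r) (at 0)" .
  have eq: "F t = average \<psi> f (x + t *\<^sub>R ?e) r" if t: "t \<in> {-r<..<r}" for t
  proof -
    have "integral big_box (\<lambda>y. \<psi> (y + (- t / r) *\<^sub>R ?e) *\<^sub>R f (x + t *\<^sub>R ?e + r *\<^sub>R (y + (- t / r) *\<^sub>R ?e)))
      = average \<psi> f (x + t *\<^sub>R ?e) r"
      by (rule integral_shift_supported[where w = "\<lambda>y. \<psi> y *\<^sub>R f (x + t *\<^sub>R ?e + r *\<^sub>R y)"])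
        (use t r z in \<open>auto intro!: continuous_intros simp: norm_axis_1 abs_le_iff field_simps\<close>)
    moreover have "x + t *\<^sub>R ?e + r *\<^sub>R (y + (- t / r) *\<^sub>R ?e) = x + r *\<^sub>R y" for y
      using r by (simp add: algebra_simps)
    ultimately show ?thesis unfolding F_def by (simp only:)
  qed
  show ?thesis
    by (rule has_vector_derivative_transform_within_open[OF F, where S = "{-r<..<r}"]) (use eq r in auto)
qed

text \<open>The value of \<^const>\<open>partial_deriv\<close> is an arbitrary vector where no derivative exists; this predicate
says that it is a genuine derivative everywhere.\<close>
definition has_partials :: "'n \<Rightarrow> (real ^ 'n \<Rightarrow> complex) \<Rightarrow> bool" where
  "has_partials i f \<longleftrightarrow> (\<forall>x. ((\<lambda>t. f (x + t *\<^sub>R axis i 1)) has_vector_derivative partial_deriv i f x) (at 0))"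

lemma has_partialsI:
  assumes "\<And>x. ((\<lambda>t. f (x + t *\<^sub>R axis i 1)) has_vector_derivative f' x) (at 0)"
  shows "has_partials i f" "partial_deriv i f = f'"
proof -
  show "partial_deriv i f = f'"
    unfolding partial_deriv_def using vector_derivative_at[OF assms] by auto
  with assms show "has_partials i f" by (simp add: has_partials_def)
qed

lemma has_partialsD:
  "has_partials i f \<Longrightarrow>
    ((\<lambda>t. f (x + t *\<^sub>R axis i 1)) has_vector_derivative partial_deriv i f (x + s *\<^sub>R axis i 1)) (at s)"
  by (rule has_vector_derivative_shift_axis) (simp add: has_partials_def)

lemma continuous_on_composeU: 
  "continuous_on UNIV f \<Longrightarrow> continuous_on S g \<Longrightarrow> continuous_on S (\<lambda>x. f (g x))"
  by (rule continuous_on_compose2) auto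

lemma partial_under_integral:
  fixes f :: "real ^ 'n \<Rightarrow> complex"
  assumes \<psi>: "continuous_on UNIV \<psi>" and f: "continuous_on UNIV f"
    and d: "has_partials i f" and f': "continuous_on UNIV (partial_deriv i f)"
  shows "((\<lambda>t. average \<psi> f (x + t *\<^sub>R axis i 1) r) has_vector_derivative
     average \<psi> (partial_deriv i f) x r) (at 0)"
proof -
  note [continuous_intros] = continuous_on_composeU[OF \<psi>] continuous_on_composeU[OF f] continuous_on_composeU[OF f']
  have "((\<lambda>t. f (x + t *\<^sub>R axis i 1 + r *\<^sub>R y)) has_vector_derivative
        partial_deriv i f (x + t *\<^sub>R axis i 1 + r *\<^sub>R y)) (at t)" for y t
    using has_partialsD[OF d, of "x + r *\<^sub>R y" t] by (simp add: add_ac)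
  then have "((\<lambda>t. \<psi> y *\<^sub>R f (x + t *\<^sub>R axis i 1 + r *\<^sub>R y)) has_vector_derivative
        \<psi> y *\<^sub>R partial_deriv i f (x + t *\<^sub>R axis i 1 + r *\<^sub>R y)) (at t)" for y t
    using has_vector_derivative_scaleR[OF DERIV_const] by fastforce
  then have "((\<lambda>t. average \<psi> f (x + t *\<^sub>R axis i 1) r) has_vector_derivative
     integral big_box (\<lambda>y. \<psi> y *\<^sub>R partial_deriv i f (x + 0 *\<^sub>R axis i 1 + r *\<^sub>R y))) (at 0)"
    unfolding big_box_def
    by (intro leibniz_rule_vector_derivative[where U = UNIV])
      (auto intro!: integrable_continuous continuous_intros simp: split_beta)
  then show ?thesis by simp
qed

text \<open>Both sides compute the derivative of the same average: once through the kernel, once through \<open>f\<close>.\<close>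
lemma integration_by_parts_kernel:
  fixes f :: "real ^ 'n \<Rightarrow> complex"
  assumes \<psi>: "continuous_on UNIV \<psi>" and \<psi>': "continuous_on UNIV \<psi>'"
    and z: "\<And>y. norm y \<ge> 1 \<Longrightarrow> \<psi> y = 0"
    and d: "\<And>y t. ((\<lambda>t. \<psi> (y + t *\<^sub>R axis i 1)) has_real_derivative \<psi>' (y + t *\<^sub>R axis i 1)) (at t)"
    and f: "continuous_on UNIV f" "has_partials i f" "continuous_on UNIV (partial_deriv i f)" and r: "r > 0"
  shows "average \<psi>' f x r = - r *\<^sub>R average \<psi> (partial_deriv i f) x r"
proof -
  have "(- (1 / r)) *\<^sub>R average \<psi>' f x r = average \<psi> (partial_deriv i f) x r"
    by (rule vector_derivative_unique_at[OF kernel_derivative partial_under_integral]) (use assms in auto)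
  then have "- r *\<^sub>R (- (1 / r)) *\<^sub>R average \<psi>' f x r = - r *\<^sub>R average \<psi> (partial_deriv i f) x r"
    by simp
  then show ?thesis using r by simp
qed

section \<open>Harmonic functions have the mean value property\<close>

definition bump_mass :: "'n::finite itself \<Rightarrow> real" where
  "bump_mass _ = integral big_box (bump 3 :: real ^ 'n \<Rightarrow> real)"

lemma bump_mass_pos: "bump_mass TYPE('n::finite) > 0"
proof -
  let ?I = "integral big_box (bump 3 :: real ^ 'n \<Rightarrow> real)"
  have c: "continuous_on big_box (bump 3 :: real ^ 'n \<Rightarrow> real)"
    using continuous_on_bump[OF continuous_on_id] by simp
  then have i: "(bump 3 :: real ^ 'n \<Rightarrow> real) integrable_on big_box"
    unfolding big_box_def by (rule integrable_continuous)
  have "?I \<ge> 0" by (intro integral_nonneg i bump_nonneg)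
  moreover have "?I \<noteq> 0"
  proof
    assume "?I = 0"
    then have "((bump 3 :: real ^ 'n \<Rightarrow> real) has_integral 0) big_box" using i by (metis integrable_integral)
    then have "bump 3 (0 :: real ^ 'n) = 0"
      using has_integral_0_cbox_imp_0[of "\<chi> i. - 2" "\<chi> i. 2" "bump 3 :: real ^ 'n \<Rightarrow> real" 0] c
      unfolding big_box_def by (auto simp: bump_nonneg mem_box_cart interval_eq_empty_cart)
    then show False by (simp add: bump_def)
  qed
  ultimately show ?thesis by (simp add: bump_mass_def)
qed

text \<open>Averages over spheres would need surface measure. A fixed radial weight at all scales \<open>r\<close> is just as strong
and only needs integrals over a box.\<close>
definition mean_value :: "(real ^ 'n \<Rightarrow> complex) \<Rightarrow> bool" where
  "mean_value f \<longleftrightarrow> continuous_on UNIV f \<and> (\<forall>x. \<forall>r>0.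
     average (bump 3) f x r = bump_mass TYPE('n) *\<^sub>R f x)"

lemma differentiable_directional:
  fixes f :: "real ^ 'n \<Rightarrow> complex"
  assumes "\<And>x. f differentiable (at x)"
  shows "((\<lambda>t. f (x + t *\<^sub>R v)) has_vector_derivative (\<Sum>i\<in>UNIV. v $ i *\<^sub>R partial_deriv i f (x + t *\<^sub>R v))) (at t)"
    and "has_partials i f"
proof -
  have *: "\<exists>L. linear L \<and> (\<forall>v. ((\<lambda>t. f (x + t *\<^sub>R v)) has_vector_derivative L v) (at 0))" for x
  proof -
    obtain L where L: "(f has_derivative L) (at x)" using assms by (auto simp: differentiable_def)
    then have lin: "linear L" by (rule has_derivative_linear)
    have "((\<lambda>t. f (x + t *\<^sub>R v)) has_vector_derivative L v) (at 0)" for v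
    proof -
      have "((\<lambda>t. x + t *\<^sub>R v) has_derivative (\<lambda>t. t *\<^sub>R v)) (at 0)"
        by (auto intro!: derivative_eq_intros)
      from diff_chain_at[OF this, of f L] L
      have "((\<lambda>t. f (x + t *\<^sub>R v)) has_derivative (\<lambda>t. L (t *\<^sub>R v))) (at 0)"
        by (simp add: o_def)
      then show ?thesis using lin by (simp add: has_vector_derivative_def linear_scale)
    qed
    with lin show ?thesis by auto
  qed
  have pd: "((\<lambda>t. f (x + t *\<^sub>R axis i 1)) has_vector_derivative partial_deriv i f x) (at 0)" for x i
    using * unfolding partial_deriv_def by (metis vector_derivative_at)
  then show "has_partials i f" by (simp add: has_partials_def)
  have "((\<lambda>t. f (x + t *\<^sub>R v)) has_vector_derivative (\<Sum>i\<in>UNIV. v $ i *\<^sub>R partial_deriv i f x)) (at 0)" for x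
  proof -
    obtain L where L: "linear L" "\<And>v. ((\<lambda>t. f (x + t *\<^sub>R v)) has_vector_derivative L v) (at 0)"
      using * by blast
    have "L v = L (\<Sum>i\<in>UNIV. v $ i *\<^sub>R axis i 1)"
      by (simp add: basis_expansion[of v, unfolded scalar_mult_eq_scaleR])
    also have "\<dots> = (\<Sum>i\<in>UNIV. v $ i *\<^sub>R L (axis i 1))"
      using L(1) by (simp add: linear_sum linear_scale)
    also have "\<dots> = (\<Sum>i\<in>UNIV. v $ i *\<^sub>R partial_deriv i f x)"
      using vector_derivative_unique_at[OF L(2) pd] by simp
    finally show ?thesis using L(2)[of v] by simp
  qed
  from has_vector_derivative_shift_axis[OF this]
  show "((\<lambda>t. f (x + t *\<^sub>R v)) has_vector_derivative (\<Sum>i\<in>UNIV. v $ i *\<^sub>R partial_deriv i f (x + t *\<^sub>R v))) (at t)" .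
qed

text \<open>The average \<open>A(r)\<close> is constant in \<open>r\<close>: its derivative is \<open>\<Sum>\<^sub>i \<integral> y\<^sub>i bump\<^sub>3(y) \<partial>\<^sub>i u(x + r y) dy\<close>, the factor
\<open>y\<^sub>i bump\<^sub>3\<close> is \<open>\<partial>\<^sub>i (- bump\<^sub>4 / 8)\<close> because the kernel is radial, and integration by parts produces the Laplacian of \<open>u\<close>.
At \<open>r = 0\<close> the average is the mass times \<open>u(x)\<close>.\<close>
theorem harmonic_mean_value:
  fixes u :: "real ^ 'n \<Rightarrow> complex"
  assumes "harmonic u"
  shows "mean_value u"
proof -
  have d1: "\<And>x. u differentiable (at x)" and d2: "\<And>i x. partial_deriv i u differentiable (at x)"
    and c2: "\<And>i. continuous_on UNIV (partial_deriv i (partial_deriv i u))"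
    and lap: "\<And>x. (\<Sum>i\<in>UNIV. partial_deriv i (partial_deriv i u) x) = 0"
    using assms by (auto simp: harmonic_def numeral_2_eq_2 laplacian_def)
  have c0: "continuous_on UNIV u" and c1: "continuous_on UNIV (partial_deriv i u)" for i
    using d1 d2 by (auto simp: differentiable_imp_continuous_on differentiable_on_def)
  note [continuous_intros] = continuous_on_composeU[OF c0] continuous_on_composeU[OF c1] continuous_on_composeU[OF c2]
  show ?thesis unfolding mean_value_def
  proof (intro conjI allI impI c0)
    fix x and r :: real assume r: "r > 0"
    define A where "A s = average (bump 3) u x s" for s
    have "((\<lambda>s. bump 3 y *\<^sub>R u (x + s *\<^sub>R y)) has_vector_derivative
        bump 3 y *\<^sub>R (\<Sum>i\<in>UNIV. y $ i *\<^sub>R partial_deriv i u (x + s *\<^sub>R y))) (at s)" for y s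
      using has_vector_derivative_scaleR[OF DERIV_const differentiable_directional(1)[OF d1]] by fastforce
    then have A: "(A has_vector_derivative
       integral big_box (\<lambda>y. bump 3 y *\<^sub>R (\<Sum>i\<in>UNIV. y $ i *\<^sub>R partial_deriv i u (x + s *\<^sub>R y)))) (at s)" for s
      unfolding A_def big_box_def
      by (intro leibniz_rule_vector_derivative[where U = UNIV])
        (auto intro!: integrable_continuous continuous_intros simp: split_beta)
    have zero: "integral big_box (\<lambda>y. bump 3 y *\<^sub>R (\<Sum>i\<in>UNIV. y $ i *\<^sub>R partial_deriv i u (x + s *\<^sub>R y))) = 0"
      if s: "s > 0" for s
    proof -
      (* The factor -8 is that of the derivative of bump 4. *)
      have parts: "integral big_box (\<lambda>y. (- 8 * (y $ i * bump 3 y)) *\<^sub>R partial_deriv i u (x + s *\<^sub>R y))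
         = - s *\<^sub>R average (bump 4) (partial_deriv i (partial_deriv i u)) x s" for i
        by (rule integration_by_parts_kernel)
          (use has_derivative_bump[of 2 _ i] s differentiable_directional(2)[OF d2] in 
            \<open>auto intro!: continuous_intros c1 c2 simp: bump_eq_0 numeral_eq_Suc\<close>)
      have "integral big_box (\<lambda>y. bump 3 y *\<^sub>R (\<Sum>i\<in>UNIV. y $ i *\<^sub>R partial_deriv i u (x + s *\<^sub>R y)))
        = integral big_box (\<lambda>y. \<Sum>i\<in>UNIV. (- 1 / 8) *\<^sub>R ((- 8 * (y $ i * bump 3 y)) *\<^sub>R partial_deriv i u (x + s *\<^sub>R y)))"
        by (simp add: scaleR_sum_right mult.commute)
      also have "\<dots> = (\<Sum>i\<in>UNIV. (- 1 / 8) *\<^sub>R integral big_box (\<lambda>y. ((- 8 * (y $ i * bump 3 y)) *\<^sub>R partial_deriv i u (x + s *\<^sub>R y))))"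
        unfolding big_box_def
        by (subst integral_sum) (auto intro!: integrable_continuous continuous_intros simp del: scaleR_scaleR)
      also have "\<dots> = (s / 8) *\<^sub>R (\<Sum>i\<in>UNIV. average (bump 4) (partial_deriv i (partial_deriv i u)) x s)"
        unfolding parts by (simp add: scaleR_sum_right)
      also have "\<dots> = (s / 8) *\<^sub>R (integral big_box (\<lambda>y. bump 4 y *\<^sub>R (\<Sum>i\<in>UNIV. partial_deriv i (partial_deriv i u) (x + s *\<^sub>R y))))"
        unfolding big_box_def scaleR_sum_right[of "bump 4 _"]
        by (subst integral_sum) (auto intro!: integrable_continuous continuous_intros)
      finally show ?thesis using lap by simp
    qed
    have "A r = A 0"
    proof (rule has_derivative_zero_unique_strong_interval[where k = "{0}" and a = 0 and b = r])
      show "continuous_on {0..r} A"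
        by (intro continuous_at_imp_continuous_on ballI) (use A has_vector_derivative_continuous in blast)
      fix s assume "s \<in> {0..r} - {0}"
      then have "(A has_vector_derivative 0) (at s)" using A[of s] zero[of s] by auto
      then show "(A has_derivative (\<lambda>h. 0)) (at s within {0..r})"
        by (auto simp: has_vector_derivative_def intro: has_derivative_at_withinI)
    qed (use r in auto)
    also have "A 0 = bump_mass TYPE('n) *\<^sub>R u x"
      unfolding A_def bump_mass_def
      by (simp add: big_box_def integral_unique[OF has_integral_scaleR_left[OF integrable_integral]]
         integrable_continuous continuous_on_bump[OF continuous_on_id])
    finally show "average (bump 3) u x r = bump_mass TYPE('n) *\<^sub>R u x"
      by (simp add: A_def)
  qed
qed

section \<open>Derivatives of functions with the mean value property\<close>

text \<open>First and second partial derivatives of \<open>bump 3\<close>, in closed form.\<close>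
definition dbump :: "'n \<Rightarrow> real ^ 'n \<Rightarrow> real" where
  "dbump i y = - 6 * (y $ i * bump 2 y)"

definition ddbump :: "'n \<Rightarrow> 'n \<Rightarrow> real ^ 'n \<Rightarrow> real" where
  "ddbump j i y = 24 * (y $ i * y $ j * bump 1 y) - (if i = j then 6 * bump 2 y else 0)"

lemma continuous_on_dbump: "continuous_on UNIV (dbump i)" "continuous_on UNIV (ddbump j i)"
proof -
  show "continuous_on UNIV (dbump i)"
    unfolding dbump_def by (intro continuous_intros)
  show "continuous_on UNIV (ddbump j i)"
    unfolding ddbump_def by (cases "i = j") (auto intro!: continuous_intros)
qed

lemma has_derivative_bump3: 
  "((\<lambda>t. bump 3 (y + t *\<^sub>R axis i 1)) has_real_derivative dbump i (y + t *\<^sub>R axis i 1)) (at t)"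
  using has_derivative_bump[of 1 y i t] by (simp add: dbump_def numeral_eq_Suc)

lemma has_derivative_dbump: 
  "((\<lambda>t. dbump i (y + t *\<^sub>R axis j 1)) has_real_derivative ddbump j i (y + t *\<^sub>R axis j 1)) (at t)"
proof -
  have "((\<lambda>t. (y + t *\<^sub>R axis j 1) $ i) has_real_derivative (if i = j then 1 else 0)) (at t)"
    by (auto simp: axis_def intro!: derivative_eq_intros)
  from DERIV_cmult[OF DERIV_mult[OF this has_derivative_bump[of 0 y j t]], of "-6"]
  show ?thesis unfolding dbump_def ddbump_def
    by (auto simp: algebra_simps numeral_2_eq_2 split: if_splits)
qed

text \<open>The mean value identity expresses \<open>f\<close> as an average, whose derivative falls on the kernel. This yields existence
and continuity of the partial derivative; differentiating the identity once more under the integral shows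
that the derivative satisfies it as well, so the argument can be iterated.\<close>
lemma mean_value_partial:
  fixes f :: "real ^ 'n \<Rightarrow> complex"
  assumes "mean_value f"
  shows "has_partials i f"
    and "r > 0 \<Longrightarrow> partial_deriv i f x =
      (- 1 / (r * bump_mass TYPE('n))) *\<^sub>R average (dbump i) f x r"
    and "mean_value (partial_deriv i f)"
proof -
  have c: "continuous_on UNIV f" 
    and mv: "\<And>x r. r > 0 \<Longrightarrow> average (bump 3) f x r = bump_mass TYPE('n) *\<^sub>R f x"
    using assms by (auto simp: mean_value_def)
  have K: "bump_mass TYPE('n) \<noteq> 0" using bump_mass_pos[where ?'n = 'n] by simp
  have d: "((\<lambda>t. f (x + t *\<^sub>R axis i 1)) has_vector_derivative (- 1 / (r * bump_mass TYPE('n))) *\<^sub>R average (dbump i) f x r) (at 0)"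
    if r: "r > 0" for x and r :: real
  proof -
    have "((\<lambda>t. average (bump 3) f (x + t *\<^sub>R axis i 1) r) has_vector_derivative
       (- (1 / r)) *\<^sub>R average (dbump i) f x r) (at 0)"
      by (intro kernel_derivative has_derivative_bump3 continuous_on_dbump continuous_intros c r)
        (auto simp: bump_eq_0)
    then have "((\<lambda>t. bump_mass TYPE('n) *\<^sub>R f (x + t *\<^sub>R axis i 1)) has_vector_derivative
       (- (1 / r)) *\<^sub>R average (dbump i) f x r) (at 0)"
      using r by (simp add: mv)
    from has_vector_derivative_scaleR[OF DERIV_const this, of "1 / bump_mass TYPE('n)"] K
    show ?thesis by (simp add: mult.commute)
  qed
  show hp: "has_partials i f" using has_partialsI(1)[OF d[of 1]] by simp
  show eq: "partial_deriv i f x =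
      (- 1 / (r * bump_mass TYPE('n))) *\<^sub>R average (dbump i) f x r" if "r > 0" for r x
    using has_partialsI(2)[OF d[OF that]] by simp
  note [continuous_intros] = continuous_on_composeU[OF c] continuous_on_composeU[OF continuous_on_dbump(1)]
  have "continuous_on UNIV (\<lambda>x. average (dbump i) f x 1)"
    unfolding big_box_def
    by (rule integral_continuous_on_param) (auto simp: split_beta intro!: continuous_intros)
  then have "continuous_on UNIV (\<lambda>x. (- 1 / (1 * bump_mass TYPE('n))) *\<^sub>R average (dbump i) f x 1)"
    by (intro continuous_intros)
  then have c': "continuous_on UNIV (partial_deriv i f)"
    using eq[of 1] by (simp add: fun_eq_iff[symmetric])
  have "average (bump 3) (partial_deriv i f) x r = bump_mass TYPE('n) *\<^sub>R partial_deriv i f x" 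
    if r: "r > 0" for x r
  proof (rule vector_derivative_unique_at)
    show "((\<lambda>t. average (bump 3) f (x + t *\<^sub>R axis i 1) r) has_vector_derivative
      average (bump 3) (partial_deriv i f) x r) (at 0)"
      by (intro partial_under_integral c hp c' continuous_intros)
    show "((\<lambda>t. average (bump 3) f (x + t *\<^sub>R axis i 1) r) has_vector_derivative
      bump_mass TYPE('n) *\<^sub>R partial_deriv i f x) (at 0)"
      unfolding mv[OF r] using hp has_vector_derivative_scaleR[OF DERIV_const, of _ _ 0 UNIV "bump_mass TYPE('n)"]
      by (fastforce simp: has_partials_def)
  qed
  with c' show "mean_value (partial_deriv i f)" by (simp add: mean_value_def)
qed

text \<open>Both mixed derivatives are averages of \<open>f\<close> against the second derivative of the kernel, which is symmetric
by inspection.\<close>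
lemma mean_value_partials_commute:
  fixes f :: "real ^ 'n \<Rightarrow> complex"
  assumes "mean_value f"
  shows "partial_deriv i (partial_deriv j f) = partial_deriv j (partial_deriv i f)"
proof -
  have c: "continuous_on UNIV f" using assms by (simp add: mean_value_def)
  have *: "partial_deriv j (partial_deriv i f) =
     (\<lambda>x. (1 / bump_mass TYPE('n)) *\<^sub>R average (ddbump j i) f x 1)" for i j
  proof (rule has_partialsI(2))
    fix x
    have "((\<lambda>t. integral big_box (\<lambda>y. dbump i y *\<^sub>R f (x + t *\<^sub>R axis j 1 + 1 *\<^sub>R y))) has_vector_derivative
       (- (1 / 1)) *\<^sub>R average (ddbump j i) f x 1) (at 0)"
      by (intro kernel_derivative has_derivative_dbump continuous_on_dbump c)
        (auto simp: bump_eq_0 dbump_def)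
    from has_vector_derivative_scaleR[OF DERIV_const this, of "- 1 / (1 * bump_mass TYPE('n))"]
    show "((\<lambda>t. partial_deriv i f (x + t *\<^sub>R axis j 1)) has_vector_derivative
        (1 / bump_mass TYPE('n)) *\<^sub>R average (ddbump j i) f x 1) (at 0)"
      by (subst mean_value_partial(2)[OF assms, of 1]) auto
  qed
  have "ddbump i j y = ddbump j i y" for y :: "real ^ 'n" by (simp add: ddbump_def mult_ac)
  then show ?thesis unfolding * by simp
qed

text \<open>The representation by the derivative of the kernel carries a factor \<open>1 / r\<close>, and all \<open>r\<close> are admissible.\<close>
lemma mean_value_partial_bound:
  obtains A :: real where "A > 0"
    "\<And>(f :: real ^ 'n \<Rightarrow> complex) i x R S. mean_value f \<Longrightarrow> R > 0 \<Longrightarrow> (\<And>z. z \<in> cball x R \<Longrightarrow> norm (f z) \<le> S)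
      \<Longrightarrow> norm (partial_deriv i f x) \<le> A / R * S"
proof -
  have "bounded (big_box :: (real ^ 'n) set)" unfolding big_box_def by (rule bounded_cbox)
  then obtain \<rho> where \<rho>: "\<rho> > 0" "\<And>y :: real ^ 'n. y \<in> big_box \<Longrightarrow> norm y \<le> \<rho>"
    by (auto simp: bounded_pos)
  define K where "K = bump_mass TYPE('n)"
  have K: "K > 0" unfolding K_def by (rule bump_mass_pos)
  have int: "(\<lambda>y. \<bar>dbump i y\<bar>) integrable_on (big_box :: (real ^ 'n) set)" for i
    unfolding big_box_def
    by (intro integrable_continuous continuous_intros continuous_on_subset[OF continuous_on_dbump(1)]) auto
  define J :: "'n \<Rightarrow> real" where "J i = integral big_box (\<lambda>y. \<bar>dbump i y\<bar>)" for i
  have J: "J i \<ge> 0" for i unfolding J_def by (intro integral_nonneg int) auto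
  define A where "A = \<rho> / K * (1 + (\<Sum>i\<in>UNIV. J i))"
  have "A > 0" unfolding A_def using \<rho> K J by (intro mult_pos_pos divide_pos_pos add_pos_nonneg sum_nonneg) auto
  moreover have "norm (partial_deriv i f x) \<le> A / R * S" 
    if f: "mean_value f" and R: "R > 0" and S: "\<And>z. z \<in> cball x R \<Longrightarrow> norm (f z) \<le> S" for f :: "real ^ 'n \<Rightarrow> complex" and i x R S
  proof -
    (* With this scale the argument x + r y stays in the ball of radius R for all y in the box. *)
    define r where "r = R / \<rho>"
    have r: "r > 0" using \<rho> R by (simp add: r_def)
    have S0: "S \<ge> 0" using order_trans[OF norm_ge_zero S[of x]] R by simp
    have c: "continuous_on UNIV f" using f by (simp add: mean_value_def)
    note [continuous_intros] = continuous_on_composeU[OF c] continuous_on_composeU[OF continuous_on_dbump(1)]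
    have "norm (average (dbump i) f x r) \<le> integral big_box (\<lambda>y. S * \<bar>dbump i y\<bar>)"
    proof (rule integral_norm_bound_integral)
      show "(\<lambda>y. dbump i y *\<^sub>R f (x + r *\<^sub>R y)) integrable_on big_box"
        unfolding big_box_def by (intro integrable_continuous continuous_intros)
      show "(\<lambda>y. S * \<bar>dbump i y\<bar>) integrable_on big_box"
        using integrable_cmul[OF int, of S] by simp
      fix y :: "real ^ 'n" assume y: "y \<in> big_box"
      have "r * norm y \<le> r * \<rho>" using \<rho>(2)[OF y] r by simp
      then have "r * norm y \<le> R" using \<rho> by (simp add: r_def)
      then have "x + r *\<^sub>R y \<in> cball x R" using r by (simp add: dist_norm)
      from S[OF this] show "norm (dbump i y *\<^sub>R f (x + r *\<^sub>R y)) \<le> S * \<bar>dbump i y\<bar>"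
        using mult_left_mono[of "norm (f (x + r *\<^sub>R y))" S "\<bar>dbump i y\<bar>"] by (simp add: mult.commute)
    qed
    also have "\<dots> = S * J i" unfolding J_def by simp
    also have "\<dots> \<le> S * (1 + (\<Sum>i\<in>UNIV. J i))"
      using J S0 by (intro mult_left_mono) (auto intro!: member_le_sum add_increasing)
    finally have b: "norm (average (dbump i) f x r) \<le> S * (1 + (\<Sum>i\<in>UNIV. J i))" .
    have "norm (partial_deriv i f x) = 1 / (r * K) * norm (average (dbump i) f x r)"
      unfolding mean_value_partial(2)[OF f r] K_def[symmetric] using r K by simp
    also have "\<dots> \<le> 1 / (r * K) * (S * (1 + (\<Sum>i\<in>UNIV. J i)))"
      using b r K by (intro mult_left_mono) auto
    also have "\<dots> = A / R * S" unfolding A_def r_def using \<rho> R by (simp add: field_simps)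
    finally show ?thesis .
  qed
  ultimately show ?thesis using that by blast
qed

section \<open>Sums over vectors and over fibres\<close>

text \<open>If no factor has norm sum 0, the infinite sum of the norms of the products is a product of nonzero
numbers; a divergent family would have been assigned the value 0.\<close>
lemma abs_summable_prod_PiE:
  fixes f :: "'a \<Rightarrow> 'b \<Rightarrow> 'c :: {real_normed_field, banach}"
  assumes A: "finite A" and f: "\<And>x. x \<in> A \<Longrightarrow> f x abs_summable_on B x"
  shows "(\<lambda>g. \<Prod>x\<in>A. f x (g x)) abs_summable_on PiE A B"
proof (cases "\<exists>x\<in>A. infsum (\<lambda>y. norm (f x y)) (B x) = 0")
  case True
  then obtain x where x: "x \<in> A" "infsum (\<lambda>y. norm (f x y)) (B x) = 0" by blast
  then have "f x y = 0" if "y \<in> B x" for y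
    using nonneg_infsum_le_0D[of "\<lambda>y. norm (f x y)" "B x" y] f[of x] that by auto
  then have "(\<Prod>x\<in>A. f x (g x)) = 0" if "g \<in> PiE A B" for g
    using A x that by (intro prod_zero) (auto simp: PiE_iff)
  then have "(\<lambda>g. norm (\<Prod>x\<in>A. f x (g x))) summable_on PiE A B \<longleftrightarrow> (\<lambda>_. 0 :: real) summable_on PiE A B"
    by (intro summable_on_cong) auto
  then show ?thesis by simp
next
  case False
  have "infsum (\<lambda>g. \<Prod>x\<in>A. norm (f x (g x))) (PiE A B) = (\<Prod>x\<in>A. infsum (\<lambda>y. norm (f x y)) (B x))"
    by (rule infsum_prod_PiE_abs[OF A]) (use f in auto)
  also have "\<dots> \<noteq> 0" using False A by auto
  finally show ?thesis using infsum_not_exists by (fastforce simp: prod_norm)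
qed

lemma bij_betw_vec_lambda_PiE:
  "bij_betw vec_lambda (PiE UNIV A) {\<beta> :: 'b ^ 'n. \<forall>i. \<beta> $ i \<in> A i}"
  by (rule bij_betwI[where g = vec_nth]) (auto simp: PiE_iff)

lemma prod_vec_sum:
  fixes f :: "'n::finite \<Rightarrow> 'b \<Rightarrow> 'c :: {real_normed_field, banach}"
  assumes f: "\<And>i. f i abs_summable_on A i"
  shows "(\<lambda>\<beta> :: 'b ^ 'n. \<Prod>i\<in>UNIV. f i (\<beta> $ i)) abs_summable_on {\<beta>. \<forall>i. \<beta> $ i \<in> A i}"
    and "((\<lambda>\<beta> :: 'b ^ 'n. \<Prod>i\<in>UNIV. f i (\<beta> $ i)) has_sum (\<Prod>i\<in>UNIV. infsum (f i) (A i))) {\<beta>. \<forall>i. \<beta> $ i \<in> A i}"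
proof -
  have "(\<lambda>g. \<Prod>i\<in>UNIV. f i (g i)) abs_summable_on PiE UNIV A"
    by (rule abs_summable_prod_PiE) (use f in auto)
  then show abs: "(\<lambda>\<beta> :: 'b ^ 'n. \<Prod>i\<in>UNIV. f i (\<beta> $ i)) abs_summable_on {\<beta>. \<forall>i. \<beta> $ i \<in> A i}"
    by (subst summable_on_reindex_bij_betw[OF bij_betw_vec_lambda_PiE, symmetric]) simp
  have "infsum (\<lambda>\<beta> :: 'b ^ 'n. \<Prod>i\<in>UNIV. f i (\<beta> $ i)) {\<beta>. \<forall>i. \<beta> $ i \<in> A i}
      = infsum (\<lambda>g. \<Prod>i\<in>UNIV. f i (g i)) (PiE UNIV A)"
    by (subst infsum_reindex_bij_betw[OF bij_betw_vec_lambda_PiE, symmetric]) simp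
  also have "\<dots> = (\<Prod>i\<in>UNIV. infsum (f i) (A i))"
    by (rule infsum_prod_PiE_abs) (use f in auto)
  finally show "((\<lambda>\<beta> :: 'b ^ 'n. \<Prod>i\<in>UNIV. f i (\<beta> $ i)) has_sum (\<Prod>i\<in>UNIV. infsum (f i) (A i))) {\<beta>. \<forall>i. \<beta> $ i \<in> A i}"
    using has_sum_infsum[OF abs_summable_summable[OF abs]] by simp
qed

text \<open>The rearrangements of multiple series below have this form: a family is summed along the fibres of two
different maps, and the two resulting sums agree.\<close>
lemma has_sum_fibers:
  fixes f :: "'a \<Rightarrow> 'c :: {topological_comm_monoid_add, t3_space}"
  assumes f: "(f has_sum s) UNIV" and g: "\<And>y. (f has_sum g y) {x. \<phi> x = y}"
  shows "(g has_sum s) UNIV"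
proof (rule has_sum_SigmaD[where f = "\<lambda>(y, x). f x" and B = "\<lambda>y. {x. \<phi> x = y}"])
  show "((\<lambda>(y, x). f x) has_sum s) (SIGMA y:UNIV. {x. \<phi> x = y})"
    by (subst has_sum_reindex_bij_witness[where j = snd and i = "\<lambda>x. (\<phi> x, x)" and T = UNIV and h = f])
      (use f in auto)
qed (use g in auto)

lemma has_sum_fibers_infsum:
  fixes f :: "'a \<Rightarrow> 'c :: banach"
  assumes "f summable_on UNIV"
  shows "((\<lambda>y. infsum f {x. \<phi> x = y}) has_sum infsum f UNIV) UNIV"
proof (rule has_sum_fibers[OF has_sum_infsum[OF assms]])
  show "(f has_sum infsum f {x. \<phi> x = y}) {x. \<phi> x = y}" for y
    by (rule has_sum_infsum[OF summable_on_subset_banach[OF assms]]) simp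
qed

lemma abs_summable_times:
  fixes f :: "'a \<Rightarrow> 'c :: {real_normed_field, banach}"
  assumes f: "f abs_summable_on A" and g: "g abs_summable_on B"
  shows "(\<lambda>(x, y). f x * g y) abs_summable_on A \<times> B"
proof (rule summable_on_SigmaI[where g = "\<lambda>x. norm (f x) * infsum (\<lambda>y. norm (g y)) B"])
  show "((\<lambda>y. norm (case (x, y) of (x, y) \<Rightarrow> f x * g y)) has_sum norm (f x) * infsum (\<lambda>y. norm (g y)) B) B" for x
    using has_sum_cmult_right[OF has_sum_infsum[OF g]] by (simp add: norm_mult)
qed (use summable_on_cmult_left[OF f] in auto)

lemma has_sum_times:
  fixes f :: "'a \<Rightarrow> 'c :: {real_normed_field, banach}"
  assumes f: "f abs_summable_on A" "(f has_sum S) A" and g: "g abs_summable_on B" "(g has_sum T) B"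
  shows "((\<lambda>(x, y). f x * g y) has_sum S * T) (A \<times> B)"
proof (rule has_sum_SigmaI)
  show "((\<lambda>x. f x * T) has_sum S * T) A" by (rule has_sum_cmult_left[OF f(2)])
  show "((\<lambda>y. case (x, y) of (x, y) \<Rightarrow> f x * g y) has_sum f x * T) B" for x
    using has_sum_cmult_right[OF g(2)] by simp
  show "(\<lambda>(x, y). f x * g y) summable_on (A \<times> B)"
    using abs_summable_summable[OF abs_summable_times[OF f(1) g(1)]] .
qed

lemma abs_summable_dominated:
  fixes f :: "'a \<Rightarrow> 'c :: banach"
  assumes "g abs_summable_on A" "\<And>x. x \<in> A \<Longrightarrow> norm (f x) \<le> norm (g x)"
  shows "f abs_summable_on A" "f summable_on A"
proof -
  show "f abs_summable_on A" by (rule Infinite_Sum.abs_summable_on_comparison_test'[OF assms])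
  then show "f summable_on A" by (rule abs_summable_summable)
qed

section \<open>Global Taylor expansion\<close>

lemma power_self_le_fact_exp: "real b ^ b \<le> fact b * exp (real b)"
proof -
  have "(\<Sum>n\<in>{b}. real b ^ n /\<^sub>R fact n) \<le> exp (real b)"
    unfolding exp_def by (rule sum_le_suminf[OF summable_exp_generic]) auto
  then show ?thesis by (simp add: field_simps)
qed

lemma mean_value_iter: "mean_value f \<Longrightarrow> mean_value ((partial_deriv i ^^ b) f)"
  by (induction b) (auto intro: mean_value_partial)

text \<open>Applying the first-order bound \<open>b\<close> times on balls of radius \<open>R / b\<close> costs \<open>b\<^sup>b\<close>, which is at most \<open>e\<^sup>b b!\<close>.\<close>
lemma mean_value_iter_bound:
  obtains A :: real where "A > 0"
    "\<And>(f :: real ^ 'n \<Rightarrow> complex) i b x R S. mean_value f \<Longrightarrow> R > 0 \<Longrightarrow> (\<And>z. z \<in> cball x R \<Longrightarrow> norm (f z) \<le> S)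
      \<Longrightarrow> norm ((partial_deriv i ^^ b) f x) \<le> fact b * (A / R) ^ b * S"
proof -
  obtain A where A: "A > 0"
    "\<And>(f :: real ^ 'n \<Rightarrow> complex) i x R S. mean_value f \<Longrightarrow> R > 0 \<Longrightarrow> (\<And>z. z \<in> cball x R \<Longrightarrow> norm (f z) \<le> S)
      \<Longrightarrow> norm (partial_deriv i f x) \<le> A / R * S"
    using mean_value_partial_bound[where ?'n = 'n] by blast
  have small: "norm ((partial_deriv i ^^ b) f x) \<le> (A / \<delta>) ^ b * S"
    if "mean_value f" "\<delta> > 0" "\<And>z. z \<in> cball x (real b * \<delta>) \<Longrightarrow> norm (f z) \<le> S" 
    for f :: "real ^ 'n \<Rightarrow> complex" and i b x \<delta> S
    using that(3)
  proof (induction b arbitrary: x)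
    case (Suc b)
    have "norm ((partial_deriv i ^^ b) f z) \<le> (A / \<delta>) ^ b * S" if z: "z \<in> cball x \<delta>" for z
    proof (rule Suc.IH)
      fix w assume "w \<in> cball z (real b * \<delta>)"
      then have "w \<in> cball x (real (Suc b) * \<delta>)"
        using z dist_triangle[of x w z] by (simp add: algebra_simps)
      then show "norm (f w) \<le> S" by (rule Suc.prems)
    qed
    from A(2)[OF mean_value_iter[OF that(1)] that(2) this, of x i] show ?case by (simp add: mult_ac)
  qed simp
  have "norm ((partial_deriv i ^^ b) f x) \<le> fact b * (A * exp 1 / R) ^ b * S"
    if f: "mean_value f" and R: "R > 0" and S: "\<And>z. z \<in> cball x R \<Longrightarrow> norm (f z) \<le> S"
    for f :: "real ^ 'n \<Rightarrow> complex" and i b x R S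
  proof (cases "b = 0")
    case True
    then show ?thesis using S[of x] R by simp
  next
    case False
    have S0: "S \<ge> 0" using order_trans[OF norm_ge_zero S[of x]] R by simp
    have "norm ((partial_deriv i ^^ b) f x) \<le> (A / (R / b)) ^ b * S"
      by (rule small) (use f R S False in auto)
    also have "(A / (R / b)) ^ b = (A / R) ^ b * real b ^ b"
      using False by (simp add: field_simps power_mult_distrib power_divide)
    also have "\<dots> \<le> (A / R) ^ b * (fact b * exp (real b))"
      using A R by (intro mult_left_mono power_self_le_fact_exp) auto
    also have "\<dots> = fact b * (A * exp 1 / R) ^ b"
      by (simp add: power_mult_distrib power_divide exp_of_nat_mult[symmetric])
    finally show ?thesis using S0 by (simp add: mult_right_mono)
  qed
  with that[of "A * exp 1"] A show ?thesis by simp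
qed

lemma real_taylor_sums:
  fixes diff :: "nat \<Rightarrow> real \<Rightarrow> real"
  assumes d: "\<And>m t. DERIV (diff m) t :> diff (Suc m) t"
    and b: "\<And>m t. \<bar>t\<bar> \<le> \<bar>v\<bar> \<Longrightarrow> \<bar>diff m t\<bar> \<le> fact m * c ^ m * S"
    and c: "c \<ge> 0" "c * \<bar>v\<bar> < 1"
  shows "(\<lambda>m. diff m 0 / fact m * v ^ m) sums diff 0 v"
proof -
  have "norm (diff 0 v - (\<Sum>m<n. diff m 0 / fact m * v ^ m)) \<le> (c * \<bar>v\<bar>) ^ n * S" for n
  proof -
    obtain t where t: "\<bar>t\<bar> \<le> \<bar>v\<bar>" "diff 0 v = (\<Sum>m<n. diff m 0 / fact m * v ^ m) + diff n t / fact n * v ^ n"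
      using Maclaurin_all_le[of diff "diff 0" v n] d by auto
    have "norm (diff 0 v - (\<Sum>m<n. diff m 0 / fact m * v ^ m)) = \<bar>diff n t\<bar> / fact n * \<bar>v\<bar> ^ n"
      unfolding t(2) by (simp add: abs_mult power_abs)
    also have "\<dots> \<le> (fact n * c ^ n * S) / fact n * \<bar>v\<bar> ^ n"
      by (intro mult_right_mono divide_right_mono b t) auto
    finally show ?thesis by (simp add: power_mult_distrib mult_ac)
  qed
  moreover have "(\<lambda>n. (c * \<bar>v\<bar>) ^ n * S) \<longlonglongrightarrow> 0"
    using c by (auto intro!: tendsto_mult_left_zero LIMSEQ_power_zero simp: abs_mult)
  ultimately have "(\<lambda>n. diff 0 v - (\<Sum>m<n. diff m 0 / fact m * v ^ m)) \<longlonglongrightarrow> 0"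
    by (rule Lim_null_comparison[OF always_eventually[OF allI]])
  from tendsto_diff[OF tendsto_const[of "diff 0 v"] this] show ?thesis by (simp add: sums_def)
qed

lemma continuous_bounded_on_cball:
  fixes f :: "real ^ 'n \<Rightarrow> complex"
  assumes "continuous_on UNIV f"
  obtains S where "S > 0" "\<And>z. z \<in> cball p R \<Longrightarrow> norm (f z) \<le> S"
proof -
  have "compact (f ` cball p R)"
    by (intro compact_continuous_image compact_cball continuous_on_subset[OF assms]) auto
  then have "bounded (f ` cball p R)" by (rule compact_imp_bounded)
  then show ?thesis using that by (auto simp: bounded_pos)
qed

text \<open>On a segment of length \<open>|v|\<close> the bounds with \<open>R\<close> much larger than \<open>A |v|\<close> make the Lagrange remainder decay
geometrically.\<close>
lemma mean_value_coordinate_taylor: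
  fixes f :: "real ^ 'n \<Rightarrow> complex"
  assumes f: "mean_value f"
  shows "((\<lambda>b. (partial_deriv i ^^ b) f q / fact b * complex_of_real v ^ b) has_sum f (q + v *\<^sub>R axis i 1)) UNIV"
proof -
  obtain A where A: "A > 0" and bd:
    "\<And>(f :: real ^ 'n \<Rightarrow> complex) i b x R S. mean_value f \<Longrightarrow> R > 0 \<Longrightarrow> (\<And>z. z \<in> cball x R \<Longrightarrow> norm (f z) \<le> S)
      \<Longrightarrow> norm ((partial_deriv i ^^ b) f x) \<le> fact b * (A / R) ^ b * S"
    using mean_value_iter_bound[where ?'n = 'n] by blast
  (* Any R with A |v| / R < 1 works; the summand 1 keeps R positive. *)
  define R where "R = 2 * A * (1 + \<bar>v\<bar>)"
  have R: "R > 0" using A by (simp add: R_def add_pos_nonneg)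
  have c: "A / R \<ge> 0" "A / R * \<bar>v\<bar> < 1" 
    using A R by (auto simp: R_def field_simps add_nonneg_pos)
  have "continuous_on UNIV f" using f by (simp add: mean_value_def)
  then obtain S where S: "S > 0" "\<And>z. z \<in> cball q (R + \<bar>v\<bar>) \<Longrightarrow> norm (f z) \<le> S"
    by (metis continuous_bounded_on_cball)
  define g where "g m t = (partial_deriv i ^^ m) f (q + t *\<^sub>R axis i 1)" for m t
  have gd: "(g m has_vector_derivative g (Suc m) t) (at t)" for m t
    using has_partialsD[OF mean_value_partial(1)[OF mean_value_iter[OF f]]] by (simp add: g_def[abs_def])
  have gb: "norm (g m t) \<le> fact m * (A / R) ^ m * S" if t: "\<bar>t\<bar> \<le> \<bar>v\<bar>" for m t
    unfolding g_def
  proof (rule bd[OF f R])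
    fix z assume "z \<in> cball (q + t *\<^sub>R axis i 1) R"
    then have "z \<in> cball q (R + \<bar>v\<bar>)"
      using t dist_triangle[of q z "q + t *\<^sub>R axis i 1"] by (simp add: dist_norm)
    then show "norm (f z) \<le> S" by (rule S)
  qed
  have "(\<lambda>m. Re (g m 0) / fact m * v ^ m) sums Re (g 0 v)"
    by (rule real_taylor_sums[where diff = "\<lambda>m t. Re (g m t)", OF _ _ c])
      (auto intro: has_field_derivative_Re[OF gd] order_trans[OF abs_Re_le_cmod gb])
  moreover have "(\<lambda>m. Im (g m 0) / fact m * v ^ m) sums Im (g 0 v)"
    by (rule real_taylor_sums[where diff = "\<lambda>m t. Im (g m t)", OF _ _ c])
      (auto intro: has_field_derivative_Im[OF gd] order_trans[OF abs_Im_le_cmod gb])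
  moreover have scale: "g m 0 / fact m * complex_of_real v ^ m = (v ^ m / fact m) *\<^sub>R g m 0" for m
    by (simp add: scaleR_conv_of_real)
  ultimately have "(\<lambda>m. g m 0 / fact m * complex_of_real v ^ m) sums g 0 v"
    unfolding scale sums_complex_iff by (simp add: mult.commute)
  moreover have "summable (\<lambda>m. norm (g m 0 / fact m * complex_of_real v ^ m))"
  proof (rule summable_comparison_test')
    show "summable (\<lambda>m. S * (A / R * \<bar>v\<bar>) ^ m)"
      using c by (intro summable_mult summable_geometric) (use A R in \<open>simp add: abs_mult\<close>)
    show "norm (norm (g m 0 / fact m * complex_of_real v ^ m)) \<le> S * (A / R * \<bar>v\<bar>) ^ m" for m
    proof -
      have "norm (g m 0 / fact m * complex_of_real v ^ m) = norm (g m 0) / fact m * \<bar>v\<bar> ^ m"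
        by (simp add: norm_mult norm_divide norm_power)
      also have "\<dots> \<le> (fact m * (A / R) ^ m * S) / fact m * \<bar>v\<bar> ^ m"
        by (intro mult_right_mono divide_right_mono gb) auto
      also have "\<dots> = S * (A / R * \<bar>v\<bar>) ^ m" by (simp only: power_mult_distrib) simp
      finally show ?thesis by simp
    qed
  qed
  ultimately show ?thesis using norm_summable_imp_has_sum[of "\<lambda>m. g m 0 / fact m * complex_of_real v ^ m" "g 0 v"]
    by (simp add: g_def)
qed

text \<open>The multi-index derivative along an arbitrary list of coordinates; it makes induction over the
coordinates possible.\<close>
abbreviation derivs_along :: "'n list \<Rightarrow> ('n \<Rightarrow> nat) \<Rightarrow> (real ^ 'n \<Rightarrow> complex) \<Rightarrow> real ^ 'n \<Rightarrow> complex" where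
  "derivs_along xs \<beta> f \<equiv> foldr (\<lambda>i g. (partial_deriv i ^^ \<beta> i) g) xs f"

lemma mean_value_derivs_along: "mean_value f \<Longrightarrow> mean_value (derivs_along xs \<beta> f)"
  by (induction xs) (auto intro: mean_value_iter)

lemma derivs_along_cong: "(\<And>i. i \<in> set xs \<Longrightarrow> \<beta> i = \<gamma> i) \<Longrightarrow> derivs_along xs \<beta> f = derivs_along xs \<gamma> f"
  by (induction xs) auto

text \<open>Expanding one coordinate at a time needs no multinomial formula: the outermost derivative of the list is
expanded around \<open>p\<close>, and the induction hypothesis is used at the point already moved in that coordinate. The
coordinatewise derivative bounds give a product of geometric series as majorant.\<close>
lemma mean_value_taylor_list:
  fixes f :: "real ^ 'n \<Rightarrow> complex"
  assumes f: "mean_value f" and xs: "distinct xs"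
  shows "((\<lambda>\<beta>. derivs_along xs \<beta> f p * (\<Prod>i\<in>set xs. complex_of_real (v i) ^ \<beta> i / fact (\<beta> i)))
     has_sum f (p + (\<Sum>i\<in>set xs. v i *\<^sub>R axis i 1))) (PiE (set xs) (\<lambda>_. UNIV))"
  using xs
proof (induction xs arbitrary: p)
  case Nil
  then show ?case by (simp add: has_sum_finite_iff)
next
  case (Cons j xs)
  let ?P = "PiE (set xs) (\<lambda>_. UNIV :: nat set)"
  let ?T = "\<lambda>xs \<beta>. derivs_along xs \<beta> f p * (\<Prod>i\<in>set xs. complex_of_real (v i) ^ \<beta> i / fact (\<beta> i))"
  have j: "j \<notin> set xs" and dist: "distinct xs" using Cons.prems by auto
  obtain A where A: "A > 0" and bd:
    "\<And>(f :: real ^ 'n \<Rightarrow> complex) i b x R S. mean_value f \<Longrightarrow> R > 0 \<Longrightarrow> (\<And>z. z \<in> cball x R \<Longrightarrow> norm (f z) \<le> S)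
      \<Longrightarrow> norm ((partial_deriv i ^^ b) f x) \<le> fact b * (A / R) ^ b * S"
    using mean_value_iter_bound[where ?'n = 'n] by blast
  (* One radius for all coordinates, large enough for every ratio A |v i| / R to be below 1. *)
  define R where "R = 2 * A * (1 + (\<Sum>i\<in>UNIV. \<bar>v i\<bar>))"
  have R: "R > 0" using A by (simp add: R_def add_pos_nonneg sum_nonneg)
  have c: "A / R * \<bar>v i\<bar> < 1" for i
  proof -
    have "\<bar>v i\<bar> \<le> (\<Sum>i\<in>UNIV. \<bar>v i\<bar>)" by (rule member_le_sum) auto
    then show ?thesis using A by (simp add: R_def divide_less_eq add_pos_nonneg sum_nonneg mult_pos_pos)
  qed
  obtain S where S: "S > 0" "\<And>z. z \<in> cball p (real (length (j # xs)) * R) \<Longrightarrow> norm (f z) \<le> S"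
    using f by (metis continuous_bounded_on_cball mean_value_def)
  have lb: "norm (derivs_along ys \<beta> f x) \<le> (\<Prod>i\<in>set ys. fact (\<beta> i) * (A / R) ^ \<beta> i) * S"
    if "distinct ys" "\<And>z. z \<in> cball x (real (length ys) * R) \<Longrightarrow> norm (f z) \<le> S" for ys x \<beta>
    using that
  proof (induction ys arbitrary: x)
    case (Cons k ys)
    have "norm (derivs_along ys \<beta> f z) \<le> (\<Prod>i\<in>set ys. fact (\<beta> i) * (A / R) ^ \<beta> i) * S" if z: "z \<in> cball x R" for z
    proof (rule Cons.IH)
      fix w assume "w \<in> cball z (real (length ys) * R)"
      then have "w \<in> cball x (real (length (k # ys)) * R)"
        using z dist_triangle[of x w z] by (simp add: algebra_simps)
      then show "norm (f w) \<le> S" by (rule Cons.prems)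
    qed (use Cons.prems in auto)
    from bd[OF mean_value_derivs_along[OF f] R this] show ?case using Cons.prems by (simp add: mult_ac)
  qed simp
  have "(\<lambda>\<beta>. \<Prod>i\<in>set (j # xs). (A / R * \<bar>v i\<bar>) ^ \<beta> i) abs_summable_on PiE (set (j # xs)) (\<lambda>_. UNIV)"
  proof (rule abs_summable_prod_PiE)
    show "(\<lambda>b. (A / R * \<bar>v i\<bar>) ^ b) abs_summable_on UNIV" for i
      using c[of i] A R by (subst summable_on_UNIV_nonneg_real_iff) (auto intro!: summable_geometric simp: norm_power abs_mult)
  qed simp
  then have "(\<lambda>\<beta>. S * (\<Prod>i\<in>set (j # xs). (A / R * \<bar>v i\<bar>) ^ \<beta> i)) abs_summable_on PiE (set (j # xs)) (\<lambda>_. UNIV)"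
    unfolding norm_mult by (rule summable_on_cmult_right)
  then have "?T (j # xs) summable_on PiE (set (j # xs)) (\<lambda>_. UNIV)"
  proof (rule abs_summable_dominated(2))
    fix \<beta>
    have "norm (?T (j # xs) \<beta>) = norm (derivs_along (j # xs) \<beta> f p) * (\<Prod>i\<in>set (j # xs). \<bar>v i\<bar> ^ \<beta> i / fact (\<beta> i))"
      by (simp only: norm_mult prod_norm[symmetric]) (simp add: norm_divide norm_power)
    also have "\<dots> \<le> ((\<Prod>i\<in>set (j # xs). fact (\<beta> i) * (A / R) ^ \<beta> i) * S) * (\<Prod>i\<in>set (j # xs). \<bar>v i\<bar> ^ \<beta> i / fact (\<beta> i))"
      by (intro mult_right_mono lb Cons.prems S prod_nonneg) auto
    also have "\<dots> = S * (\<Prod>i\<in>set (j # xs). (A / R * \<bar>v i\<bar>) ^ \<beta> i)"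
      unfolding power_mult_distrib prod.distrib prod_dividef by (simp add: field_simps)
    also have "\<dots> \<le> norm \<dots>" by simp
    finally show "norm (?T (j # xs) \<beta>) \<le> norm (S * (\<Prod>i\<in>set (j # xs). (A / R * \<bar>v i\<bar>) ^ \<beta> i))" .
  qed
  moreover have pi: "PiE (set (j # xs)) (\<lambda>_. UNIV) = (\<lambda>(\<beta>, b). \<beta>(j := b)) ` (?P \<times> (UNIV :: nat set))"
    unfolding list.set PiE_insert_eq 
    by (subst swap_product [symmetric]) (simp add: image_image case_prod_unfold)
  have inj: "inj_on (\<lambda>(\<beta>, b). \<beta>(j := b)) (?P \<times> (UNIV :: nat set))"
    using j by (rule inj_combinator')
  have step: "?T (j # xs) (\<beta>(j := b)) = 
     (\<Prod>i\<in>set xs. complex_of_real (v i) ^ \<beta> i / fact (\<beta> i)) * 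
     ((partial_deriv j ^^ b) (derivs_along xs \<beta> f) p / fact b * complex_of_real (v j) ^ b)" for \<beta> b
  proof -
    have "derivs_along xs (\<beta>(j := b)) f = derivs_along xs \<beta> f"
      by (rule derivs_along_cong) (use j in auto)
    moreover have "(\<Prod>i\<in>set xs. complex_of_real (v i) ^ (\<beta>(j := b)) i / fact ((\<beta>(j := b)) i)) = (\<Prod>i\<in>set xs. complex_of_real (v i) ^ \<beta> i / fact (\<beta> i))"
      by (rule prod.cong) (use j in auto)
    ultimately show ?thesis using j by simp
  qed
  have inner: "((\<lambda>b. ((?T (j # xs)) \<circ> (\<lambda>(\<beta>, b). \<beta>(j := b))) (\<beta>, b)) has_sum
      derivs_along xs \<beta> f (p + v j *\<^sub>R axis j 1) * (\<Prod>i\<in>set xs. complex_of_real (v i) ^ \<beta> i / fact (\<beta> i))) UNIV" for \<beta>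
    unfolding o_def case_prod_conv step mult.commute[of "derivs_along xs \<beta> f (p + v j *\<^sub>R axis j 1)"]
    by (intro has_sum_cmult_right mean_value_coordinate_taylor mean_value_derivs_along f)
  ultimately have "((?T (j # xs)) has_sum f (p + v j *\<^sub>R axis j 1 + (\<Sum>i\<in>set xs. v i *\<^sub>R axis i 1))) (PiE (set (j # xs)) (\<lambda>_. UNIV))"
    unfolding pi has_sum_reindex[OF inj] summable_on_reindex[OF inj]
    by (intro has_sum_SigmaI[OF inner Cons.IH[OF dist]]) 
  then show ?case using j by (simp add: add_ac)
qed

section \<open>Multi-index derivatives\<close>

lemma coord_list: "distinct (coord_list :: 'n::finite list)" "set (coord_list :: 'n list) = UNIV"
proof -
  have "\<exists>xs :: 'n list. distinct xs \<and> set xs = UNIV"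
    using finite_distinct_list[of "UNIV :: 'n set"] by auto
  from someI_ex[OF this] show "distinct (coord_list :: 'n::finite list)" "set (coord_list :: 'n list) = UNIV"
    by (auto simp: coord_list_def)
qed

abbreviation divided_power :: "('n \<Rightarrow> complex) \<Rightarrow> nat ^ 'n \<Rightarrow> complex"
  where "divided_power z \<beta> \<equiv> (\<Prod>i\<in>UNIV. z i ^ (\<beta> $ i) / fact (\<beta> $ i))"

lemma mean_value_taylor:
  fixes f :: "real ^ 'n \<Rightarrow> complex"
  assumes f: "mean_value f"
  shows "((\<lambda>\<beta>. mi_deriv \<beta> f p * divided_power (\<lambda>i. complex_of_real (v $ i)) \<beta>)
     has_sum f (p + v)) UNIV"
proof -
  have "v = (\<Sum>i\<in>UNIV. (v $ i) *\<^sub>R axis i 1)"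
    by (simp add: basis_expansion[of v, unfolded scalar_mult_eq_scaleR])
  with mean_value_taylor_list[OF f coord_list(1), of p "vec_nth v"]
  have "((\<lambda>\<beta>. derivs_along coord_list \<beta> f p * (\<Prod>i\<in>UNIV. complex_of_real (v $ i) ^ \<beta> i / fact (\<beta> i)))
     has_sum f (p + v)) (PiE UNIV (\<lambda>_. UNIV))"
    by (simp add: coord_list)
  then show ?thesis
    using has_sum_reindex_bij_betw[OF bij_betw_vec_lambda_PiE[of "\<lambda>_ :: 'n. UNIV :: nat set"], where S = "f (p + v)" and
        f = "\<lambda>\<beta>. mi_deriv \<beta> f p * divided_power (\<lambda>i. complex_of_real (v $ i)) \<beta>"]
    by (simp add: mi_deriv_def)
qed

lemma partial_iter_commute:
  "mean_value f \<Longrightarrow> partial_deriv i ((partial_deriv j ^^ b) f) = (partial_deriv j ^^ b) (partial_deriv i f)"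
proof (induction b)
  case (Suc b)
  then show ?case
    using mean_value_partials_commute[OF mean_value_iter[OF Suc.prems, of b j], of i j] by simp
qed simp

lemma partial_derivs_along_commute:
  "mean_value f \<Longrightarrow> partial_deriv i (derivs_along xs \<beta> f) = derivs_along xs \<beta> (partial_deriv i f)"
  by (induction xs) (simp_all add: partial_iter_commute[OF mean_value_derivs_along])

lemma derivs_along_Suc:
  assumes "mean_value f" "distinct xs" "i \<in> set xs"
  shows "derivs_along xs (\<beta>(i := Suc (\<beta> i))) f = derivs_along xs \<beta> (partial_deriv i f)"
  using assms(2,3)
proof (induction xs)
  case (Cons j xs)
  show ?case
  proof (cases "j = i")
    case True
    then have "derivs_along xs (\<beta>(i := Suc (\<beta> i))) f = derivs_along xs \<beta> f"
      by (intro derivs_along_cong) (use Cons.prems in auto)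
    with True show ?thesis
      by (simp add: funpow_swap1 partial_derivs_along_commute[OF assms(1)])
  qed (use Cons in auto)
qed simp

lemma mi_deriv_add_axis:
  fixes f :: "real ^ 'n \<Rightarrow> complex"
  assumes "mean_value f"
  shows "mi_deriv (\<beta> + axis i 1) f = mi_deriv \<beta> (partial_deriv i f)"
proof -
  have "($) (\<beta> + axis i 1) = (($) \<beta>)(i := Suc (\<beta> $ i))"
    by (auto simp: axis_def)
  then show ?thesis
    unfolding mi_deriv_def using derivs_along_Suc[OF assms coord_list(1), of i "($) \<beta>"] by (simp add: coord_list)
qed

text \<open>Serves to move the Laplacian past an arbitrary multi-index derivative without any linearity
statement for \<^const>\<open>mi_deriv\<close>.\<close>
lemma mean_value_sum_zero_derivs:
  fixes F :: "'k \<Rightarrow> real ^ 'n \<Rightarrow> complex"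
  assumes F: "\<And>k. mean_value (F k)" and "\<And>x. (\<Sum>k\<in>K. F k x) = 0"
  shows "(\<Sum>k\<in>K. derivs_along xs \<beta> (F k) x) = 0"
proof -
  have one: "(\<Sum>k\<in>K. partial_deriv i (F k) x) = 0"
    if F: "\<And>k. mean_value (F k)" and z: "\<And>x. (\<Sum>k\<in>K. F k x) = 0" for F :: "'k \<Rightarrow> real ^ 'n \<Rightarrow> complex" and i x
  proof -
    have "((\<lambda>t. \<Sum>k\<in>K. F k (x + t *\<^sub>R axis i 1)) has_vector_derivative (\<Sum>k\<in>K. partial_deriv i (F k) x)) (at 0)"
      using mean_value_partial(1)[OF F] by (intro has_vector_derivative_sum) (simp add: has_partials_def)
    then show ?thesis unfolding z using vector_derivative_unique_at[OF has_vector_derivative_const] by metis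
  qed
  have iter: "(\<Sum>k\<in>K. (partial_deriv i ^^ b) (F k) x) = 0"
    if F: "\<And>k. mean_value (F k)" and z: "\<And>x. (\<Sum>k\<in>K. F k x) = 0" for F :: "'k \<Rightarrow> real ^ 'n \<Rightarrow> complex" and i b x
    by (induction b arbitrary: x) (use z one[OF mean_value_iter[OF F]] in auto)
  show ?thesis
  proof (induction xs arbitrary: x)
    case (Cons j xs)
    then show ?case using iter[of "\<lambda>k. derivs_along xs \<beta> (F k)", OF mean_value_derivs_along[OF F]] by simp
  qed (use assms(2) in simp)
qed

lemma harmonic_derivs_sum_zero:
  fixes u :: "real ^ 'n \<Rightarrow> complex"
  assumes "harmonic u"
  shows "(\<Sum>i\<in>UNIV. mi_deriv (\<beta> + axis i 2) u x) = 0"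
proof -
  have u: "mean_value u" by (rule harmonic_mean_value[OF assms])
  have "\<beta> + axis i 2 = (\<beta> + axis i 1) + axis i 1" for i
    by (simp add: vec_eq_iff axis_def)
  then have "mi_deriv (\<beta> + axis i 2) u = mi_deriv \<beta> (partial_deriv i (partial_deriv i u))" for i
    by (simp only: mi_deriv_add_axis u mean_value_partial)
  then show ?thesis
    using assms u by (simp add: mi_deriv_def mean_value_sum_zero_derivs mean_value_partial harmonic_def laplacian_def)
qed

section \<open>Uniqueness of Fourier coefficients\<close>

lemma continuous_on_polynomial_cis:
  fixes p :: "complex \<Rightarrow> 'a::euclidean_space"
  assumes "polynomial_function p"
  shows "continuous_on S (\<lambda>t. p (cis (2 * pi * t)))"
  by (rule continuous_on_composeU[OF continuous_on_polymonial_function[OF assms]]) (auto intro!: continuous_intros)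

text \<open>Orthogonality to all characters is inherited when multiplying by a polynomial in \<open>cos\<close> and \<open>sin\<close>. The statement
quantifies over all \<open>r\<close> with this property so that the multiplicative step of the induction closes.\<close>
lemma integral_poly_cis_zero:
  fixes r :: "real \<Rightarrow> complex"
  assumes "real_polynomial_function p" "continuous_on {0..1} r"
    "\<And>k :: int. integral {0..1} (\<lambda>t. r t * cis (2 * pi * k * t)) = 0"
  shows "integral {0..1} (\<lambda>t. r t * complex_of_real (p (cis (2 * pi * t))) * cis (2 * pi * of_int k * t)) = 0"
  using assms
proof (induction arbitrary: r k)
  case (linear f)
  interpret bounded_linear f by fact
  (* A real linear form on the plane is a combination of z and its conjugate. *)
  define \<alpha> \<beta> where "\<alpha> = (complex_of_real (f 1) - \<i> * f \<i>) / 2" and "\<beta> = (complex_of_real (f 1) + \<i> * f \<i>) / 2"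
  have "complex_of_real (f (cis \<theta>)) = \<alpha> * cis \<theta> + \<beta> * cis (- \<theta>)" for \<theta>
  proof -
    have "f (cis \<theta>) = f (cos \<theta> *\<^sub>R 1 + sin \<theta> *\<^sub>R \<i>)" by (simp add: cis_conv_exp exp_Euler scaleR_conv_of_real cos_of_real sin_of_real mult.commute)
    also have "\<dots> = cos \<theta> * f 1 + sin \<theta> * f \<i>" by (simp add: add scaleR)
    finally show ?thesis by (simp add: \<alpha>_def \<beta>_def complex_eq_iff field_simps)
  qed
  moreover have "cis (2 * pi * of_int (k + 1) * t) = cis (2 * pi * t) * cis (2 * pi * of_int k * t)"
    "cis (2 * pi * of_int (k - 1) * t) = cis (- (2 * pi * t)) * cis (2 * pi * of_int k * t)" for t
    by (simp_all add: cis_mult algebra_simps)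
  ultimately have "r t * complex_of_real (f (cis (2 * pi * t))) * cis (2 * pi * of_int k * t) =
    \<alpha> * (r t * cis (2 * pi * of_int (k + 1) * t)) + \<beta> * (r t * cis (2 * pi * of_int (k - 1) * t))" for t
    by (simp only:) (simp only: ring_distribs mult_ac)
  moreover have "integral {0..1} (\<lambda>t. \<alpha> * (r t * cis (2 * pi * of_int (k + 1) * t)) + \<beta> * (r t * cis (2 * pi * of_int (k - 1) * t)))
    = \<alpha> * integral {0..1} (\<lambda>t. r t * cis (2 * pi * of_int (k + 1) * t)) + \<beta> * integral {0..1} (\<lambda>t. r t * cis (2 * pi * of_int (k - 1) * t))"
    by (subst integral_add) (auto intro!: integrable_continuous_interval continuous_intros linear.prems)
  ultimately show ?case using linear.prems(2) by (simp del: of_int_add of_int_diff)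
next
  case (const c)
  have "r t * complex_of_real c * cis (2 * pi * of_int k * t) = complex_of_real c * (r t * cis (2 * pi * of_int k * t))" for t
    by (simp only: mult_ac)
  then show ?case using const.prems by (simp only: integral_mult_right mult_zero_right)
next
  case (add f g)
  have c: "continuous_on {0..1} (\<lambda>t. f (cis (2 * pi * t)))" "continuous_on {0..1} (\<lambda>t. g (cis (2 * pi * t)))"
    using add.hyps by (simp_all add: continuous_on_polynomial_cis real_polynomial_function_eq)
  show ?case
    using add.IH[of r k] add.prems
    by (simp add: ring_distribs, subst integral_add) (auto intro!: integrable_continuous_interval continuous_intros c)
next
  case (mult f g)
  have c: "continuous_on {0..1} (\<lambda>t. f (cis (2 * pi * t)))"
    using mult.hyps by (simp_all add: continuous_on_polynomial_cis real_polynomial_function_eq)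
  have "integral {0..1} (\<lambda>t. (r t * complex_of_real (f (cis (2 * pi * t)))) * complex_of_real (g (cis (2 * pi * t))) * cis (2 * pi * of_int k * t)) = 0"
    by (rule mult.IH(2)) (auto intro!: continuous_intros c mult.prems mult.IH(1))
  then show ?case by (simp add: mult_ac)
qed

text \<open>A periodic function is a function \<open>h\<close> on the unit circle, which polynomials approximate uniformly. As \<open>H\<close>
is orthogonal to polynomials, \<open>\<integral> |H|\<^sup>2\<close> is arbitrarily small.\<close>
lemma periodic_fourier_unique:
  fixes H :: "real \<Rightarrow> complex"
  assumes c: "continuous_on UNIV H" and per: "\<And>t. H (t + 1) = H t"
    and zero: "\<And>k :: int. integral {0..1} (\<lambda>t. H t * cis (2 * pi * k * t)) = 0"
  shows "H t = 0"
proof -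
  interpret periodic_fun_simple' H by unfold_locales (rule per)
  have isC: "isCont H t" for t using c by (simp add: continuous_on_eq_continuous_at)
  define h where "h z = H (Arg z / (2 * pi))" for z
  have cis_eq: "H (a / (2 * pi)) = H (b / (2 * pi))" if ab: "cis a = cis b" for a b
  proof -
    obtain n :: int where "a = b + 2 * pi * n"
      using arg_cong[OF ab, of Re] arg_cong[OF ab, of Im] sin_cos_eq_iff[of a b] by auto
    then have "a / (2 * pi) = b / (2 * pi) + of_int n" by (simp add: field_simps)
    then show ?thesis by (simp only: plus_of_int)
  qed
  (* Arg jumps on the negative axis and Arg2pi on the positive one; both describe h, so h is continuous. *)
  have h2: "h = (\<lambda>z. H (Arg2pi z / (2 * pi)))"
  proof
    fix z show "h z = H (Arg2pi z / (2 * pi))"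
    proof (cases "z = 0")
      case False
      have "cis (Arg2pi z) = cis (Arg z)"
      proof -
        have "cis (Arg2pi z) * of_real (norm z) = z"
          using Arg2pi_eq[of z] by (simp add: cis_conv_exp mult.commute)
        then have "cis (Arg2pi z) = z / of_real (norm z)" using False by (metis divide_eq_eq norm_eq_zero of_real_eq_0_iff eq_divide_eq)
        then show ?thesis using False by (simp add: cis_Arg sgn_eq)
      qed
      from cis_eq[OF this] show ?thesis by (simp add: h_def)
    qed (simp add: h_def Arg_zero Arg2pi_def)
  qed
  have hH: "h (cis (2 * pi * s)) = H s" for s
  proof -
    have "cis (Arg (cis (2 * pi * s))) = cis (2 * pi * s)" by (simp add: cis_Arg sgn_eq)
    from cis_eq[OF this] show ?thesis by (simp add: h_def)
  qed
  have "isCont h z" if "norm z = 1" for z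
  proof (cases "z \<in> \<real>\<^sub>\<le>\<^sub>0")
    case False
    then have "isCont (\<lambda>z. Arg z / (2 * pi)) z" by (intro continuous_intros continuous_at_Arg) auto
    from isCont_o2[OF this isC] show ?thesis by (simp add: h_def[abs_def])
  next
    case True
    then have "z \<notin> \<real>\<^sub>\<ge>\<^sub>0" using that by (auto simp: complex_nonpos_Reals_iff complex_nonneg_Reals_iff norm_complex_def)
    then have "isCont (\<lambda>z. Arg2pi z / (2 * pi)) z" by (intro continuous_intros continuous_at_Arg2pi) auto
    from isCont_o2[OF this isC] show ?thesis by (simp add: h2)
  qed
  then have ch: "continuous_on (sphere 0 1) h"
    by (intro continuous_at_imp_continuous_on) auto
  have c01: "continuous_on {0..1} H" using c by (rule continuous_on_subset) auto
  have "bounded (H ` {0..1})"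
    by (intro compact_imp_bounded compact_continuous_image c01) auto
  then obtain B where B: "B > 0" "\<And>t. t \<in> {0..1} \<Longrightarrow> norm (H t) \<le> B"
    by (auto simp: bounded_pos)
  define J where "J = integral {0..1} (\<lambda>t. (norm (H t))\<^sup>2)"
  have "J \<le> e" if e: "e > 0" for e
  proof -
    obtain g :: "complex \<Rightarrow> complex" where g: "polynomial_function g" "\<And>z. z \<in> sphere 0 1 \<Longrightarrow> norm (h z - g z) < e / B"
      using Stone_Weierstrass_polynomial_function[OF compact_sphere ch, of "e / B"] e B by auto
    have "real_polynomial_function (Re \<circ> g)" "real_polynomial_function (Im \<circ> g)"
      using g(1) bounded_linear_Re bounded_linear_Im unfolding polynomial_function_def by blast+
    from this[THEN integral_poly_cis_zero, OF c01 zero, of 0]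
    have z: "integral {0..1} (\<lambda>t. H t * complex_of_real (Re (g (cis (2 * pi * t))))) = 0"
      "integral {0..1} (\<lambda>t. H t * complex_of_real (Im (g (cis (2 * pi * t))))) = 0" by simp_all
    have cg: "continuous_on {0..1} (\<lambda>t. g (cis (2 * pi * t)))"
      by (rule continuous_on_polynomial_cis[OF g(1)])
    have "H t * cnj (g (cis (2 * pi * t))) = H t * complex_of_real (Re (g (cis (2 * pi * t)))) - \<i> * (H t * complex_of_real (Im (g (cis (2 * pi * t)))))" for t
      by (simp add: complex_eq_iff)
    then have "integral {0..1} (\<lambda>t. H t * cnj (g (cis (2 * pi * t)))) = 0"
      using z by (simp, subst integral_diff) (auto intro!: integrable_continuous_interval continuous_intros c01 cg)
    then have "integral {0..1} (\<lambda>t. H t * cnj (H t - g (cis (2 * pi * t)))) = integral {0..1} (\<lambda>t. H t * cnj (H t))"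
      unfolding complex_cnj_diff right_diff_distrib
      by (subst integral_diff) (auto intro!: integrable_continuous_interval continuous_intros c01 cg)
    also have "(\<lambda>t. H t * cnj (H t)) = (\<lambda>t. complex_of_real ((norm (H t))\<^sup>2))"
      by (simp only: complex_norm_square)
    also have "integral {0..1} \<dots> = complex_of_real J"
      unfolding J_def using integral_linear[OF _ bounded_linear_of_real, of "\<lambda>t. (norm (H t))\<^sup>2" "{0..1}"]
      by (simp add: o_def integrable_continuous_interval continuous_intros c01)
    finally have eq: "complex_of_real J = integral {0..1} (\<lambda>t. H t * cnj (H t - g (cis (2 * pi * t))))" ..
    have "norm (complex_of_real J) \<le> B * (e / B) * (1 - 0)"
      unfolding eq
    proof (rule integral_bound)
      show "continuous_on {0..1} (\<lambda>t. H t * cnj (H t - g (cis (2 * pi * t))))"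
        by (intro continuous_intros c01 cg)
      fix t :: real assume t: "t \<in> {0..1}"
      show "norm (H t * cnj (H t - g (cis (2 * pi * t)))) \<le> B * (e / B)"
        unfolding norm_mult complex_mod_cnj using B(2)[OF t] g(2)[of "cis (2 * pi * t)"] e B(1)
        by (intro mult_mono) (auto simp: hH)
    qed simp
    then show ?thesis using B by simp
  qed
  then have J0: "J \<le> 0" by (rule field_le_epsilon[of J 0, simplified])
  have cn: "continuous_on {0..1} (\<lambda>t. (norm (H t))\<^sup>2)" by (intro continuous_intros c01)
  have "J \<ge> 0" unfolding J_def by (intro integral_nonneg integrable_continuous_interval cn) auto
  with J0 have "J = 0" by simp
  then have z01: "H t = 0" if "t \<in> {0..1}" for t
    using that integral_eq_0_iff[OF cn] by (simp add: J_def)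
  have "H t = H (frac t + of_int \<lfloor>t\<rfloor>)" by (simp add: frac_def)
  also have "\<dots> = H (frac t)" by (simp only: plus_of_int)
  also have "\<dots> = 0" by (intro z01) (simp add: frac_ge_0 less_imp_le[OF frac_lt_1])
  finally show ?thesis .
qed

section \<open>The theta identity\<close>

lemma dominated_series:
  fixes f :: "'k \<Rightarrow> real \<Rightarrow> complex"
  assumes b: "\<And>k t. t \<in> {a..b} \<Longrightarrow> norm (f k t) \<le> M k" and M: "M summable_on UNIV"
    and c: "\<And>k. continuous_on {a..b} (f k)"
  shows "continuous_on {a..b} (\<lambda>t. \<Sum>\<^sub>\<infinity>k. f k t)"
    and "((\<lambda>k. integral {a..b} (f k)) has_sum integral {a..b} (\<lambda>t. \<Sum>\<^sub>\<infinity>k. f k t)) UNIV"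
proof -
  have s: "(\<lambda>k. f k t) summable_on UNIV" if "t \<in> {a..b}" for t
    by (rule abs_summable_summable, rule Infinite_Sum.abs_summable_on_comparison_test'[OF M]) (use b that in auto)
  have u: "uniform_limit {a..b} (\<lambda>X t. \<Sum>k\<in>X. f k t) (\<lambda>t. \<Sum>\<^sub>\<infinity>k. f k t) (finite_subsets_at_top UNIV)"
    by (rule Weierstrass_m_test_general'[where M = M]) (use b M s in auto)
  show "continuous_on {a..b} (\<lambda>t. \<Sum>\<^sub>\<infinity>k. f k t)"
    by (rule uniform_limit_theorem[OF _ u]) (auto intro!: always_eventually continuous_intros c)
  have c': "continuous_on {a..b} (\<lambda>t. \<Sum>k\<in>X. f k t)" for X by (intro continuous_intros c)
  obtain I J where I: "\<And>X. ((\<lambda>t. \<Sum>k\<in>X. f k t) has_integral I X) {a..b}" 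
    and J: "((\<lambda>t. \<Sum>\<^sub>\<infinity>k. f k t) has_integral J) {a..b}" "(I \<longlongrightarrow> J) (finite_subsets_at_top UNIV)"
    using uniform_limit_integral[OF u c'] by auto
  have "I X = (\<Sum>k\<in>X. integral {a..b} (f k))" if "finite X" for X
    using integral_sum[OF that, of f "{a..b}"] integral_unique[OF I] c by (simp add: integrable_continuous_interval)
  then have "((\<lambda>X. \<Sum>k\<in>X. integral {a..b} (f k)) \<longlongrightarrow> J) (finite_subsets_at_top UNIV)"
    using J(2) by (rule_tac Lim_transform_eventually) (auto intro: eventually_finite_subsets_at_top_weakI)
  with J(1) show "((\<lambda>k. integral {a..b} (f k)) has_sum integral {a..b} (\<lambda>t. \<Sum>\<^sub>\<infinity>k. f k t)) UNIV"
    by (simp add: has_sum_def integral_unique)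
qed

lemma summable_on_int_geometric:
  fixes q :: real
  assumes "0 \<le> q" "q < 1"
  shows "(\<lambda>k :: int. q ^ nat \<bar>k\<bar>) summable_on UNIV"
proof -
  have g: "(\<lambda>n. q ^ n) summable_on UNIV"
    using assms by (intro norm_summable_imp_summable_on) (simp add: norm_power summable_geometric)
  have "(\<lambda>k :: int. q ^ nat \<bar>k\<bar>) summable_on range int"
    by (subst summable_on_reindex) (use g in \<open>simp_all add: o_def\<close>)
  moreover have "(\<lambda>k :: int. q ^ nat \<bar>k\<bar>) summable_on range (\<lambda>n. - int n)"
    by (subst summable_on_reindex) (use g in \<open>simp_all add: o_def inj_on_def\<close>)
  ultimately have "(\<lambda>k :: int. q ^ nat \<bar>k\<bar>) summable_on (range int \<union> range (\<lambda>n. - int n))"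
    by (metis Un_Diff_cancel Diff_disjoint Diff_subset summable_on_Un_disjoint summable_on_subset_banach)
  moreover have "range int \<union> range (\<lambda>n. - int n) = UNIV"
    by (metis (no_types, lifting) UNIV_eq_I UnI1 UnI2 int_cases2 range_eqI)
  ultimately show ?thesis by simp
qed

text \<open>From \<open>(\<xi> - h k)\<^sup>2 \<ge> (h k)\<^sup>2 / 2 - \<xi>\<^sup>2\<close> and \<open>k\<^sup>2 \<ge> |k|\<close>; the bound is locally uniform in \<open>\<xi>\<close>.\<close>
lemma gaussian_le_geometric:
  fixes c h \<xi> :: real
  assumes "c \<ge> 0"
  shows "exp (- c * (\<xi> - h * of_int k)\<^sup>2) \<le> exp (c * \<xi>\<^sup>2) * exp (- c * h\<^sup>2 / 2) ^ nat \<bar>k\<bar>"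
proof -
  have "0 \<le> (2 * \<xi> - h * k)\<^sup>2" by simp
  then have 1: "(h * k)\<^sup>2 / 2 - \<xi>\<^sup>2 \<le> (\<xi> - h * k)\<^sup>2" by (simp add: power2_eq_square algebra_simps)
  have "\<bar>k\<bar> * 1 \<le> \<bar>k\<bar> * \<bar>k\<bar>" using mult_left_mono[of 1 "\<bar>k\<bar>" "\<bar>k\<bar>"] by (cases "k = 0") auto
  then have "real_of_int \<bar>k\<bar> \<le> real_of_int (k\<^sup>2)"
    unfolding of_int_le_iff by (simp add: power2_eq_square)
  then have "real (nat \<bar>k\<bar>) \<le> (real_of_int k)\<^sup>2" by simp
  then have "h\<^sup>2 * real (nat \<bar>k\<bar>) \<le> h\<^sup>2 * (real_of_int k)\<^sup>2" by (intro mult_left_mono) auto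
  with 1 have "h\<^sup>2 * real (nat \<bar>k\<bar>) / 2 - \<xi>\<^sup>2 \<le> (\<xi> - h * k)\<^sup>2" by (simp add: power_mult_distrib)
  then have "c * (h\<^sup>2 * real (nat \<bar>k\<bar>) / 2 - \<xi>\<^sup>2) \<le> c * (\<xi> - h * k)\<^sup>2" using assms by (rule mult_left_mono)
  then have "- c * (\<xi> - h * of_int k)\<^sup>2 \<le> c * \<xi>\<^sup>2 + real (nat \<bar>k\<bar>) * (- c * h\<^sup>2 / 2)" by (simp add: algebra_simps)
  then show ?thesis by (simp only: exp_of_nat_mult[symmetric] exp_add[symmetric] exp_le_cancel_iff)
qed

lemma summable_on_gaussian_int:
  fixes c h \<xi> :: real
  assumes "c > 0" "h \<noteq> 0"
  shows "(\<lambda>k :: int. exp (- c * (\<xi> - h * of_int k)\<^sup>2)) summable_on UNIV"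
proof -
  have "(\<lambda>k :: int. exp (c * \<xi>\<^sup>2) * exp (- c * h\<^sup>2 / 2) ^ nat \<bar>k\<bar>) summable_on UNIV"
    using assms by (intro summable_on_cmult_right summable_on_int_geometric) auto
  from Infinite_Sum.abs_summable_on_comparison_test'[OF this, of "\<lambda>k. exp (- c * (\<xi> - h * of_int k)\<^sup>2)"]
  show ?thesis using gaussian_le_geometric[of c \<xi> h] assms by simp
qed

text \<open>The characteristic function of the normal distribution after the substitution \<open>x \<mapsto> (2 / D)\<^bsup>1/2\<^esup> x\<close>.\<close>
lemma gaussian_fourier_integral:
  fixes D s :: real
  assumes D: "D > 0"
  shows "((\<lambda>x. complex_of_real (exp (- x\<^sup>2 / D)) * cis (2 * pi * s * x)) has_integral
     complex_of_real (sqrt (pi * D) * exp (- pi\<^sup>2 * D * s\<^sup>2))) UNIV"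
proof -
  interpret normal: real_distribution std_normal_distribution by (rule real_dist_normal_dist)
  (* The frequency and the dilation that turn the standard normal density into exp (- x^2 / D). *)
  define \<sigma> where "\<sigma> = 2 * pi * s * sqrt (D / 2)"
  define c where "c = sqrt (2 / D)"
  define f where "f x = complex_of_real (std_normal_density x) * cis (\<sigma> * x)" for x
  have c: "c > 0" using D by (simp add: c_def)
  have [measurable]: "(\<lambda>x. cis (\<sigma> * x)) \<in> borel_measurable borel"
    by (intro borel_measurable_continuous_onI continuous_intros)
  have "(\<lambda>x. std_normal_density x *\<^sub>R cis (\<sigma> * x)) = f"
    by (simp add: f_def fun_eq_iff scaleR_conv_of_real)
  moreover have "integrable std_normal_distribution (\<lambda>x. cis (\<sigma> * x))"
    by (rule normal.integrable_const_bound[where B = 1]) auto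
  then have "integrable lborel (\<lambda>x. std_normal_density x *\<^sub>R cis (\<sigma> * x))"
    by (subst (asm) integrable_density) auto
  moreover have "integral\<^sup>L lborel (\<lambda>x. std_normal_density x *\<^sub>R cis (\<sigma> * x)) = complex_of_real (exp (- \<sigma>\<^sup>2 / 2))"
    using fun_cong[OF char_std_normal_distribution, of \<sigma>] unfolding char_def
    by (subst (asm) integral_density) (auto simp: cis_conv_exp)
  ultimately have int: "integrable lborel f" "integral\<^sup>L lborel f = complex_of_real (exp (- \<sigma>\<^sup>2 / 2))" by simp_all
  have "integrable lborel (\<lambda>x. f (0 + c * x))"
    using c int(1) by (intro lborel_integrable_real_affine) auto
  moreover have "integral\<^sup>L lborel f = \<bar>c\<bar> *\<^sub>R integral\<^sup>L lborel (\<lambda>x. f (0 + c * x))"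
    by (rule lborel_integral_real_affine) (use c in auto)
  then have "integral\<^sup>L lborel (\<lambda>x. f (0 + c * x)) = complex_of_real (exp (- \<sigma>\<^sup>2 / 2) / c)"
    using c int(2) by (simp add: scaleR_conv_of_real field_simps)
  ultimately have "((\<lambda>x. f (c * x)) has_integral complex_of_real (exp (- \<sigma>\<^sup>2 / 2) / c)) UNIV"
    using has_integral_integral_lborel[of "\<lambda>x. f (0 + c * x)"] by simp
  from has_integral_mult_right[OF this, of "complex_of_real (sqrt (2 * pi))"]
  have "((\<lambda>x. complex_of_real (sqrt (2 * pi)) * f (c * x)) has_integral
     complex_of_real (sqrt (2 * pi) * (exp (- \<sigma>\<^sup>2 / 2) / c))) UNIV" by simp
  moreover have "complex_of_real (sqrt (2 * pi)) * f (c * x) = complex_of_real (exp (- x\<^sup>2 / D)) * cis (2 * pi * s * x)" for x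
  proof -
    have "sqrt (2 * pi) * std_normal_density (c * x) = exp (- x\<^sup>2 / D)"
      using D by (simp add: std_normal_density_def c_def power_mult_distrib real_sqrt_mult)
    moreover have "\<sigma> * (c * x) = 2 * pi * s * x"
    proof -
      have "sqrt (D / 2) * sqrt (2 / D) = 1" using D by (simp add: real_sqrt_mult[symmetric])
      then show ?thesis by (simp add: \<sigma>_def c_def mult_ac)
    qed
    ultimately show ?thesis unfolding f_def by (metis mult.assoc of_real_mult)
  qed
  moreover have "sqrt (2 * pi) * (exp (- \<sigma>\<^sup>2 / 2) / c) = sqrt (pi * D) * exp (- pi\<^sup>2 * D * s\<^sup>2)"
  proof -
    have "\<sigma>\<^sup>2 / 2 = pi\<^sup>2 * D * s\<^sup>2" using D by (simp add: \<sigma>_def power_mult_distrib)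
    moreover have "sqrt (2 * pi) / c = sqrt (pi * D)"
      using D by (simp add: c_def real_sqrt_divide[symmetric])
    moreover have "sqrt (2 * pi) * (exp (- \<sigma>\<^sup>2 / 2) / c) = sqrt (2 * pi) / c * exp (- (\<sigma>\<^sup>2 / 2))" by simp
    ultimately show ?thesis by simp
  qed
  ultimately show ?thesis by (simp only:)
qed

lemma continuous_on_UNIV_if_intervals:
  fixes f :: "real \<Rightarrow> complex"
  assumes "\<And>R. continuous_on {-R..R} f"
  shows "continuous_on UNIV f"
proof (intro continuous_at_imp_continuous_on ballI)
  fix t
  have "continuous_on {- (\<bar>t\<bar> + 1)<..<\<bar>t\<bar> + 1} f"
    using assms[of "\<bar>t\<bar> + 1"] by (rule continuous_on_subset) auto
  then show "isCont f t"
    by (rule continuous_on_interior) (auto simp: abs_if)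
qed

lemma integral_cis_period:
  fixes n :: int
  shows "integral {0..1} (\<lambda>t. cis (2 * pi * of_int n * t)) = (if n = 0 then 1 else 0)"
proof (cases "n = 0")
  case False
  define c where "c = 2 * pi * real_of_int n"
  have c: "c \<noteq> 0" using False by (simp add: c_def)
  have "((\<lambda>t. cis (c * t) / (\<i> * c)) has_vector_derivative cis (c * t)) (at t within {0..1})" for t
    using c by (auto simp: has_vector_derivative_complex_iff Re_divide Im_divide power2_eq_square intro!: derivative_eq_intros)
  then have "((\<lambda>t. cis (c * t)) has_integral cis (c * 1) / (\<i> * c) - cis (c * 0) / (\<i> * c)) {0..1}"
    by (intro fundamental_theorem_of_calculus) auto
  moreover have "cis (c * 1) = 1" unfolding c_def
    by (simp add: cis.ctr sin_int_2pin cos_int_2pin flip: one_complex.code)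
  ultimately show ?thesis using False by (simp add: c_def integral_unique)
qed simp

lemma integral_consecutive_intervals:
  fixes \<phi> :: "real \<Rightarrow> complex"
  assumes "continuous_on UNIV \<phi>"
  shows "(\<Sum>k\<in>{- int N..int N}. integral {- real_of_int k..1 - real_of_int k} \<phi>) = integral {- real N..real N + 1} \<phi>"
proof (induction N)
  case (Suc N)
  have i: "\<phi> integrable_on {a..b}" for a b
    by (intro integrable_continuous_interval continuous_on_subset[OF assms]) auto
  have "{- int (Suc N)..int (Suc N)} = insert (- int (Suc N)) (insert (int (Suc N)) {- int N..int N})" by auto
  then have "(\<Sum>k\<in>{- int (Suc N)..int (Suc N)}. integral {- real_of_int k..1 - real_of_int k} \<phi>)
     = integral {real N + 1..real N + 2} \<phi> + (integral {- 1 - real N..- real N} \<phi> + integral {- real N..real N + 1} \<phi>)"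
    by (simp add: Suc.IH algebra_simps)
  also have "integral {- 1 - real N..- real N} \<phi> + integral {- real N..real N + 1} \<phi> = integral {- 1 - real N..real N + 1} \<phi>"
    by (intro Henstock_Kurzweil_Integration.integral_combine i) auto
  also have "integral {real N + 1..real N + 2} \<phi> + integral {- 1 - real N..real N + 1} \<phi> = integral {- 1 - real N..real N + 2} \<phi>"
    by (subst add.commute, intro Henstock_Kurzweil_Integration.integral_combine i) auto
  finally show ?case by (simp add: add_ac)
qed simp

lemma integral_UNIV_limit:
  fixes \<phi> :: "real \<Rightarrow> complex"
  assumes "(\<phi> has_integral I) UNIV"
  shows "(\<lambda>N. integral {- real N..real N + 1} \<phi>) \<longlonglongrightarrow> I"
proof (rule LIMSEQ_I)
  fix e :: real assume "e > 0"
  then obtain B where B: "B > 0" "\<And>a b. ball 0 B \<subseteq> cbox a b \<Longrightarrow> \<exists>z. (\<phi> has_integral z) (cbox a b) \<and> norm (z - I) < e"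
    using assms by (subst (asm) has_integral') auto
  obtain N0 :: nat where N0: "B \<le> real N0" using real_arch_simple by blast
  show "\<exists>N0. \<forall>N\<ge>N0. norm (integral {- real N..real N + 1} \<phi> - I) < e"
  proof (intro exI allI impI)
    fix N assume "N \<ge> N0"
    then have "ball 0 B \<subseteq> cbox (- real N) (real N + 1)" using N0 by (auto simp: dist_real_def)
    from B(2)[OF this] show "norm (integral {- real N..real N + 1} \<phi> - I) < e"
      by (auto simp: integral_unique)
  qed
qed

text \<open>Both sides are continuous with period 1, so it suffices to compare Fourier coefficients. On the left the
integrals over \<open>[0, 1]\<close> of the translates add up to the Fourier integral of the Gaussian over the whole line.\<close>
theorem theta_identity:
  fixes D t :: real
  assumes D: "D > 0"
  shows "(\<Sum>\<^sub>\<infinity>k :: int. complex_of_real (exp (- (t - of_int k)\<^sup>2 / D)))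
    = (\<Sum>\<^sub>\<infinity>k :: int. complex_of_real (sqrt (pi * D) * exp (- pi\<^sup>2 * D * (of_int k)\<^sup>2)) * cis (2 * pi * of_int k * t))"
proof -
  define F where "F t = (\<Sum>\<^sub>\<infinity>k :: int. complex_of_real (exp (- (t - of_int k)\<^sup>2 / D)))" for t
  define a where "a k = sqrt (pi * D) * exp (- pi\<^sup>2 * D * (of_int k)\<^sup>2)" for k :: int
  define G where "G t = (\<Sum>\<^sub>\<infinity>k :: int. complex_of_real (a k) * cis (2 * pi * of_int k * t))" for t
  have a0: "a k \<ge> 0" for k using D by (simp add: a_def)
  have as: "a summable_on UNIV"
    unfolding a_def[abs_def] using summable_on_gaussian_int[of "pi\<^sup>2 * D" 1 0] D
    by (intro summable_on_cmult_right) simp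
  define q where "q = exp (- (1 / D) * 1\<^sup>2 / 2)"
  have q: "(\<lambda>k :: int. C * q ^ nat \<bar>k\<bar>) summable_on UNIV" for C
    using D by (intro summable_on_cmult_right summable_on_int_geometric) (auto simp: q_def)
  have Fb: "exp (- (t - of_int k)\<^sup>2 / D) \<le> exp (R\<^sup>2 / D) * q ^ nat \<bar>k\<bar>" if "t \<in> {-R..R}" for t R and k :: int
  proof -
    have "exp (- (t - of_int k)\<^sup>2 / D) \<le> exp ((1 / D) * t\<^sup>2) * q ^ nat \<bar>k\<bar>"
      using gaussian_le_geometric[of "1 / D" t 1 k] D by (simp add: q_def)
    also have "(1 / D) * t\<^sup>2 \<le> R\<^sup>2 / D"
      using that D abs_le_square_iff[of t R] by (auto simp: abs_le_iff divide_right_mono)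
    finally show ?thesis by (simp add: q_def mult_right_mono)
  qed
  have cF: "continuous_on UNIV F"
  proof (rule continuous_on_UNIV_if_intervals)
    show "continuous_on {-R..R} F" for R
      unfolding F_def
      by (rule dominated_series(1)[OF _ q[of "exp (R\<^sup>2 / D)"]]) (use Fb D in \<open>auto intro!: continuous_intros\<close>)
  qed
  have cG: "continuous_on UNIV G"
  proof (rule continuous_on_UNIV_if_intervals)
    show "continuous_on {-R..R} G" for R
      unfolding G_def
      by (rule dominated_series(1)[OF _ as]) (use a0 in \<open>auto intro!: continuous_intros simp: norm_mult\<close>)
  qed
  have pF: "F (t + 1) = F t" for t
  proof -
    have "bij_betw (\<lambda>k :: int. k - 1) UNIV UNIV" by (rule bij_betwI[where g = "\<lambda>k. k + 1"]) auto
    from infsum_reindex_bij_betw[OF this, of "\<lambda>k. complex_of_real (exp (- (t - of_int k)\<^sup>2 / D))"]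
    show ?thesis unfolding F_def by (simp add: algebra_simps)
  qed
  have pG: "G (t + 1) = G t" for t
  proof -
    have "cis (2 * pi * of_int k * (t + 1)) = cis (2 * pi * of_int k * t)" for k :: int
      by (simp add: distrib_left cis_mult[symmetric] cis.ctr[of "2 * pi * of_int k"] sin_int_2pin cos_int_2pin flip: one_complex.code)
    then show ?thesis unfolding G_def by simp
  qed
  have iF: "integral {0..1} (\<lambda>t. F t * cis (2 * pi * of_int j * t)) = complex_of_real (a j)" for j :: int
  proof -
    define \<phi> where "\<phi> x = complex_of_real (exp (- x\<^sup>2 / D)) * cis (2 * pi * of_int j * x)" for x
    have c\<phi>: "continuous_on UNIV \<phi>" unfolding \<phi>_def using D by (intro continuous_intros) auto
    define f where "f k t = complex_of_real (exp (- (t - of_int k)\<^sup>2 / D)) * cis (2 * pi * of_int j * t)" for k :: int and t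
    have f\<phi>: "f k t = \<phi> (t - of_int k)" for k t
    proof -
      have "cis (2 * pi * of_int j * (t - of_int k)) = cis (2 * pi * of_int j * t) * cis (- (2 * pi * of_int (j * k)))"
        by (simp add: cis_mult algebra_simps)
      also have "cis (- (2 * pi * of_int (j * k))) = 1"
        by (simp only: cis.ctr sin_minus cos_minus sin_int_2pin cos_int_2pin) (simp flip: one_complex.code)
      finally show ?thesis by (simp add: f_def \<phi>_def)
    qed
    have "((\<lambda>k. integral {0..1} (f k)) has_sum integral {0..1} (\<lambda>t. \<Sum>\<^sub>\<infinity>k. f k t)) UNIV"
      by (rule dominated_series(2)[OF _ q[of "exp (1\<^sup>2 / D)"]])
        (use Fb[of _ 1] D in \<open>auto intro!: continuous_intros simp: f_def norm_mult\<close>)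
    also have "(\<lambda>t. \<Sum>\<^sub>\<infinity>k. f k t) = (\<lambda>t. F t * cis (2 * pi * of_int j * t))"
      unfolding f_def F_def by (simp add: infsum_cmult_left')
    also have "(\<lambda>k. integral {0..1} (f k)) = (\<lambda>k. integral {- real_of_int k..1 - real_of_int k} \<phi>)"
    proof
      fix k :: int
      have "integral {0..1} (\<phi> \<circ> (+) (- real_of_int k)) = integral {0 + - real_of_int k..1 + - real_of_int k} \<phi>"
        by (rule integral_shift_Icc_real)
      moreover have "\<phi> \<circ> (+) (- real_of_int k) = f k" by (auto simp: f\<phi>)
      ultimately show "integral {0..1} (f k) = integral {- real_of_int k..1 - real_of_int k} \<phi>" by simp
    qed
    finally have hs: "((\<lambda>k. integral {- real_of_int k..1 - real_of_int k} \<phi>) has_sum integral {0..1} (\<lambda>t. F t * cis (2 * pi * of_int j * t))) UNIV" .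
    (* The unconditional sum over the integers is also the limit of the symmetric partial sums, which
       are integrals over growing intervals. *)
    have "filterlim (\<lambda>N. {- int N..int N}) (finite_subsets_at_top UNIV) sequentially"
      unfolding filterlim_finite_subsets_at_top
    proof (intro allI impI)
      fix X :: "int set" assume X: "finite X \<and> X \<subseteq> UNIV"
      then have "\<bar>k\<bar> \<le> Max (insert 0 (abs ` X))" if "k \<in> X" for k using that by (intro Max_ge) auto
      then have "X \<subseteq> {- int N..int N}" if "N \<ge> nat (Max (insert 0 (abs ` X)))" for N
        using that by (force simp: nat_le_iff abs_le_iff)
      then show "\<forall>\<^sub>F N in sequentially. finite {- int N..int N} \<and> X \<subseteq> {- int N..int N} \<and> {- int N..int N} \<subseteq> UNIV"
        by (auto simp: eventually_sequentially)
    qed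
    from filterlim_compose[OF hs[unfolded has_sum_def] this]
    have "(\<lambda>N. integral {- real N..real N + 1} \<phi>) \<longlonglongrightarrow> integral {0..1} (\<lambda>t. F t * cis (2 * pi * of_int j * t))"
      unfolding integral_consecutive_intervals[OF c\<phi>] .
    moreover have "(\<lambda>N. integral {- real N..real N + 1} \<phi>) \<longlonglongrightarrow> complex_of_real (a j)"
      using integral_UNIV_limit[OF gaussian_fourier_integral[OF D, of "of_int j"]] by (simp add: \<phi>_def[abs_def] a_def)
    ultimately show ?thesis by (rule LIMSEQ_unique)
  qed
  have iG: "integral {0..1} (\<lambda>t. G t * cis (2 * pi * of_int j * t)) = complex_of_real (a j)" for j :: int
  proof -
    define f where "f k t = complex_of_real (a k) * cis (2 * pi * of_int k * t) * cis (2 * pi * of_int j * t)" for k :: int and t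
    have "((\<lambda>k. integral {0..1} (f k)) has_sum integral {0..1} (\<lambda>t. \<Sum>\<^sub>\<infinity>k. f k t)) UNIV"
      by (rule dominated_series(2)[OF _ as]) (use a0 in \<open>auto intro!: continuous_intros simp: f_def norm_mult\<close>)
    also have "(\<lambda>t. \<Sum>\<^sub>\<infinity>k. f k t) = (\<lambda>t. G t * cis (2 * pi * of_int j * t))"
      unfolding f_def G_def by (simp add: infsum_cmult_left')
    also have "(\<lambda>k. integral {0..1} (f k)) = (\<lambda>k. if k = - j then complex_of_real (a k) else 0)"
    proof
      fix k :: int
      have "f k = (\<lambda>t. complex_of_real (a k) * cis (2 * pi * of_int (k + j) * t))"
        by (simp add: f_def fun_eq_iff cis_mult algebra_simps)
      then have "integral {0..1} (f k) = complex_of_real (a k) * (if k + j = 0 then 1 else 0)"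
        by (simp only: integral_mult_right integral_cis_period)
      then show "integral {0..1} (f k) = (if k = - j then complex_of_real (a k) else 0)" by (simp add: eq_neg_iff_add_eq_0)
    qed
    finally have "((\<lambda>k. if k = - j then complex_of_real (a k) else 0) has_sum integral {0..1} (\<lambda>t. G t * cis (2 * pi * of_int j * t))) UNIV" .
    moreover have "((\<lambda>k. if k = - j then complex_of_real (a k) else 0) has_sum complex_of_real (a (- j))) UNIV"
      by (rule has_sum_finite_neutralI[of "{- j}"]) auto
    ultimately show ?thesis using has_sum_unique by (fastforce simp: a_def)
  qed
  have i: "(\<lambda>t. F t * cis (2 * pi * of_int j * t)) integrable_on {0..1}" "(\<lambda>t. G t * cis (2 * pi * of_int j * t)) integrable_on {0..1}" for j :: int
    by (auto intro!: integrable_continuous_interval continuous_intros continuous_on_subset[OF cF] continuous_on_subset[OF cG])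
  have "F t - G t = 0"
  proof (rule periodic_fourier_unique[of "\<lambda>t. F t - G t"])
    show "integral {0..1} (\<lambda>t. (F t - G t) * cis (2 * pi * of_int k * t)) = 0" for k :: int
      unfolding left_diff_distrib by (subst integral_diff) (auto simp: i iF iG)
  qed (auto intro!: continuous_intros cF cG simp: pF pG)
  then show ?thesis by (simp add: F_def G_def a_def)
qed

section \<open>Poisson summation for monomials\<close>

lemma exp_has_sum:
  fixes x :: "'a :: {real_normed_field, banach}"
  shows "((\<lambda>n. x ^ n / fact n) has_sum exp x) UNIV" "(\<lambda>n. x ^ n / fact n) abs_summable_on UNIV"
proof -
  have eq: "x ^ n /\<^sub>R fact n = x ^ n / fact n" for n
    by (simp add: scaleR_conv_of_real divide_inverse mult.commute)
  have s: "summable (\<lambda>n. norm (x ^ n / fact n))"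
    using summable_norm_exp[of x] unfolding eq .
  show "((\<lambda>n. x ^ n / fact n) has_sum exp x) UNIV"
    using exp_converges[of x] unfolding eq by (rule norm_summable_imp_has_sum[OF s])
  show "(\<lambda>n. x ^ n / fact n) abs_summable_on UNIV"
    using norm_summable_imp_summable_on[of "\<lambda>n. norm (x ^ n / fact n)"] s by simp
qed

text \<open>Convergence at all real points gives an entire function, whose zeros would be isolated.\<close>
lemma power_series_zero_on_reals:
  fixes f :: "nat \<Rightarrow> complex"
  assumes f: "\<And>s :: real. ((\<lambda>b. f b * complex_of_real s ^ b) has_sum 0) UNIV"
  shows "f b = 0"
proof -
  have sm: "summable (\<lambda>b. f b * z ^ b)" for z :: complex
  proof (rule summable_norm_cancel)
    have "(\<lambda>b. f b * complex_of_real (norm z) ^ b) abs_summable_on UNIV"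
      using has_sum_imp_summable[OF f[of "norm z"]] by (simp only: summable_on_iff_abs_summable_on_complex)
    then show "summable (\<lambda>b. norm (f b * z ^ b))"
      using summable_on_UNIV_nonneg_real_iff[of "\<lambda>b. norm (f b * z ^ b)"] by (simp add: norm_mult norm_power)
  qed
  have zero: "(\<Sum>b. f b * complex_of_real s ^ b) = 0" for s
    using has_sum_imp_sums[OF f[of s]] by (simp add: sums_iff)
  have f0: "f 0 = 0" using zero[of 0] by simp
  show ?thesis
  proof (rule ccontr)
    assume b: "f b \<noteq> 0"
    then have "b > 0" using f0 by (cases "b = 0") auto
    obtain s where s: "s > 0" "\<And>z. z \<in> cball 0 s - {0} \<Longrightarrow> (\<Sum>b. f b * z ^ b) \<noteq> 0"
      using powser_0_nonzero[of 1 0 f "\<lambda>z. \<Sum>b. f b * z ^ b" b] sm b \<open>b > 0\<close> f0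
      by (auto simp: summable_sums)
    show False using s(2)[of "complex_of_real s"] s(1) zero[of s] by auto
  qed
qed

text \<open>Lattice side: Gaussian weight times a divided power, indexed by the lattice point and the exponent.\<close>
definition gauss_monomial :: "real \<Rightarrow> real \<Rightarrow> real \<Rightarrow> int \<times> nat \<Rightarrow> complex" where
  "gauss_monomial h D \<xi> = (\<lambda>(k, b). complex_of_real (exp (- (\<xi> - h * of_int k)\<^sup>2 / (h\<^sup>2 * D))) *
     (complex_of_real (h * of_int k - \<xi>) ^ b / fact b))"

definition theta_coeff :: "real \<Rightarrow> real \<Rightarrow> real \<Rightarrow> int \<Rightarrow> complex" where
  "theta_coeff h D \<xi> k = complex_of_real (sqrt (pi * D) * exp (- pi\<^sup>2 * D * (of_int k)\<^sup>2)) * cis (2 * pi * of_int k * (\<xi> / h))"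

text \<open>Dual side: the terms of the expansion of \<open>exp (c s\<^sup>2 + w s)\<close> with \<open>c = h\<^sup>2 D / 4\<close> and \<open>w = \<pi> i h D k\<close>; the indices
\<open>g\<close> and \<open>a\<close> belong to the power \<open>s\<^bsup>2 g + a\<^esup>\<close>.\<close>
definition dual_monomial :: "real \<Rightarrow> real \<Rightarrow> real \<Rightarrow> int \<times> nat \<times> nat \<Rightarrow> complex" where
  "dual_monomial h D \<xi> = (\<lambda>(k, g, a). theta_coeff h D \<xi> k *
     (complex_of_real (h\<^sup>2 * D / 4) ^ g / fact g * ((\<i> * complex_of_real (pi * h * D * of_int k)) ^ a / fact a)))"

lemma gaussian_exp_summable:
  fixes c h \<xi> s :: real
  assumes c: "c > 0" and h: "h \<noteq> 0"
  shows "(\<lambda>k :: int. exp (- c * (\<xi> - h * of_int k)\<^sup>2) * exp (\<bar>s\<bar> * \<bar>\<xi> - h * of_int k\<bar>)) summable_on UNIV"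
proof -
  have "(\<lambda>k :: int. exp (s\<^sup>2 / (2 * c)) * exp (- (c / 2) * (\<xi> - h * of_int k)\<^sup>2)) summable_on UNIV"
    using assms by (intro summable_on_cmult_right summable_on_gaussian_int) auto
  from Infinite_Sum.abs_summable_on_comparison_test'[OF this, of "\<lambda>k. exp (- c * (\<xi> - h * of_int k)\<^sup>2) * exp (\<bar>s\<bar> * \<bar>\<xi> - h * of_int k\<bar>)"]
  show ?thesis
  proof (simp add: exp_add[symmetric], elim meta_mp)
    fix k :: int
    define x where "x = \<bar>\<xi> - h * of_int k\<bar>"
    have "0 \<le> (\<bar>s\<bar> - c * x)\<^sup>2 / (2 * c)" using c by simp
    also have "\<dots> = s\<^sup>2 / (2 * c) - \<bar>s\<bar> * x + c * x\<^sup>2 / 2"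
      using c by (simp add: power2_diff field_simps power2_eq_square)
    finally have "\<bar>s\<bar> * x - c * x\<^sup>2 \<le> s\<^sup>2 / (2 * c) - c * x\<^sup>2 / 2" by simp
    then show "\<bar>s\<bar> * \<bar>\<xi> - h * of_int k\<bar> - c * (\<xi> - h * of_int k)\<^sup>2 \<le> s\<^sup>2 / (2 * c) - c * (\<xi> - h * of_int k)\<^sup>2 / 2"
      by (simp add: x_def)
  qed
qed

lemma gauss_monomial_series:
  fixes h D \<xi> s :: real
  assumes h: "h > 0" and D: "D > 0"
  shows "(\<lambda>x. gauss_monomial h D \<xi> x * complex_of_real s ^ snd x) abs_summable_on UNIV"
    and "infsum (\<lambda>x. gauss_monomial h D \<xi> x * complex_of_real s ^ snd x) UNIV =
      (\<Sum>\<^sub>\<infinity>k :: int. complex_of_real (exp (- (\<xi> - h * of_int k)\<^sup>2 / (h\<^sup>2 * D)) * exp (s * (h * of_int k - \<xi>))))"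
proof -
  let ?f = "\<lambda>x. gauss_monomial h D \<xi> x * complex_of_real s ^ snd x"
  let ?g = "\<lambda>k :: int. exp (- (\<xi> - h * of_int k)\<^sup>2 / (h\<^sup>2 * D))"
  have f: "?f (k, b) = complex_of_real (?g k) * (complex_of_real (s * (h * of_int k - \<xi>)) ^ b / fact b)" for k b
    by (simp add: gauss_monomial_def power_mult_distrib)
  have "(\<lambda>x. norm (?f x)) summable_on (UNIV :: int set) \<times> (UNIV :: nat set)"
  proof (rule summable_on_SigmaI[where g = "\<lambda>k. ?g k * exp (\<bar>s\<bar> * \<bar>\<xi> - h * of_int k\<bar>)"])
    fix k :: int
    have "norm (?f (k, b)) = ?g k * ((\<bar>s\<bar> * \<bar>\<xi> - h * of_int k\<bar>) ^ b / fact b)" for b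
      unfolding f norm_mult norm_divide norm_power norm_of_real abs_mult by (simp add: abs_minus_commute)
    then show "((\<lambda>b. norm (?f (k, b))) has_sum ?g k * exp (\<bar>s\<bar> * \<bar>\<xi> - h * of_int k\<bar>)) UNIV"
      using has_sum_cmult_right[OF exp_has_sum(1)] by (simp only:)
  next
    show "(\<lambda>k. ?g k * exp (\<bar>s\<bar> * \<bar>\<xi> - h * of_int k\<bar>)) summable_on UNIV"
      using gaussian_exp_summable[of "1 / (h\<^sup>2 * D)" h \<xi> s] h D by simp
  qed simp
  then show abs: "?f abs_summable_on UNIV" by (simp only: UNIV_Times_UNIV)
  have "((\<lambda>k. complex_of_real (?g k * exp (s * (h * of_int k - \<xi>)))) has_sum infsum ?f UNIV) UNIV"
  proof (rule has_sum_SigmaD[where f = ?f and B = "\<lambda>_. UNIV"])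
    show "(?f has_sum infsum ?f UNIV) (UNIV \<times> UNIV)"
      using abs_summable_summable[OF abs] by simp
    show "((\<lambda>b. ?f (k, b)) has_sum complex_of_real (?g k * exp (s * (h * of_int k - \<xi>)))) UNIV" for k
      unfolding f of_real_mult exp_of_real[symmetric, of "s * (h * of_int k - \<xi>)"]
      by (intro has_sum_cmult_right exp_has_sum(1))
  qed
  then show "infsum ?f UNIV = (\<Sum>\<^sub>\<infinity>k :: int. complex_of_real (?g k * exp (s * (h * of_int k - \<xi>))))"
    by (rule infsumI[symmetric])
qed

lemma dual_monomial_series:
  fixes h D \<xi> s :: real
  assumes h: "h > 0" and D: "D > 0"
  shows "(\<lambda>(k, g, a). dual_monomial h D \<xi> (k, g, a) * complex_of_real s ^ (2 * g + a)) abs_summable_on UNIV"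
    and "infsum (\<lambda>(k, g, a). dual_monomial h D \<xi> (k, g, a) * complex_of_real s ^ (2 * g + a)) UNIV =
      (\<Sum>\<^sub>\<infinity>k :: int. theta_coeff h D \<xi> k * (exp (complex_of_real (h\<^sup>2 * D / 4 * s\<^sup>2)) * cis (pi * h * D * of_int k * s)))"
proof -
  let ?f = "\<lambda>(k, g, a). dual_monomial h D \<xi> (k, g, a) * complex_of_real s ^ (2 * g + a)"
  let ?c = "h\<^sup>2 * D / 4 * s\<^sup>2" and ?w = "\<lambda>k :: int. pi * h * D * of_int k * s"
  have f: "?f (k, y) = theta_coeff h D \<xi> k * (\<lambda>(g, a). complex_of_real ?c ^ g / fact g * ((\<i> * complex_of_real (?w k)) ^ a / fact a)) y" for k y
  proof -
    have "complex_of_real ?c = complex_of_real (h\<^sup>2 * D / 4) * complex_of_real s ^ 2"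
      "\<i> * complex_of_real (?w k) = (\<i> * complex_of_real (pi * h * D * of_int k)) * complex_of_real s" by simp_all
    moreover have "complex_of_real s ^ (2 * g + a) = (complex_of_real s ^ 2) ^ g * complex_of_real s ^ a" for g a
      by (simp add: power_add power_mult)
    ultimately show ?thesis
      by (cases y) (simp only: dual_monomial_def case_prod_conv power_mult_distrib times_divide_eq_left times_divide_eq_right mult_ac)
  qed
  have E: "norm (theta_coeff h D \<xi> k) = sqrt (pi * D) * exp (- pi\<^sup>2 * D * (of_int k)\<^sup>2)" for k
    using D by (simp add: theta_coeff_def norm_mult)
  have "(\<lambda>x. norm (?f x)) summable_on (UNIV :: int set) \<times> (UNIV :: (nat \<times> nat) set)"
  proof (rule summable_on_SigmaI[where g = "\<lambda>k. norm (theta_coeff h D \<xi> k) * (exp ?c * exp \<bar>?w k\<bar>)"])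
    fix k :: int
    have "((\<lambda>(g, a). ?c ^ g / fact g * (\<bar>?w k\<bar> ^ a / fact a)) has_sum exp ?c * exp \<bar>?w k\<bar>) (UNIV \<times> UNIV)"
      by (intro has_sum_times exp_has_sum)
    from has_sum_cmult_right[OF this, of "norm (theta_coeff h D \<xi> k)"]
    have "((\<lambda>y. norm (theta_coeff h D \<xi> k) * (\<lambda>(g, a). ?c ^ g / fact g * (\<bar>?w k\<bar> ^ a / fact a)) y) has_sum norm (theta_coeff h D \<xi> k) * (exp ?c * exp \<bar>?w k\<bar>)) UNIV"
      by simp
    moreover have "norm (theta_coeff h D \<xi> k) * (\<lambda>(g, a). ?c ^ g / fact g * (\<bar>?w k\<bar> ^ a / fact a)) y = norm (?f (k, y))" for y
      unfolding f using D by (cases y) (simp only: norm_mult norm_divide norm_power norm_of_real norm_ii case_prod_conv mult_1_left norm_fact, simp)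
    ultimately show "((\<lambda>y. norm (?f (k, y))) has_sum norm (theta_coeff h D \<xi> k) * (exp ?c * exp \<bar>?w k\<bar>)) UNIV" by (simp only:)
  next
    have "(\<lambda>k :: int. sqrt (pi * D) * exp ?c * (exp (- (pi\<^sup>2 * D) * (0 - 1 * of_int k)\<^sup>2) * exp (\<bar>pi * h * D * s\<bar> * \<bar>0 - 1 * of_int k\<bar>))) summable_on UNIV"
      by (intro summable_on_cmult_right gaussian_exp_summable) (use D in auto)
    then show "(\<lambda>k. norm (theta_coeff h D \<xi> k) * (exp ?c * exp \<bar>?w k\<bar>)) summable_on UNIV"
      unfolding E by (simp add: abs_mult mult_ac)
  qed simp
  then show abs: "?f abs_summable_on UNIV" by (simp only: UNIV_Times_UNIV)
  have "((\<lambda>k. theta_coeff h D \<xi> k * (exp (complex_of_real ?c) * cis (?w k))) has_sum infsum ?f UNIV) UNIV"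
  proof (rule has_sum_SigmaD[where f = ?f and B = "\<lambda>_. UNIV"])
    show "(?f has_sum infsum ?f UNIV) (UNIV \<times> UNIV)"
      using abs_summable_summable[OF abs] by simp
    show "((\<lambda>y. ?f (k, y)) has_sum theta_coeff h D \<xi> k * (exp (complex_of_real ?c) * cis (?w k))) UNIV" for k
      unfolding f cis_conv_exp UNIV_Times_UNIV[symmetric]
      by (intro has_sum_cmult_right has_sum_times exp_has_sum)
  qed
  then show "infsum ?f UNIV = (\<Sum>\<^sub>\<infinity>k. theta_coeff h D \<xi> k * (exp (complex_of_real ?c) * cis (?w k)))"
    by (rule infsumI[symmetric])
qed

text \<open>Completing the square, \<open>- (\<xi> - h k)\<^sup>2 / (4 c) + s (h k - \<xi>) = c s\<^sup>2 - (\<xi> + 2 c s - h k)\<^sup>2 / (4 c)\<close>. For real \<open>s\<close> the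
shifted argument is real, so the theta identity applies.\<close>
lemma generating_functions_agree:
  fixes h D \<xi> s :: real
  assumes h: "h > 0" and D: "D > 0"
  shows "infsum (\<lambda>x. gauss_monomial h D \<xi> x * complex_of_real s ^ snd x) UNIV =
    infsum (\<lambda>(k, g, a). dual_monomial h D \<xi> (k, g, a) * complex_of_real s ^ (2 * g + a)) UNIV"
proof -
  define c where "c = h\<^sup>2 * D / 4"
  define t where "t = (\<xi> + 2 * c * s) / h"
  have c: "c > 0" using h D by (simp add: c_def)
  have 1: "exp (- (\<xi> - h * of_int k)\<^sup>2 / (h\<^sup>2 * D)) * exp (s * (h * of_int k - \<xi>)) =
    exp (c * s\<^sup>2) * exp (- (t - of_int k)\<^sup>2 / D)" for k :: int
  proof -
    have "(t - of_int k)\<^sup>2 / D = ((t - of_int k) * h)\<^sup>2 / (4 * c)"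
      using h D by (simp add: c_def power_mult_distrib)
    also have "(t - of_int k) * h = (\<xi> - h * of_int k) + 2 * c * s"
      using h by (simp add: t_def field_simps)
    also have "\<dots>\<^sup>2 / (4 * c) = (\<xi> - h * of_int k)\<^sup>2 / (4 * c) + s * (\<xi> - h * of_int k) + c * s\<^sup>2"
      using c by (simp add: power2_sum field_simps power2_eq_square)
    finally show ?thesis by (simp add: exp_add[symmetric] c_def algebra_simps)
  qed
  have 2: "complex_of_real (sqrt (pi * D) * exp (- pi\<^sup>2 * D * (of_int k)\<^sup>2)) * cis (2 * pi * of_int k * t) =
    theta_coeff h D \<xi> k * cis (pi * h * D * of_int k * s)" for k :: int
  proof -
    have "2 * pi * of_int k * t = 2 * pi * of_int k * (\<xi> / h) + pi * h * D * of_int k * s"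
      using h by (simp add: t_def c_def field_simps power2_eq_square)
    then show ?thesis by (simp add: theta_coeff_def cis_mult)
  qed
  have "infsum (\<lambda>x. gauss_monomial h D \<xi> x * complex_of_real s ^ snd x) UNIV =
    complex_of_real (exp (c * s\<^sup>2)) * (\<Sum>\<^sub>\<infinity>k :: int. complex_of_real (exp (- (t - of_int k)\<^sup>2 / D)))"
    unfolding gauss_monomial_series(2)[OF h D] 1 by (simp add: infsum_cmult_right')
  also have "\<dots> = complex_of_real (exp (c * s\<^sup>2)) * (\<Sum>\<^sub>\<infinity>k :: int. theta_coeff h D \<xi> k * cis (pi * h * D * of_int k * s))"
    unfolding theta_identity[OF D] 2 ..
  also have "\<dots> = infsum (\<lambda>(k, g, a). dual_monomial h D \<xi> (k, g, a) * complex_of_real s ^ (2 * g + a)) UNIV"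
    unfolding dual_monomial_series(2)[OF h D] c_def[symmetric] exp_of_real
    by (simp add: infsum_cmult_right'[symmetric] mult_ac)
  finally show ?thesis .
qed

theorem poisson_monomial:
  fixes h D \<xi> :: real
  assumes h: "h > 0" and D: "D > 0"
  shows "infsum (gauss_monomial h D \<xi>) {x. snd x = b} = infsum (dual_monomial h D \<xi>) {(k, g, a). 2 * g + a = b}"
proof -
  let ?P = "\<lambda>b. infsum (gauss_monomial h D \<xi>) {x. snd x = b}"
  let ?X = "\<lambda>b. infsum (dual_monomial h D \<xi>) {(k, g, a). 2 * g + a = b}"
  have "((\<lambda>b. (?P b - ?X b) * complex_of_real s ^ b) has_sum 0) UNIV" for s :: real
  proof -
    let ?f = "\<lambda>x. gauss_monomial h D \<xi> x * complex_of_real s ^ snd x"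
    let ?g = "\<lambda>(k, g, a). dual_monomial h D \<xi> (k, g, a) * complex_of_real s ^ (2 * g + a)"
    have "((\<lambda>b. infsum ?f {x. snd x = b}) has_sum infsum ?f UNIV) UNIV"
      by (rule has_sum_fibers_infsum[OF abs_summable_summable[OF gauss_monomial_series(1)[OF assms]]])
    moreover have "infsum ?f {x. snd x = b} = ?P b * complex_of_real s ^ b" for b
      by (subst infsum_cmult_left'[symmetric]) (intro infsum_cong, auto)
    ultimately have 1: "((\<lambda>b. ?P b * complex_of_real s ^ b) has_sum infsum ?f UNIV) UNIV" by (simp only:)
    have "((\<lambda>b. infsum ?g {x. (\<lambda>(k, g, a). 2 * g + a) x = b}) has_sum infsum ?g UNIV) UNIV"
      by (rule has_sum_fibers_infsum[OF abs_summable_summable[OF dual_monomial_series(1)[OF assms]]])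
    moreover have "infsum ?g {x. (\<lambda>(k, g, a). 2 * g + a) x = b} = ?X b * complex_of_real s ^ b" for b
      by (subst infsum_cmult_left'[symmetric]) (intro infsum_cong_neutral, auto)
    ultimately have 2: "((\<lambda>b. ?X b * complex_of_real s ^ b) has_sum infsum ?f UNIV) UNIV"
      by (simp only: generating_functions_agree[OF h D])
    from has_sum_add[OF 1 has_sum_cmult_right[OF 2, of "- 1"]] show ?thesis by (simp add: left_diff_distrib)
  qed
  from power_series_zero_on_reals[OF this] show ?thesis by simp
qed

section \<open>Factorial weights and multi-indices\<close>

lemma fact_add_le: "(fact (m + n) :: real) \<le> 2 ^ (m + n) * fact m * fact n"
proof -
  have "fact m * fact n * ((m + n) choose m) = (fact (m + n) :: nat)"
    using binomial_fact_lemma[of m "m + n"] by simp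
  then have "fact m * fact n * real ((m + n) choose m) = (fact (m + n) :: real)"
    by (metis of_nat_fact of_nat_mult)
  moreover have "real ((m + n) choose m) \<le> 2 ^ (m + n)"
    using binomial_le_pow2[of "m + n" m] by (metis of_nat_le_iff of_nat_numeral of_nat_power)
  then have "fact m * fact n * real ((m + n) choose m) \<le> fact m * fact n * 2 ^ (m + n)"
    by (intro mult_left_mono) auto
  ultimately show ?thesis by (simp add: mult_ac)
qed

lemma power_le_fact_exp: "x ^ n \<le> fact n * exp x" if "x \<ge> 0" for x :: real
proof -
  have "x ^ n / fact n = (\<Sum>k\<in>{n}. x ^ k / fact k)" by simp
  also have "\<dots> \<le> exp x" 
    by (rule finite_sum_le_has_sum[OF exp_has_sum(1)]) (use that in auto)
  finally show ?thesis by (simp add: divide_le_eq mult.commute)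
qed

lemma power2_power_commute: "(x ^ b)\<^sup>2 = (x\<^sup>2) ^ b" for x :: real
  by (simp add: power_mult[symmetric] mult.commute)

lemma power2_sqrt_power: "x \<ge> 0 \<Longrightarrow> (sqrt x ^ b)\<^sup>2 = x ^ b"
  by (metis power_commutes power_mult mult.commute real_sqrt_pow2)

text \<open>Squaring reduces this to \<open>(2 z)\<^sup>b \<le> b! exp (2 z)\<close> with \<open>z = \<rho>\<^sup>2 t\<^sup>2\<close>; the factor 2 leaves a geometric factor for
summation over \<open>b\<close>.\<close>
lemma power_div_sqrt_fact_le:
  fixes \<rho> t :: real
  assumes "\<rho> \<ge> 0" "t \<ge> 0"
  shows "(\<rho> * t) ^ b / sqrt (fact b) \<le> sqrt (1 / 2) ^ b * exp (\<rho>\<^sup>2 * t\<^sup>2)"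
proof (rule power2_le_imp_le)
  have "(2 * (\<rho> * t)\<^sup>2) ^ b \<le> fact b * exp (2 * (\<rho> * t)\<^sup>2)" by (rule power_le_fact_exp) simp
  then have "((\<rho> * t)\<^sup>2) ^ b / fact b \<le> (1 / 2) ^ b * exp (2 * (\<rho> * t)\<^sup>2)"
    by (simp add: power_mult_distrib divide_simps mult_ac)
  also have "exp (2 * (\<rho> * t)\<^sup>2) = (exp (\<rho>\<^sup>2 * t\<^sup>2))\<^sup>2"
    by (simp add: power_mult_distrib exp_double)
  finally show "((\<rho> * t) ^ b / sqrt (fact b))\<^sup>2 \<le> (sqrt (1 / 2) ^ b * exp (\<rho>\<^sup>2 * t\<^sup>2))\<^sup>2"
    by (simp add: power_mult_distrib power_divide power2_sqrt_power power2_power_commute del: real_sqrt_divide)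
qed simp

text \<open>Separates the exponents \<open>g\<close> and \<open>a\<close> in the weight of a coefficient of order \<open>2 g + a\<close>, at the price of factors
that a small \<open>\<rho>\<close> absorbs.\<close>
lemma sqrt_fact_weight_le:
  fixes \<rho> c :: real
  assumes "\<rho> \<ge> 0" "c \<ge> 0"
  shows "sqrt (fact (2 * g + a)) * \<rho> ^ (2 * g + a) * (c ^ g / fact g) \<le> (4 * c * \<rho>\<^sup>2) ^ g * (sqrt (fact a) * (sqrt 2 * \<rho>) ^ a)"
proof -
  have "(fact (2 * g + a) :: real) \<le> 2 ^ (2 * g + a) * fact (2 * g) * fact a" by (rule fact_add_le)
  also have "\<dots> \<le> 2 ^ (2 * g + a) * (2 ^ (g + g) * fact g * fact g) * fact a"
    using fact_add_le[of g g] by (intro mult_right_mono mult_left_mono) (auto simp: mult_2)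
  also have "\<dots> = (4 ^ g * fact g)\<^sup>2 * (2 ^ a * fact a)"
  proof -
    have "(2 :: real) ^ (2 * g + a) * 2 ^ (g + g) = (4 ^ g)\<^sup>2 * 2 ^ a"
      by (simp add: power_add power_mult power2_eq_square flip: power_mult_distrib)
    then show ?thesis by (simp only: power_mult_distrib power2_eq_square mult_ac)
  qed
  finally have "sqrt (fact (2 * g + a)) \<le> sqrt ((4 ^ g * fact g)\<^sup>2 * (2 ^ a * fact a))" by simp
  also have "\<dots> = (4 ^ g * fact g) * (sqrt 2 ^ a * sqrt (fact a))"
  proof -
    have "sqrt (x\<^sup>2 * y) = x * sqrt y" if "x \<ge> 0" for x y :: real using that by (simp add: real_sqrt_mult)
    from this[of "4 ^ g * fact g"] show ?thesis by (simp add: real_sqrt_mult[of "2 ^ a"] real_sqrt_power)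
  qed
  finally have "sqrt (fact (2 * g + a)) * (\<rho> ^ (2 * g + a) * (c ^ g / fact g)) \<le> (4 ^ g * fact g) * (sqrt 2 ^ a * sqrt (fact a)) * (\<rho> ^ (2 * g + a) * (c ^ g / fact g))"
    using assms by (intro mult_right_mono) auto
  also have "\<dots> = (4 * c * \<rho>\<^sup>2) ^ g * (sqrt (fact a) * (sqrt 2 * \<rho>) ^ a)"
    by (simp add: power_mult_distrib power_add power_mult power2_power_commute field_simps)
  finally show ?thesis by (simp only: mult.assoc)
qed

lemma finite_mi_abs_le: "finite {\<beta> :: nat ^ 'n. mi_abs \<beta> \<le> K}"
proof (rule finite_subset)
  have "\<beta> $ i \<le> mi_abs \<beta>" for \<beta> :: "nat ^ 'n" and i
    unfolding mi_abs_def by (rule member_le_sum) auto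
  then show "{\<beta> :: nat ^ 'n. mi_abs \<beta> \<le> K} \<subseteq> vec_lambda ` (PiE UNIV (\<lambda>_. {..K}))"
    by (auto intro!: image_eqI[where x = "vec_nth _"] intro: order_trans)
qed (auto intro!: finite_imageI finite_PiE)

lemma mi_abs_add: "mi_abs (\<alpha> + \<beta>) = mi_abs \<alpha> + mi_abs \<beta>"
  by (simp add: mi_abs_def sum.distrib)

lemma mi_abs_axis: "mi_abs (axis i k) = k"
  by (simp add: mi_abs_def axis_def if_distrib cong: if_cong)

lemma mi_abs_eq_0_iff: "mi_abs \<beta> = 0 \<longleftrightarrow> \<beta> = 0"
  by (auto simp: mi_abs_def vec_eq_iff)

lemma mi_fact_pos: "mi_fact \<beta> > 0"
  by (simp add: mi_fact_def prod_pos)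

lemma mi_fact_add_axis: "mi_fact (\<gamma> + axis i 1) = real (\<gamma> $ i + 1) * mi_fact \<gamma>"
proof -
  have "mi_fact (\<gamma> + axis i 1) = (\<Prod>j\<in>UNIV. (if j = i then real (\<gamma> $ i + 1) else 1) * fact (\<gamma> $ j))"
    unfolding mi_fact_def by (rule prod.cong) (auto simp: axis_def)
  then show ?thesis by (simp add: prod.distrib mi_fact_def)
qed

lemma sqrt_prod: "sqrt (\<Prod>i\<in>A. f i) = (\<Prod>i\<in>A. sqrt (f i))"
  by (induction A rule: infinite_finite_induct) (auto simp: real_sqrt_mult)

section \<open>Coefficient families annihilated by the Laplacian\<close>

text \<open>The two properties of the derivatives \<open>d \<beta> = \<partial>\<^sup>\<beta> u(x)\<close> of a harmonic function at one point from which the summation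
formulas follow.\<close>
locale harmonic_coefficients =
  fixes d :: "nat ^ 'n \<Rightarrow> complex"
  assumes weighted_summable: "\<And>y :: real ^ 'n. 
      (\<lambda>\<beta>. norm (d \<beta> / complex_of_real (sqrt (mi_fact \<beta>)) * complex_of_real (mi_pow y \<beta>))) summable_on UNIV"
    and laplace: "\<And>\<beta>. (\<Sum>i\<in>UNIV. d (\<beta> + axis i 2)) = 0"
begin

text \<open>The weighted family at \<open>y = (1 / \<rho>, \<dots>, 1 / \<rho>)\<close> is bounded by its sum.\<close>
lemma coefficient_bound:
  fixes \<rho> :: real
  assumes \<rho>: "\<rho> > 0"
  obtains C where "C \<ge> 0" "\<And>\<beta>. norm (d \<beta>) \<le> C * (\<Prod>i\<in>UNIV. sqrt (fact (\<beta> $ i)) * \<rho> ^ (\<beta> $ i))"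
proof -
  define y :: "real ^ 'n" where "y = (\<chi> i. 1 / \<rho>)"
  let ?f = "\<lambda>\<beta>. norm (d \<beta> / complex_of_real (sqrt (mi_fact \<beta>)) * complex_of_real (mi_pow y \<beta>))"
  have s: "?f summable_on UNIV" by (rule weighted_summable)
  have le: "?f \<beta> \<le> infsum ?f UNIV" for \<beta>
    using finite_sum_le_infsum[OF s, of "{\<beta>}"] by simp
  have eq: "norm (d \<beta>) = ?f \<beta> * (\<Prod>i\<in>UNIV. sqrt (fact (\<beta> $ i)) * \<rho> ^ (\<beta> $ i))" for \<beta>
  proof -
    have "mi_pow y \<beta> * (\<Prod>i\<in>UNIV. \<rho> ^ (\<beta> $ i)) = 1"
      using \<rho> by (simp add: mi_pow_def y_def prod.distrib[symmetric] power_one_over)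
    moreover have "mi_pow y \<beta> > 0" using \<rho> by (simp add: mi_pow_def y_def prod_pos)
    moreover have "sqrt (mi_fact \<beta>) > 0" using mi_fact_pos[of \<beta>] by simp
    ultimately show ?thesis
      by (simp add: norm_mult norm_divide prod.distrib sqrt_prod[symmetric] mi_fact_def[symmetric] mult_ac)
  qed
  show ?thesis
  proof (rule that[of "infsum ?f UNIV"])
    show "infsum ?f UNIV \<ge> 0" by (intro infsum_nonneg) auto
    show "norm (d \<beta>) \<le> infsum ?f UNIV * (\<Prod>i\<in>UNIV. sqrt (fact (\<beta> $ i)) * \<rho> ^ (\<beta> $ i))" for \<beta>
      unfolding eq[of \<beta>] using \<rho> by (intro mult_right_mono le prod_nonneg) auto
  qed
qed

text \<open>The weight in the coefficient bound is a product over the coordinates, so absolute convergence over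
vectors of indices reduces to a majorant in a single coordinate.\<close>
lemma product_dominated:
  fixes F :: "'b \<Rightarrow> nat" and t :: "'n \<Rightarrow> 'b \<Rightarrow> complex" and w :: "'n \<Rightarrow> 'b \<Rightarrow> real"
  assumes \<rho>: "\<rho> > 0"
    and w: "\<And>i. w i abs_summable_on UNIV"
    and le: "\<And>i x. sqrt (fact (F x)) * \<rho> ^ F x * norm (t i x) \<le> w i x"
  shows "(\<lambda>\<sigma> :: 'b ^ 'n. d (\<chi> i. F (\<sigma> $ i)) * (\<Prod>i\<in>UNIV. t i (\<sigma> $ i))) abs_summable_on UNIV"
proof -
  obtain C where C: "C \<ge> 0" "\<And>\<beta>. norm (d \<beta>) \<le> C * (\<Prod>i\<in>UNIV. sqrt (fact (\<beta> $ i)) * \<rho> ^ (\<beta> $ i))"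
    using coefficient_bound[OF \<rho>] by blast
  have "(\<lambda>\<sigma> :: 'b ^ 'n. \<Prod>i\<in>UNIV. w i (\<sigma> $ i)) abs_summable_on {\<sigma>. \<forall>i. \<sigma> $ i \<in> UNIV}"
    by (rule prod_vec_sum(1)[OF w])
  then have "(\<lambda>\<sigma> :: 'b ^ 'n. C * norm (\<Prod>i\<in>UNIV. w i (\<sigma> $ i))) summable_on UNIV"
    by (intro summable_on_cmult_right) simp
  then show ?thesis
  proof (rule Infinite_Sum.abs_summable_on_comparison_test')
    fix \<sigma> :: "'b ^ 'n"
    have "norm (d (\<chi> i. F (\<sigma> $ i)) * (\<Prod>i\<in>UNIV. t i (\<sigma> $ i))) = norm (d (\<chi> i. F (\<sigma> $ i))) * (\<Prod>i\<in>UNIV. norm (t i (\<sigma> $ i)))"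
      by (simp add: norm_mult prod_norm)
    also have "\<dots> \<le> C * (\<Prod>i\<in>UNIV. sqrt (fact (F (\<sigma> $ i))) * \<rho> ^ F (\<sigma> $ i)) * (\<Prod>i\<in>UNIV. norm (t i (\<sigma> $ i)))"
      using C(2)[of "\<chi> i. F (\<sigma> $ i)"] by (intro mult_right_mono prod_nonneg) auto
    also have "\<dots> = C * (\<Prod>i\<in>UNIV. sqrt (fact (F (\<sigma> $ i))) * \<rho> ^ F (\<sigma> $ i) * norm (t i (\<sigma> $ i)))"
      by (simp add: prod.distrib mult_ac)
    also have "\<dots> \<le> C * (\<Prod>i\<in>UNIV. w i (\<sigma> $ i))"
      using C(1) \<rho> le by (intro mult_left_mono prod_mono) auto
    also have "\<dots> \<le> C * norm (\<Prod>i\<in>UNIV. w i (\<sigma> $ i))"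
      using C(1) by (intro mult_left_mono) auto
    finally show "norm (d (\<chi> i. F (\<sigma> $ i)) * (\<Prod>i\<in>UNIV. t i (\<sigma> $ i))) \<le> C * norm (\<Prod>i\<in>UNIV. w i (\<sigma> $ i))" .
  qed
qed

lemma summable_half_power: "(\<lambda>b. sqrt (1 / 2) ^ b) abs_summable_on (UNIV :: nat set)"
proof -
  have "sqrt (1 / 2) < sqrt 1" by (subst real_sqrt_less_iff) simp
  then have "norm (sqrt (1 / 2)) < 1" by simp
  then have "summable (\<lambda>b. norm (sqrt (1 / 2)) ^ b)" by (intro summable_geometric) simp
  then have "summable (\<lambda>b. norm (norm (sqrt (1 / 2) ^ b)))" by (simp add: norm_power)
  then show ?thesis by (rule norm_summable_imp_summable_on)
qed

lemma taylor_abs_summable: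
  fixes z :: "complex ^ 'n"
  shows "(\<lambda>\<beta>. d \<beta> * divided_power (\<lambda>i. z $ i) \<beta>) abs_summable_on UNIV"
proof -
  have "(\<lambda>\<sigma> :: nat ^ 'n. d (\<chi> i. id (\<sigma> $ i)) * (\<Prod>i\<in>UNIV. (\<lambda>b. (z $ i) ^ b / fact b) (\<sigma> $ i))) abs_summable_on UNIV"
  proof (rule product_dominated[where \<rho> = 1 and w = "\<lambda>i b. exp (1\<^sup>2 * (norm (z $ i))\<^sup>2) * sqrt (1 / 2) ^ b"])
    show "(\<lambda>b. exp (1\<^sup>2 * (norm (z $ i))\<^sup>2) * sqrt (1 / 2) ^ b) abs_summable_on (UNIV :: nat set)" for i
      unfolding norm_mult by (rule summable_on_cmult_right[OF summable_half_power])
    show "sqrt (fact (id b)) * 1 ^ id b * norm ((z $ i) ^ b / fact b) \<le> exp (1\<^sup>2 * (norm (z $ i))\<^sup>2) * sqrt (1 / 2) ^ b" for i b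
    proof -
      have "sqrt (fact (id b)) * 1 ^ id b * norm ((z $ i) ^ b / fact b) = (1 * norm (z $ i)) ^ b / sqrt (fact b)"
      proof -
        have "sqrt x * (N / x) = N / sqrt x" if "x > 0" for x N :: real
          using that by (simp add: divide_simps)
        then show ?thesis by (simp add: norm_divide norm_power del: times_divide_eq_right)
      qed
      also have "\<dots> \<le> sqrt (1 / 2) ^ b * exp (1\<^sup>2 * (norm (z $ i))\<^sup>2)"
        by (rule power_div_sqrt_fact_le) auto
      finally show ?thesis by (simp add: mult.commute)
    qed
  qed simp
  then show ?thesis by simp
qed

text \<open>This is \<open>\<Delta>\<^sup>j / j!\<close> applied at \<open>\<alpha>\<close>. Multiply by \<open>j = \<Sum>\<^sub>i \<gamma>\<^sub>i\<close>, cancel \<open>\<gamma>\<^sub>i\<close> against the factorial and shift \<open>\<gamma>\<close> by \<open>e\<^sub>i\<close>: one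
Laplacian factors out.\<close>
lemma laplace_power_zero:
  assumes "j > 0"
  shows "(\<Sum>\<gamma> | mi_abs \<gamma> = j. d (\<alpha> + \<gamma> + \<gamma>) / complex_of_real (mi_fact \<gamma>)) = 0"
proof -
  have fin: "finite {\<gamma> :: nat ^ 'n. mi_abs \<gamma> = j}" for j
    by (rule finite_subset[OF _ finite_mi_abs_le[of j]]) auto
  let ?t = "\<lambda>\<gamma>. d (\<alpha> + \<gamma> + \<gamma>) / complex_of_real (mi_fact \<gamma>)"
  have part: "(\<Sum>\<gamma> | mi_abs \<gamma> = j. of_nat (\<gamma> $ i) * ?t \<gamma>) =
      (\<Sum>\<gamma> | mi_abs \<gamma> = j - 1. d (\<alpha> + \<gamma> + \<gamma> + axis i 2) / complex_of_real (mi_fact \<gamma>))" for i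
  proof -
    have "(\<Sum>\<gamma> | mi_abs \<gamma> = j. of_nat (\<gamma> $ i) * ?t \<gamma>) = (\<Sum>\<gamma> | mi_abs \<gamma> = j \<and> \<gamma> $ i \<noteq> 0. of_nat (\<gamma> $ i) * ?t \<gamma>)"
      by (rule sum.mono_neutral_right) (use fin in auto)
    also have "\<dots> = (\<Sum>\<gamma> | mi_abs \<gamma> = j - 1. of_nat ((\<gamma> + axis i 1) $ i) * ?t (\<gamma> + axis i 1))"
    proof (rule sum.reindex_bij_witness[where i = "\<lambda>\<gamma>. \<gamma> + axis i 1" and j = "\<lambda>\<gamma>. \<gamma> - axis i 1"])
      fix \<gamma> :: "nat ^ 'n" assume g: "\<gamma> \<in> {\<gamma>. mi_abs \<gamma> = j \<and> \<gamma> $ i \<noteq> 0}"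
      then show eq: "\<gamma> - axis i 1 + axis i 1 = \<gamma>" by (auto simp: vec_eq_iff axis_def)
      show "\<gamma> - axis i 1 \<in> {\<gamma>. mi_abs \<gamma> = j - 1}"
        using g mi_abs_add[of "\<gamma> - axis i 1" "axis i 1"] unfolding eq mi_abs_axis by auto
      show "of_nat ((\<gamma> - axis i 1 + axis i 1) $ i) * ?t (\<gamma> - axis i 1 + axis i 1) = of_nat (\<gamma> $ i) * ?t \<gamma>"
        unfolding eq ..
    next
      fix \<gamma> :: "nat ^ 'n" assume "\<gamma> \<in> {\<gamma>. mi_abs \<gamma> = j - 1}"
      then show "\<gamma> + axis i 1 - axis i 1 = \<gamma>" "\<gamma> + axis i 1 \<in> {\<gamma>. mi_abs \<gamma> = j \<and> \<gamma> $ i \<noteq> 0}"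
        using assms by (auto simp: vec_eq_iff mi_abs_add mi_abs_axis)
    qed
    also have "\<dots> = (\<Sum>\<gamma> | mi_abs \<gamma> = j - 1. d (\<alpha> + \<gamma> + \<gamma> + axis i 2) / complex_of_real (mi_fact \<gamma>))"
    proof (rule sum.cong)
      fix \<gamma> :: "nat ^ 'n"
      have "\<alpha> + (\<gamma> + axis i 1) + (\<gamma> + axis i 1) = \<alpha> + \<gamma> + \<gamma> + axis i 2"
        by (auto simp: vec_eq_iff axis_def)
      moreover have "(\<gamma> + axis i 1) $ i = \<gamma> $ i + 1" by simp
      moreover have "complex_of_real (real (\<gamma> $ i + 1)) \<noteq> 0"
        unfolding of_real_eq_0_iff by simp
      ultimately show "of_nat ((\<gamma> + axis i 1) $ i) * ?t (\<gamma> + axis i 1) = d (\<alpha> + \<gamma> + \<gamma> + axis i 2) / complex_of_real (mi_fact \<gamma>)"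
        unfolding mi_fact_add_axis of_real_mult by (simp only: of_real_of_nat_eq) simp
    qed simp
    finally show ?thesis .
  qed
  have "of_nat j * (\<Sum>\<gamma> | mi_abs \<gamma> = j. ?t \<gamma>) = (\<Sum>\<gamma> | mi_abs \<gamma> = j. (\<Sum>i\<in>UNIV. of_nat (\<gamma> $ i) * ?t \<gamma>))"
    unfolding sum_distrib_left
  proof (rule sum.cong)
    fix \<gamma> :: "nat ^ 'n" assume "\<gamma> \<in> {\<gamma>. mi_abs \<gamma> = j}"
    then have "(of_nat j :: complex) = (\<Sum>i\<in>UNIV. of_nat (\<gamma> $ i))" by (auto simp: mi_abs_def)
    then show "of_nat j * ?t \<gamma> = (\<Sum>i\<in>UNIV. of_nat (\<gamma> $ i) * ?t \<gamma>)" by (simp only: sum_distrib_right)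
  qed simp
  also have "\<dots> = (\<Sum>i\<in>UNIV. \<Sum>\<gamma> | mi_abs \<gamma> = j. of_nat (\<gamma> $ i) * ?t \<gamma>)" by (rule sum.swap)
  also have "\<dots> = (\<Sum>\<gamma> | mi_abs \<gamma> = j - 1. \<Sum>i\<in>UNIV. d (\<alpha> + \<gamma> + \<gamma> + axis i 2) / complex_of_real (mi_fact \<gamma>))"
    unfolding part by (rule sum.swap)
  also have "\<dots> = 0" unfolding sum_divide_distrib[symmetric] laplace by simp
  finally show ?thesis using assms by simp
qed

text \<open>The heat operator \<open>exp (c \<Delta>)\<close> fixes the coefficients: group by \<open>|\<gamma>| = j\<close>, where only \<open>j = 0\<close> contributes.\<close>
lemma heat_invariance:
  fixes c :: real
  assumes c: "c > 0"
  shows "((\<lambda>\<gamma>. d (\<alpha> + \<gamma> + \<gamma>) * divided_power (\<lambda>i. complex_of_real c) \<gamma>) has_sum d \<alpha>) UNIV"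
proof -
  let ?f = "\<lambda>\<gamma>. d (\<alpha> + \<gamma> + \<gamma>) * divided_power (\<lambda>i. complex_of_real c) \<gamma>"
  (* This choice makes the ratio 4 c rho^2 of the geometric series in g equal to 1/4. *)
  define \<rho> where "\<rho> = sqrt (1 / (16 * c))"
  have \<rho>: "\<rho> > 0" "4 * c * \<rho>\<^sup>2 = 1 / 4" using c by (simp_all add: \<rho>_def)
  obtain C where C: "C \<ge> 0" "\<And>\<beta>. norm (d \<beta>) \<le> C * (\<Prod>i\<in>UNIV. sqrt (fact (\<beta> $ i)) * \<rho> ^ (\<beta> $ i))"
    using coefficient_bound[OF \<rho>(1)] by blast
  let ?w = "\<lambda>i b. (1 / 4 :: real) ^ b * (sqrt (fact (\<alpha> $ i)) * (sqrt 2 * \<rho>) ^ (\<alpha> $ i))"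
  have "summable (\<lambda>b. norm (norm ((1 / 4 :: real) ^ b)))" by (simp add: norm_power summable_geometric)
  then have g: "(\<lambda>b :: nat. (1 / 4 :: real) ^ b) abs_summable_on UNIV" by (rule norm_summable_imp_summable_on)
  have "?w i abs_summable_on UNIV" for i unfolding norm_mult by (rule summable_on_cmult_left[OF g])
  from prod_vec_sum(1)[OF this]
  have "(\<lambda>\<gamma> :: nat ^ 'n. C * norm (\<Prod>i\<in>UNIV. ?w i (\<gamma> $ i))) summable_on UNIV"
    by (intro summable_on_cmult_right) simp
  then have "?f abs_summable_on UNIV"
  proof (rule Infinite_Sum.abs_summable_on_comparison_test')
    fix \<gamma> :: "nat ^ 'n"
    have idx: "(\<alpha> + \<gamma> + \<gamma>) $ i = 2 * \<gamma> $ i + \<alpha> $ i" for i by simp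
    have "norm (?f \<gamma>) = norm (d (\<alpha> + \<gamma> + \<gamma>)) * (\<Prod>i\<in>UNIV. c ^ (\<gamma> $ i) / fact (\<gamma> $ i))"
      using c by (simp add: norm_mult prod_norm[symmetric] norm_divide norm_power)
    also have "\<dots> \<le> C * (\<Prod>i\<in>UNIV. sqrt (fact (2 * \<gamma> $ i + \<alpha> $ i)) * \<rho> ^ (2 * \<gamma> $ i + \<alpha> $ i)) * (\<Prod>i\<in>UNIV. c ^ (\<gamma> $ i) / fact (\<gamma> $ i))"
      using C(2)[of "\<alpha> + \<gamma> + \<gamma>", unfolded idx] c by (intro mult_right_mono prod_nonneg) auto
    also have "\<dots> = C * (\<Prod>i\<in>UNIV. sqrt (fact (2 * \<gamma> $ i + \<alpha> $ i)) * \<rho> ^ (2 * \<gamma> $ i + \<alpha> $ i) * (c ^ (\<gamma> $ i) / fact (\<gamma> $ i)))"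
      by (simp only: prod.distrib mult.assoc)
    also have "\<dots> \<le> C * (\<Prod>i\<in>UNIV. (4 * c * \<rho>\<^sup>2) ^ (\<gamma> $ i) * (sqrt (fact (\<alpha> $ i)) * (sqrt 2 * \<rho>) ^ (\<alpha> $ i)))"
      using C(1) \<rho>(1) c by (intro mult_left_mono prod_mono conjI sqrt_fact_weight_le) auto
    also have "\<dots> \<le> C * norm (\<Prod>i\<in>UNIV. ?w i (\<gamma> $ i))"
      unfolding \<rho>(2) using C(1) by (intro mult_left_mono) auto
    finally show "norm (?f \<gamma>) \<le> C * norm (\<Prod>i\<in>UNIV. ?w i (\<gamma> $ i))" .
  qed
  then have s: "?f summable_on UNIV" by (rule abs_summable_summable)
  have f: "?f \<gamma> = complex_of_real c ^ mi_abs \<gamma> * (d (\<alpha> + \<gamma> + \<gamma>) / complex_of_real (mi_fact \<gamma>))" for \<gamma>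
    by (simp add: prod_dividef mi_abs_def mi_fact_def power_sum)
  have "((\<lambda>j :: nat. if j = 0 then d \<alpha> else 0) has_sum infsum ?f UNIV) UNIV"
  proof (rule has_sum_fibers[where \<phi> = mi_abs, OF has_sum_infsum[OF s]])
    fix j
    have fin: "finite {\<gamma> :: nat ^ 'n. mi_abs \<gamma> = j}"
      by (rule finite_subset[OF _ finite_mi_abs_le[of j]]) auto
    have "sum ?f {\<gamma>. mi_abs \<gamma> = j} = complex_of_real c ^ j * (\<Sum>\<gamma> | mi_abs \<gamma> = j. d (\<alpha> + \<gamma> + \<gamma>) / complex_of_real (mi_fact \<gamma>))"
      unfolding f sum_distrib_left by (rule sum.cong) auto
    also have "\<dots> = (if j = 0 then d \<alpha> else 0)"
    proof (cases "j = 0")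
      case False
      then show ?thesis using laplace_power_zero[of j \<alpha>] by simp
    qed (simp add: mi_abs_eq_0_iff mi_fact_def)
    finally show "(?f has_sum (if j = 0 then d \<alpha> else 0)) {\<gamma>. mi_abs \<gamma> = j}"
      using has_sum_finite[OF fin, of ?f] by simp
  qed
  moreover have "((\<lambda>j :: nat. if j = 0 then d \<alpha> else 0) has_sum d \<alpha>) UNIV"
    by (rule has_sum_finite_neutralI[of "{0}"]) auto
  ultimately have "infsum ?f UNIV = d \<alpha>" by (rule has_sum_unique)
  with has_sum_infsum[OF s] show ?thesis by simp
qed

end

section \<open>Both sides of Poisson summation\<close>

definition poisson_moment :: "real \<Rightarrow> real \<Rightarrow> real ^ 'n \<Rightarrow> nat ^ 'n \<Rightarrow> complex" where
  "poisson_moment h D x \<beta> = (\<Prod>i\<in>UNIV. infsum (gauss_monomial h D (x $ i)) {y. snd y = \<beta> $ i})"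

lemma gauss_eq_prod:
  assumes "h > 0" "D > 0"
  shows "gauss h D x m = (\<Prod>i\<in>UNIV. exp (- (x $ i - h * of_int (m $ i))\<^sup>2 / (h\<^sup>2 * D)))"
proof -
  have "(norm (x - h *\<^sub>R int_vec m))\<^sup>2 = (\<Sum>i\<in>UNIV. (x $ i - h * of_int (m $ i))\<^sup>2)"
    unfolding power2_norm_eq_inner inner_vec_def by (simp add: int_vec_def power2_eq_square)
  then show ?thesis unfolding gauss_def
    by (simp add: exp_sum[symmetric] sum_divide_distrib sum_negf)
qed

lemma gauss_monomial_abs_summable:
  assumes "h > 0" "D > 0"
  shows "gauss_monomial h D \<xi> abs_summable_on A"
  using gauss_monomial_series(1)[OF assms, of \<xi> 1] by (auto intro: summable_on_subset_banach)

lemma dual_monomial_abs_summable: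
  assumes "h > 0" "D > 0"
  shows "dual_monomial h D \<xi> abs_summable_on A"
proof -
  have "(\<lambda>(k, g, a). dual_monomial h D \<xi> (k, g, a) * complex_of_real 1 ^ (2 * g + a)) = dual_monomial h D \<xi>"
    by auto
  then show ?thesis
    using dual_monomial_series(1)[OF assms, of \<xi> 1] by (auto intro: summable_on_subset_banach)
qed

text \<open>The normalisation used in the saturation error: its monomials are taken in \<open>(x - h m) / (h D\<^bsup>1/2\<^esup>)\<close> and without
the factorial.\<close>
lemma gauss_moment:
  fixes x :: "real ^ 'n"
  assumes h: "h > 0" and D: "D > 0"
  shows "((\<lambda>m. gauss h D x m * mi_pow ((1 / (h * sqrt D)) *\<^sub>R (x - h *\<^sub>R int_vec m)) \<alpha>) has_sum
     (\<Sum>\<^sub>\<infinity>m. gauss h D x m * mi_pow ((1 / (h * sqrt D)) *\<^sub>R (x - h *\<^sub>R int_vec m)) \<alpha>)) UNIV" (is "(?f has_sum _) _")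
    and "complex_of_real (\<Sum>\<^sub>\<infinity>m. gauss h D x m * mi_pow ((1 / (h * sqrt D)) *\<^sub>R (x - h *\<^sub>R int_vec m)) \<alpha>) =
      complex_of_real (mi_fact \<alpha> * (- 1 / (h * sqrt D)) ^ mi_abs \<alpha>) * poisson_moment h D x \<alpha>"
proof -
  define \<kappa> where "\<kappa> b = complex_of_real (fact b * (- 1 / (h * sqrt D)) ^ b)" for b :: nat
  have bij: "bij_betw (\<lambda>k :: int. (k, b)) UNIV {y. snd y = b}" for b :: nat
    by (rule bij_betwI[where g = fst]) auto
  have abs: "(\<lambda>k. \<kappa> (\<alpha> $ i) * gauss_monomial h D (x $ i) (k, \<alpha> $ i)) abs_summable_on UNIV" for i
    unfolding norm_mult
    by (rule summable_on_cmult_right, subst summable_on_reindex_bij_betw[OF bij, where f = "\<lambda>y. norm (gauss_monomial h D (x $ i) y)"])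
      (rule gauss_monomial_abs_summable[OF assms])
  have inf: "infsum (\<lambda>k. \<kappa> (\<alpha> $ i) * gauss_monomial h D (x $ i) (k, \<alpha> $ i)) UNIV = \<kappa> (\<alpha> $ i) * infsum (gauss_monomial h D (x $ i)) {y. snd y = \<alpha> $ i}" for i
    by (simp add: infsum_cmult_right' infsum_reindex_bij_betw[OF bij])
  have eq: "complex_of_real (?f m) = (\<Prod>i\<in>UNIV. \<kappa> (\<alpha> $ i) * gauss_monomial h D (x $ i) (m $ i, \<alpha> $ i))" for m
    unfolding gauss_eq_prod[OF assms] mi_pow_def prod.distrib[symmetric] of_real_prod
  proof (rule prod.cong)
    fix i
    have "((1 / (h * sqrt D)) *\<^sub>R (x - h *\<^sub>R int_vec m)) $ i = (- 1 / (h * sqrt D)) * (h * of_int (m $ i) - x $ i)"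
      using h D by (simp add: int_vec_def field_simps)
    then show "complex_of_real (exp (- (x $ i - h * of_int (m $ i))\<^sup>2 / (h\<^sup>2 * D)) * (((1 / (h * sqrt D)) *\<^sub>R (x - h *\<^sub>R int_vec m)) $ i) ^ (\<alpha> $ i)) =
      \<kappa> (\<alpha> $ i) * gauss_monomial h D (x $ i) (m $ i, \<alpha> $ i)"
      unfolding \<kappa>_def gauss_monomial_def by (simp only: power_mult_distrib case_prod_conv) simp
  qed simp
  have \<kappa>: "(\<Prod>i\<in>UNIV. \<kappa> (\<alpha> $ i)) = complex_of_real (mi_fact \<alpha> * (- 1 / (h * sqrt D)) ^ mi_abs \<alpha>)"
    unfolding \<kappa>_def of_real_prod[symmetric] prod.distrib power_sum[symmetric] mi_fact_def mi_abs_def ..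
  have "((\<lambda>m. complex_of_real (?f m)) has_sum complex_of_real (mi_fact \<alpha> * (- 1 / (h * sqrt D)) ^ mi_abs \<alpha>) * poisson_moment h D x \<alpha>) UNIV"
    using prod_vec_sum(2)[of "\<lambda>i k. \<kappa> (\<alpha> $ i) * gauss_monomial h D (x $ i) (k, \<alpha> $ i)" "\<lambda>_. UNIV", OF abs] unfolding eq inf prod.distrib \<kappa> poisson_moment_def by simp
  moreover from summable_on_bounded_linear[OF bounded_linear_Re has_sum_imp_summable[OF this]]
  have "?f summable_on UNIV" by simp
  then show "(?f has_sum infsum ?f UNIV) UNIV" by (rule has_sum_infsum)
  from has_sum_of_real[OF this]
  have "((\<lambda>m. complex_of_real (?f m)) has_sum complex_of_real (infsum ?f UNIV)) UNIV" .
  ultimately show "complex_of_real (infsum ?f UNIV) = complex_of_real (mi_fact \<alpha> * (- 1 / (h * sqrt D)) ^ mi_abs \<alpha>) * poisson_moment h D x \<alpha>"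
    by (rule has_sum_unique[rotated])
qed

context harmonic_coefficients begin

text \<open>Both sums arise from one absolutely summable family over pairs of a lattice point and a multi-index, encoded
as vectors of pairs so that it dominates coordinatewise.\<close>
lemma gauss_side:
  fixes x :: "real ^ 'n" and v :: "real ^ 'n \<Rightarrow> complex"
  assumes h: "h > 0" and D: "D > 0"
    and taylor: "\<And>y. ((\<lambda>\<beta>. d \<beta> * divided_power (\<lambda>i. complex_of_real (y $ i)) \<beta>) has_sum v (x + y)) UNIV"
  obtains S where "((\<lambda>m. v (h *\<^sub>R int_vec m) * complex_of_real (gauss h D x m)) has_sum S) UNIV"
    "((\<lambda>\<beta>. d \<beta> * poisson_moment h D x \<beta>) has_sum S) UNIV"
proof -
  define T where "T \<sigma> = d (\<chi> i. snd (\<sigma> $ i)) * (\<Prod>i\<in>UNIV. gauss_monomial h D (x $ i) (\<sigma> $ i))" for \<sigma> :: "(int \<times> nat) ^ 'n"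
  (* The growth exp (rho^2 t^2) of the coefficients uses up half of the Gaussian decay. *)
  define \<delta> where "\<delta> = 1 / (2 * h\<^sup>2 * D)"
  define \<rho> where "\<rho> = sqrt \<delta>"
  have \<delta>: "\<delta> > 0" "1 / (h\<^sup>2 * D) = 2 * \<delta>" using h D by (simp_all add: \<delta>_def)
  have \<rho>: "\<rho> > 0" "\<rho>\<^sup>2 = \<delta>" using \<delta> by (simp_all add: \<rho>_def)
  let ?wt = "\<lambda>i (k :: int, b :: nat). exp (- \<delta> * (x $ i - h * of_int k)\<^sup>2) * sqrt (1 / 2) ^ b"
  have "T abs_summable_on UNIV"
    unfolding T_def
  proof (rule product_dominated[where F = snd and \<rho> = \<rho> and t = "\<lambda>i. gauss_monomial h D (x $ i)" 
        and w = ?wt])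
    show "?wt i abs_summable_on UNIV" for i
    proof -
      have "(\<lambda>k :: int. exp (- \<delta> * (x $ i - h * of_int k)\<^sup>2)) abs_summable_on UNIV"
        using summable_on_gaussian_int[OF \<delta>(1), of h "x $ i"] h by simp
      from abs_summable_times[OF this summable_half_power] show ?thesis by simp
    qed
    show "sqrt (fact (snd y)) * \<rho> ^ snd y * norm (gauss_monomial h D (x $ i) y) \<le> ?wt i y" for i y
    proof (cases y)
      case (Pair k b)
      let ?t = "\<bar>h * of_int k - x $ i\<bar>"
      have "sqrt (fact b) * (N / fact b) = N / sqrt (fact b)" for N :: real by (simp add: divide_simps)
      from this[of "exp (- (x $ i - h * of_int k)\<^sup>2 / (h\<^sup>2 * D)) * (\<rho> * ?t) ^ b"]
      have "sqrt (fact (snd y)) * \<rho> ^ snd y * norm (gauss_monomial h D (x $ i) y) = 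
         exp (- (x $ i - h * of_int k)\<^sup>2 / (h\<^sup>2 * D)) * ((\<rho> * ?t) ^ b / sqrt (fact b))"
        unfolding Pair gauss_monomial_def case_prod_conv norm_mult norm_divide norm_power norm_of_real norm_fact snd_conv
        by (simp add: power_mult_distrib mult_ac)
      also have "\<dots> \<le> exp (- (x $ i - h * of_int k)\<^sup>2 / (h\<^sup>2 * D)) * (sqrt (1 / 2) ^ b * exp (\<rho>\<^sup>2 * ?t\<^sup>2))"
        using \<rho> by (intro mult_left_mono power_div_sqrt_fact_le) auto
      also have "\<dots> = (exp (- (x $ i - h * of_int k)\<^sup>2 / (h\<^sup>2 * D)) * exp (\<rho>\<^sup>2 * ?t\<^sup>2)) * sqrt (1 / 2) ^ b"
        by (simp only: mult_ac)
      also have "exp (- (x $ i - h * of_int k)\<^sup>2 / (h\<^sup>2 * D)) * exp (\<rho>\<^sup>2 * ?t\<^sup>2) = exp (- \<delta> * (x $ i - h * of_int k)\<^sup>2)"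
      proof -
        have "- (x $ i - h * of_int k)\<^sup>2 / (h\<^sup>2 * D) = - (2 * \<delta>) * (x $ i - h * of_int k)\<^sup>2"
          using \<delta>(2) by (metis divide_inverse mult.commute mult_minus_left mult_1_left)
        moreover have "?t\<^sup>2 = (x $ i - h * of_int k)\<^sup>2" by (simp add: power2_commute)
        ultimately show ?thesis by (simp only: exp_add[symmetric] \<rho>(2)) simp
      qed
      finally show ?thesis by (simp add: Pair)
    qed
  qed (rule \<rho>(1))
  then have sT: "T summable_on UNIV" by (rule abs_summable_summable)
  have 1: "((\<lambda>\<beta>. d \<beta> * poisson_moment h D x \<beta>) has_sum infsum T UNIV) UNIV"
  proof (rule has_sum_fibers[where \<phi> = "\<lambda>\<sigma>. \<chi> i. snd (\<sigma> $ i)", OF has_sum_infsum[OF sT]])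
    fix \<beta> :: "nat ^ 'n"
    have fib: "{\<sigma> :: (int \<times> nat) ^ 'n. (\<chi> i. snd (\<sigma> $ i)) = \<beta>} = {\<sigma>. \<forall>i. \<sigma> $ i \<in> {y. snd y = \<beta> $ i}}"
      by (auto simp: vec_eq_iff)
    have "((\<lambda>\<sigma>. d \<beta> * (\<Prod>i\<in>UNIV. gauss_monomial h D (x $ i) (\<sigma> $ i))) has_sum d \<beta> * poisson_moment h D x \<beta>) {\<sigma>. \<forall>i. \<sigma> $ i \<in> {y. snd y = \<beta> $ i}}"
      unfolding poisson_moment_def
      by (intro has_sum_cmult_right prod_vec_sum(2) gauss_monomial_abs_summable h D)
    then show "(T has_sum d \<beta> * poisson_moment h D x \<beta>) {\<sigma>. (\<chi> i. snd (\<sigma> $ i)) = \<beta>}"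
      unfolding fib by (rule has_sum_cong[THEN iffD1, rotated]) (auto simp: T_def)
  qed
  have 2: "((\<lambda>m. v (h *\<^sub>R int_vec m) * complex_of_real (gauss h D x m)) has_sum infsum T UNIV) UNIV"
  proof (rule has_sum_fibers[where \<phi> = "\<lambda>\<sigma>. \<chi> i. fst (\<sigma> $ i)", OF has_sum_infsum[OF sT]])
    fix m :: "int ^ 'n"
    define y where "y = h *\<^sub>R int_vec m - x"
    have bij: "bij_betw (\<lambda>\<beta>. \<chi> i. (m $ i, \<beta> $ i)) UNIV {\<sigma> :: (int \<times> nat) ^ 'n. (\<chi> i. fst (\<sigma> $ i)) = m}"
      by (rule bij_betwI[where g = "\<lambda>\<sigma>. \<chi> i. snd (\<sigma> $ i)"]) (auto simp: vec_eq_iff prod_eq_iff)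
    have "T (\<chi> i. (m $ i, \<beta> $ i)) = (d \<beta> * divided_power (\<lambda>i. complex_of_real (y $ i)) \<beta>) * complex_of_real (gauss h D x m)" for \<beta>
    proof -
      have y: "h * of_int (m $ i) - x $ i = y $ i" for i by (simp add: y_def int_vec_def)
      show ?thesis unfolding T_def gauss_eq_prod[OF h D] gauss_monomial_def of_real_prod
        by (simp only: vec_lambda_beta vec_lambda_eta snd_conv case_prod_conv prod.distrib y mult_ac)
    qed
    moreover have "((\<lambda>\<beta>. (d \<beta> * divided_power (\<lambda>i. complex_of_real (y $ i)) \<beta>) * complex_of_real (gauss h D x m)) has_sum v (h *\<^sub>R int_vec m) * complex_of_real (gauss h D x m)) UNIV"
      using has_sum_cmult_left[OF taylor[of y]] by (simp add: y_def)
    ultimately have "((\<lambda>\<beta>. T (\<chi> i. (m $ i, \<beta> $ i))) has_sum v (h *\<^sub>R int_vec m) * complex_of_real (gauss h D x m)) UNIV"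
      by (simp only:)
    then show "(T has_sum v (h *\<^sub>R int_vec m) * complex_of_real (gauss h D x m)) {\<sigma>. (\<chi> i. fst (\<sigma> $ i)) = m}"
      by (simp only: has_sum_reindex_bij_betw[OF bij])
  qed
  from that[OF 2 1] show ?thesis .
qed

text \<open>The family is indexed by vectors of triples \<open>(k, g, a)\<close>. Summing over \<open>2 g + a = \<beta>\<close> gives the moments by the
one-dimensional Poisson formula; summing over \<open>g\<close> instead removes the heat operator and leaves a Taylor series in \<open>a\<close>.\<close>
lemma dual_side:
  fixes x :: "real ^ 'n"
  assumes h: "h > 0" and D: "D > 0" and S: "((\<lambda>\<beta>. d \<beta> * poisson_moment h D x \<beta>) has_sum S) UNIV"
  shows "((\<lambda>m :: int ^ 'n. (\<Prod>i\<in>UNIV. theta_coeff h D (x $ i) (m $ i)) *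
    (\<Sum>\<^sub>\<infinity>\<alpha>. d \<alpha> * divided_power (\<lambda>i. \<i> * complex_of_real (pi * h * D * of_int (m $ i))) \<alpha>)) has_sum S) UNIV"
proof -
  define c where "c = h\<^sup>2 * D / 4"
  have c: "c > 0" using h D by (simp add: c_def)
  define w :: "int \<Rightarrow> real" where "w k = pi * h * D * of_int k" for k
  define F :: "int \<times> nat \<times> nat \<Rightarrow> nat" where "F = (\<lambda>(k, g, a). 2 * g + a)"
  define U where "U \<tau> = d (\<chi> i. F (\<tau> $ i)) * (\<Prod>i\<in>UNIV. dual_monomial h D (x $ i) (\<tau> $ i))" for \<tau> :: "(int \<times> nat \<times> nat) ^ 'n"
  (* This choice makes the ratio 4 c rho^2 of the geometric series in g equal to 1/4. *)
  define \<rho> where "\<rho> = sqrt (1 / (16 * c))"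
  have \<rho>: "\<rho> > 0" "\<rho>\<^sup>2 = 1 / (16 * c)" using c by (simp_all add: \<rho>_def)
  let ?wt = "\<lambda>(k :: int, g :: nat, a :: nat). (sqrt (pi * D) * exp (- (pi\<^sup>2 * D / 2) * (0 - 1 * of_int k)\<^sup>2)) *
     ((1 / 4) ^ g * sqrt (1 / 2) ^ a)"
  have "U abs_summable_on UNIV"
    unfolding U_def
  proof (rule product_dominated[where F = F and \<rho> = \<rho> and t = "\<lambda>i. dual_monomial h D (x $ i)" 
        and w = "\<lambda>_. ?wt"])
    show "?wt abs_summable_on UNIV" for i :: 'n
    proof -
      have 1: "(\<lambda>k :: int. sqrt (pi * D) * exp (- (pi\<^sup>2 * D / 2) * (0 - 1 * of_int k)\<^sup>2)) abs_summable_on UNIV"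
        using summable_on_cmult_right[OF summable_on_gaussian_int[of "pi\<^sup>2 * D / 2" 1 0], of "sqrt (pi * D)"] D by (simp add: abs_mult)
      have "summable (\<lambda>b. norm (norm ((1 / 4 :: real) ^ b)))" by (simp add: norm_power summable_geometric)
      then have 2: "(\<lambda>b :: nat. (1 / 4 :: real) ^ b) abs_summable_on UNIV" by (rule norm_summable_imp_summable_on)
      from abs_summable_times[OF 1 abs_summable_times[OF 2 summable_half_power]] show ?thesis
        by (simp add: case_prod_unfold)
    qed
    show "sqrt (fact (F y)) * \<rho> ^ F y * norm (dual_monomial h D (x $ i) y) \<le>
       ?wt y" for i y
    proof (cases y)
      case (fields k g a)
      let ?E = "sqrt (pi * D) * exp (- pi\<^sup>2 * D * (of_int k)\<^sup>2)"
      have E: "?E \<ge> 0" using D by simp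
      have "norm (dual_monomial h D (x $ i) y) = ?E * (c ^ g / fact g * (\<bar>w k\<bar> ^ a / fact a))"
        using D c unfolding fields dual_monomial_def case_prod_conv theta_coeff_def c_def[symmetric] w_def[symmetric]
        by (simp add: norm_mult norm_divide norm_power)
      then have "sqrt (fact (F y)) * \<rho> ^ F y * norm (dual_monomial h D (x $ i) y) =
         (sqrt (fact (2 * g + a)) * \<rho> ^ (2 * g + a) * (c ^ g / fact g)) * (?E * (\<bar>w k\<bar> ^ a / fact a))"
        unfolding fields F_def case_prod_conv by (simp only: mult_ac)
      also have "\<dots> \<le> (4 * c * \<rho>\<^sup>2) ^ g * (sqrt (fact a) * (sqrt 2 * \<rho>) ^ a) * (?E * (\<bar>w k\<bar> ^ a / fact a))"
        using E \<rho> c by (intro mult_right_mono sqrt_fact_weight_le) auto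
      also have "\<dots> = (1 / 4) ^ g * ?E * ((sqrt 2 * \<rho> * \<bar>w k\<bar>) ^ a / sqrt (fact a))"
      proof -
        have "sqrt (fact a) * (N / fact a) = N / sqrt (fact a)" for N :: real by (simp add: divide_simps)
        then have e1: "(sqrt (fact a) * (sqrt 2 * \<rho>) ^ a) * (\<bar>w k\<bar> ^ a / fact a) = (sqrt 2 * \<rho> * \<bar>w k\<bar>) ^ a / sqrt (fact a)"
          by (metis (no_types, lifting) mult.commute mult.left_commute power_mult_distrib times_divide_eq_right)
        have e2: "4 * c * \<rho>\<^sup>2 = 1 / 4" using c \<rho>(2) by simp
        show ?thesis unfolding e2 e1[symmetric] by (simp only: mult_ac)
      qed
      also have "\<dots> \<le> (1 / 4) ^ g * ?E * (sqrt (1 / 2) ^ a * exp ((sqrt 2 * \<rho>)\<^sup>2 * \<bar>w k\<bar>\<^sup>2))"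
        using E \<rho> by (intro mult_left_mono power_div_sqrt_fact_le) auto
      also have "\<dots> = (sqrt (pi * D) * (exp (- pi\<^sup>2 * D * (of_int k)\<^sup>2) * exp ((sqrt 2 * \<rho>)\<^sup>2 * \<bar>w k\<bar>\<^sup>2))) * ((1 / 4) ^ g * sqrt (1 / 2) ^ a)"
        by (simp only: mult_ac)
      also have "exp (- pi\<^sup>2 * D * (of_int k)\<^sup>2) * exp ((sqrt 2 * \<rho>)\<^sup>2 * \<bar>w k\<bar>\<^sup>2) = exp (- (pi\<^sup>2 * D / 2) * (0 - 1 * of_int k)\<^sup>2)"
      proof -
        have "(sqrt 2 * \<rho>)\<^sup>2 * \<bar>w k\<bar>\<^sup>2 = pi\<^sup>2 * D / 2 * (of_int k)\<^sup>2"
        proof -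
          have s1: "(sqrt 2 * \<rho>)\<^sup>2 = 1 / (2 * h\<^sup>2 * D)" by (simp add: power_mult_distrib \<rho>(2) c_def)
          show ?thesis unfolding s1 w_def using h D by (simp add: field_simps power2_eq_square)
        qed
        then show ?thesis by (simp add: exp_add[symmetric])
      qed
      finally show ?thesis by (simp add: fields)
    qed
  qed (rule \<rho>(1))
  then have sU: "U summable_on UNIV" by (rule abs_summable_summable)
  have "((\<lambda>\<beta>. d \<beta> * poisson_moment h D x \<beta>) has_sum infsum U UNIV) UNIV"
  proof (rule has_sum_fibers[where \<phi> = "\<lambda>\<tau>. \<chi> i. F (\<tau> $ i)", OF has_sum_infsum[OF sU]])
    fix \<beta> :: "nat ^ 'n"
    have fib: "{\<tau> :: (int \<times> nat \<times> nat) ^ 'n. (\<chi> i. F (\<tau> $ i)) = \<beta>} = {\<tau>. \<forall>i. \<tau> $ i \<in> {(k, g, a). 2 * g + a = \<beta> $ i}}"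
      by (auto simp: vec_eq_iff F_def case_prod_unfold)
    have "((\<lambda>\<tau>. d \<beta> * (\<Prod>i\<in>UNIV. dual_monomial h D (x $ i) (\<tau> $ i))) has_sum d \<beta> * poisson_moment h D x \<beta>) {\<tau>. \<forall>i. \<tau> $ i \<in> {(k, g, a). 2 * g + a = \<beta> $ i}}"
      unfolding poisson_moment_def poisson_monomial[OF h D]
      by (intro has_sum_cmult_right prod_vec_sum(2) dual_monomial_abs_summable h D)
    then show "(U has_sum d \<beta> * poisson_moment h D x \<beta>) {\<tau>. (\<chi> i. F (\<tau> $ i)) = \<beta>}"
      unfolding fib[symmetric] by (rule has_sum_cong[THEN iffD1, rotated]) (auto simp: U_def)
  qed
  with S have "infsum U UNIV = S" using has_sum_unique by blast
  with has_sum_infsum[OF sU] have hU: "(U has_sum S) UNIV" by simp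
  let ?E = "\<lambda>m :: int ^ 'n. \<Prod>i\<in>UNIV. theta_coeff h D (x $ i) (m $ i)"
  let ?W = "\<lambda>(m :: int ^ 'n) \<alpha>. \<Prod>i\<in>UNIV. (\<i> * complex_of_real (w (m $ i))) ^ (\<alpha> $ i) / fact (\<alpha> $ i)"
  have "((\<lambda>(m, \<alpha>). ?E m * (d \<alpha> * ?W m \<alpha>)) has_sum S) UNIV"
  proof (rule has_sum_fibers[where \<phi> = "\<lambda>\<tau>. (\<chi> i. fst (\<tau> $ i), \<chi> i. snd (snd (\<tau> $ i)))", OF hU], clarify)
    fix m :: "int ^ 'n" and \<alpha> :: "nat ^ 'n"
    have bij: "bij_betw (\<lambda>\<gamma>. \<chi> i. (m $ i, \<gamma> $ i, \<alpha> $ i)) UNIV {\<tau> :: (int \<times> nat \<times> nat) ^ 'n. (\<chi> i. fst (\<tau> $ i), \<chi> i. snd (snd (\<tau> $ i))) = (m, \<alpha>)}"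
      by (rule bij_betwI[where g = "\<lambda>\<tau>. \<chi> i. fst (snd (\<tau> $ i))"]) (auto simp: vec_eq_iff prod_eq_iff)
    have "U (\<chi> i. (m $ i, \<gamma> $ i, \<alpha> $ i)) = (?E m * ?W m \<alpha>) * (d (\<alpha> + \<gamma> + \<gamma>) * divided_power (\<lambda>i. complex_of_real c) \<gamma>)" for \<gamma>
    proof -
      have idx: "(\<chi> i. F (m $ i, \<gamma> $ i, \<alpha> $ i)) = \<alpha> + \<gamma> + \<gamma>" by (simp add: vec_eq_iff F_def)
      show ?thesis
        unfolding U_def dual_monomial_def vec_lambda_beta case_prod_conv prod.distrib c_def[symmetric] w_def[symmetric] idx
        by (simp only: mult_ac)
    qed
    moreover have "((\<lambda>\<gamma>. (?E m * ?W m \<alpha>) * (d (\<alpha> + \<gamma> + \<gamma>) * divided_power (\<lambda>i. complex_of_real c) \<gamma>)) has_sum (?E m * ?W m \<alpha>) * d \<alpha>) UNIV"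
      by (intro has_sum_cmult_right heat_invariance c)
    ultimately have "((\<lambda>\<gamma>. U (\<chi> i. (m $ i, \<gamma> $ i, \<alpha> $ i))) has_sum ?E m * (d \<alpha> * ?W m \<alpha>)) UNIV"
      by (simp only: mult_ac)
    then show "(U has_sum ?E m * (d \<alpha> * ?W m \<alpha>)) {\<tau>. (\<chi> i. fst (\<tau> $ i), \<chi> i. snd (snd (\<tau> $ i))) = (m, \<alpha>)}"
      by (simp only: has_sum_reindex_bij_betw[OF bij])
  qed
  then have "((\<lambda>(m, \<alpha>). ?E m * (d \<alpha> * ?W m \<alpha>)) has_sum S) (UNIV \<times> UNIV)" by simp
  then have "((\<lambda>m. ?E m * (\<Sum>\<^sub>\<infinity>\<alpha>. d \<alpha> * ?W m \<alpha>)) has_sum S) UNIV"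
  proof (rule has_sum_SigmaD)
    fix m :: "int ^ 'n"
    have "(\<lambda>\<alpha>. d \<alpha> * ?W m \<alpha>) summable_on UNIV"
      using abs_summable_summable[OF taylor_abs_summable[of "\<chi> i. \<i> * complex_of_real (w (m $ i))"]] by simp
    from has_sum_cmult_right[OF has_sum_infsum[OF this]]
    show "((\<lambda>\<alpha>. case (m, \<alpha>) of (m, \<alpha>) \<Rightarrow> ?E m * (d \<alpha> * ?W m \<alpha>)) has_sum ?E m * (\<Sum>\<^sub>\<infinity>\<alpha>. d \<alpha> * ?W m \<alpha>)) UNIV"
      by simp
  qed
  then show ?thesis by (simp add: w_def)
qed

end

section \<open>The saturation error\<close>

lemma filterlim_mi_abs_le:
  assumes "filterlim K at_top F"
  shows "filterlim (\<lambda>M. {\<beta> :: nat ^ 'n. mi_abs \<beta> \<le> K M}) (finite_subsets_at_top UNIV) F"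
  unfolding filterlim_finite_subsets_at_top
proof (intro allI impI)
  fix X :: "(nat ^ 'n) set" assume X: "finite X \<and> X \<subseteq> UNIV"
  then have "mi_abs \<beta> \<le> Max (insert 0 (mi_abs ` X))" if "\<beta> \<in> X" for \<beta> using that by (intro Max_ge) auto
  then have big: "finite {\<beta> :: nat ^ 'n. mi_abs \<beta> \<le> K M} \<and> X \<subseteq> {\<beta>. mi_abs \<beta> \<le> K M} \<and> {\<beta>. mi_abs \<beta> \<le> K M} \<subseteq> UNIV"
    if "K M \<ge> Max (insert 0 (mi_abs ` X))" for M
    using that finite_mi_abs_le[of "K M"] order_trans by blast
  have "\<forall>\<^sub>F M in F. Max (insert 0 (mi_abs ` X)) \<le> K M"
    using assms by (simp add: filterlim_at_top)
  then show "\<forall>\<^sub>F M in F. finite {\<beta> :: nat ^ 'n. mi_abs \<beta> \<le> K M} \<and> X \<subseteq> {\<beta>. mi_abs \<beta> \<le> K M} \<and> {\<beta>. mi_abs \<beta> \<le> K M} \<subseteq> UNIV"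
    by (rule eventually_mono) (rule big)
qed

lemma a_coeff_double: "a_coeff (\<delta> + \<delta>) = (- 1) ^ mi_abs \<delta> / (mi_fact \<delta> * 4 ^ mi_abs \<delta>)"
proof -
  have "(\<chi> i. (\<delta> + \<delta>) $ i div 2) = \<delta>" by (simp add: vec_eq_iff)
  then show ?thesis by (simp add: a_coeff_def)
qed

lemma a_coeff_nonzero: 
  assumes "a_coeff \<gamma> \<noteq> 0" obtains \<delta> where "\<gamma> = \<delta> + \<delta>"
proof -
  have "even (\<gamma> $ i)" for i using assms by (auto simp: a_coeff_def split: if_splits)
  then have "\<gamma> = (\<chi> i. \<gamma> $ i div 2) + (\<chi> i. \<gamma> $ i div 2)" by (simp add: vec_eq_iff mult_2[symmetric])
  then show ?thesis by (rule that)
qed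

lemma has_sum_finite_sum:
  fixes f :: "'a \<Rightarrow> 'b \<Rightarrow> 'c :: topological_comm_monoid_add"
  assumes "finite A" "\<And>a. a \<in> A \<Longrightarrow> (f a has_sum s a) B"
  shows "((\<lambda>x. \<Sum>a\<in>A. f a x) has_sum (\<Sum>a\<in>A. s a)) B"
  using assms by (induction A rule: finite_induct) (auto intro: has_sum_add)

context harmonic_coefficients begin

text \<open>Only \<open>\<gamma> = 2 \<delta>\<close> contributes, and for \<open>|\<delta>| = j > 0\<close> the terms add up to a multiple of \<open>\<Delta>\<^sup>j\<close>. The truncation is by
total degree, so these groups are either complete or absent.\<close>
lemma a_coeff_sum:
  fixes q :: complex
  shows "(\<Sum>\<gamma> | mi_abs \<gamma> \<le> L. q ^ mi_abs \<gamma> * complex_of_real (a_coeff \<gamma>) * d (\<alpha> + \<gamma>)) = d \<alpha>"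
proof -
  let ?s = "\<lambda>\<gamma>. q ^ mi_abs \<gamma> * complex_of_real (a_coeff \<gamma>) * d (\<alpha> + \<gamma>)"
  let ?H = "{\<delta> :: nat ^ 'n. mi_abs \<delta> + mi_abs \<delta> \<le> L}"
  let ?r = "\<lambda>\<delta>. (- q\<^sup>2 / 4) ^ mi_abs \<delta> * (d (\<alpha> + \<delta> + \<delta>) / complex_of_real (mi_fact \<delta>))"
  have fin: "finite {\<gamma> :: nat ^ 'n. mi_abs \<gamma> + mi_abs \<gamma> \<le> L}"
    by (rule finite_subset[OF _ finite_mi_abs_le[of L]]) auto
  have "(\<Sum>\<gamma> | mi_abs \<gamma> \<le> L. ?s \<gamma>) = 
    (\<Sum>\<gamma> \<in> (\<lambda>\<delta>. \<delta> + \<delta>) ` ?H. ?s \<gamma>)"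
  proof (rule sum.mono_neutral_right[OF finite_mi_abs_le])
    show "\<forall>\<gamma>\<in>{\<gamma>. mi_abs \<gamma> \<le> L} - (\<lambda>\<delta>. \<delta> + \<delta>) ` ?H. ?s \<gamma> = 0"
    proof (rule ballI, rule ccontr)
      fix \<gamma> assume g: "\<gamma> \<in> {\<gamma>. mi_abs \<gamma> \<le> L} - (\<lambda>\<delta>. \<delta> + \<delta>) ` ?H" 
        and "?s \<gamma> \<noteq> 0"
      then have "a_coeff \<gamma> \<noteq> 0" by auto
      then obtain \<delta> where "\<gamma> = \<delta> + \<delta>" by (rule a_coeff_nonzero)
      with g show False by (auto simp: mi_abs_add)
    qed
  qed (auto simp: mi_abs_add)
  also have "\<dots> = (\<Sum>\<delta>\<in>?H. ?s (\<delta> + \<delta>))"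
  proof (subst sum.reindex)
    show "inj_on (\<lambda>\<delta>. \<delta> + \<delta>) {\<delta> :: nat ^ 'n. mi_abs \<delta> + mi_abs \<delta> \<le> L}"
    proof (rule inj_onI)
      fix \<delta> \<epsilon> :: "nat ^ 'n" assume "\<delta> + \<delta> = \<epsilon> + \<epsilon>"
      then have "(\<delta> + \<delta>) $ i = (\<epsilon> + \<epsilon>) $ i" for i by simp
      then have "\<delta> $ i = \<epsilon> $ i" for i by (metis add_self_div_2 vector_add_component)
      then show "\<delta> = \<epsilon>" by (simp add: vec_eq_iff)
    qed
  qed (simp add: o_def)
  also have "\<dots> = (\<Sum>\<delta>\<in>?H. ?r \<delta>)"
  proof (rule sum.cong)
    fix \<delta> :: "nat ^ 'n"
    have "q ^ mi_abs (\<delta> + \<delta>) = (q\<^sup>2) ^ mi_abs \<delta>" by (simp add: mi_abs_add power_add power2_eq_square power_mult_distrib)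
    moreover have "(- q\<^sup>2 / 4) ^ mi_abs \<delta> = (- 1) ^ mi_abs \<delta> * (q\<^sup>2) ^ mi_abs \<delta> / 4 ^ mi_abs \<delta>"
      by (simp only: power_divide power_minus[of "q\<^sup>2"])
    ultimately show "?s (\<delta> + \<delta>) = ?r \<delta>"
      by (simp add: a_coeff_double add.assoc mult_ac)
  qed simp
  also have "\<dots> = (\<Sum>j\<in>{j. j + j \<le> L}. \<Sum>\<delta> | \<delta> \<in> ?H \<and> mi_abs \<delta> = j. ?r \<delta>)"
    by (rule sum.group[symmetric, OF fin]) (auto intro: finite_subset[of _ "{..L}"])
  also have "\<dots> = (\<Sum>j\<in>{j. j + j \<le> L}. if j = 0 then d \<alpha> else 0)"
  proof (rule sum.cong)
    fix j assume "j \<in> {j. j + j \<le> L}"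
    then have "{\<delta> :: nat ^ 'n. \<delta> \<in> ?H \<and> mi_abs \<delta> = j} = {\<delta>. mi_abs \<delta> = j}" by auto
    moreover have "(\<Sum>\<delta> | mi_abs \<delta> = j. ?r \<delta>)
      = (- q\<^sup>2 / 4) ^ j * (\<Sum>\<delta> | mi_abs \<delta> = j. d (\<alpha> + \<delta> + \<delta>) / complex_of_real (mi_fact \<delta>))"
      unfolding sum_distrib_left by (rule sum.cong) auto
    moreover have "\<dots> = (if j = 0 then d \<alpha> else 0)"
    proof (cases "j = 0")
      case False
      then show ?thesis using laplace_power_zero[of j \<alpha>] by simp
    qed (simp add: mi_abs_eq_0_iff mi_fact_def)
    ultimately show "(\<Sum>\<delta> | \<delta> \<in> ?H \<and> mi_abs \<delta> = j. ?r \<delta>) = (if j = 0 then d \<alpha> else 0)"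
      by simp
  qed simp
  also have "\<dots> = d \<alpha>" by (subst sum.delta) (auto intro: finite_subset[of _ "{..L}"])
  finally show ?thesis .
qed

text \<open>Substituting \<open>\<beta> = \<alpha> + \<gamma>\<close> collects, for each moment of order \<open>\<alpha>\<close>, a truncated sum over \<open>\<gamma>\<close>, which harmonicity
evaluates to \<open>d \<alpha>\<close>.\<close>
lemma saturation_sum:
  fixes x :: "real ^ 'n" and h D :: real
  assumes h: "h > 0" and D: "D > 0"
  shows "(\<Sum>\<beta> | mi_abs \<beta> \<le> K.
       complex_of_real ((- h * sqrt D) ^ mi_abs \<beta>) * d \<beta> *
       complex_of_real
         (\<Sum>\<^sub>\<infinity>m. gauss h D x m *
            (\<Sum>\<alpha> | \<alpha> \<le> \<beta>. a_coeff (\<beta> - \<alpha>) / mi_fact \<alpha> *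
               mi_pow ((1 / (h * sqrt D)) *\<^sub>R (x - h *\<^sub>R int_vec m)) \<alpha>))) =
     (\<Sum>\<alpha> | mi_abs \<alpha> \<le> K. d \<alpha> * poisson_moment h D x \<alpha>)"
proof -
  define q where "q = - h * sqrt D"
  have q: "q \<noteq> 0" "- 1 / (h * sqrt D) = 1 / q" using h D by (simp_all add: q_def)
  let ?\<tau> = "\<lambda>m. (1 / (h * sqrt D)) *\<^sub>R (x - h *\<^sub>R int_vec m)"
  let ?Q = "poisson_moment h D x"
  let ?g = "\<lambda>m \<alpha>. gauss h D x m * mi_pow (?\<tau> m) \<alpha>"
  let ?c = "\<lambda>\<beta> \<alpha>. a_coeff (\<beta> - \<alpha>) / mi_fact \<alpha>"
  let ?L = "\<lambda>\<beta>. complex_of_real ((- h * sqrt D) ^ mi_abs \<beta>) * d \<beta> *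
     complex_of_real (\<Sum>\<^sub>\<infinity>m. gauss h D x m * (\<Sum>\<alpha> | \<alpha> \<le> \<beta>. ?c \<beta> \<alpha> * mi_pow (?\<tau> m) \<alpha>))"
  let ?R = "\<lambda>\<alpha> \<gamma>. ?Q \<alpha> * (complex_of_real q ^ mi_abs \<gamma> * complex_of_real (a_coeff \<gamma>) * d (\<alpha> + \<gamma>))"
  have mono: "mi_abs \<alpha> \<le> mi_abs \<beta>" if "\<alpha> \<le> \<beta>" for \<alpha> \<beta> :: "nat ^ 'n"
    using that by (auto simp: mi_abs_def less_eq_vec_def intro: sum_mono)
  have fin: "finite {\<alpha>. \<alpha> \<le> \<beta>}" for \<beta> :: "nat ^ 'n"
    by (rule finite_subset[OF _ finite_mi_abs_le[of "mi_abs \<beta>"]]) (auto intro: mono)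
  have inner: "?L \<beta>
     = (\<Sum>\<alpha> | \<alpha> \<le> \<beta>. ?R \<alpha> (\<beta> - \<alpha>))" for \<beta> :: "nat ^ 'n"
  proof -
    let ?T = "\<lambda>\<alpha>. \<Sum>\<^sub>\<infinity>m. ?g m \<alpha>"
    have "((\<lambda>m. \<Sum>\<alpha> | \<alpha> \<le> \<beta>. ?c \<beta> \<alpha> * (?g m \<alpha>)) has_sum (\<Sum>\<alpha> | \<alpha> \<le> \<beta>. ?c \<beta> \<alpha> * ?T \<alpha>)) UNIV"
      by (intro has_sum_finite_sum fin has_sum_cmult_right gauss_moment(1) h D)
    moreover have "(\<Sum>\<alpha> | \<alpha> \<le> \<beta>. ?c \<beta> \<alpha> * (?g m \<alpha>)) = gauss h D x m * (\<Sum>\<alpha> | \<alpha> \<le> \<beta>. ?c \<beta> \<alpha> * mi_pow (?\<tau> m) \<alpha>)" for m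
      by (simp add: sum_distrib_left mult_ac)
    ultimately have "(\<Sum>\<^sub>\<infinity>m. gauss h D x m * (\<Sum>\<alpha> | \<alpha> \<le> \<beta>. ?c \<beta> \<alpha> * mi_pow (?\<tau> m) \<alpha>)) = (\<Sum>\<alpha> | \<alpha> \<le> \<beta>. ?c \<beta> \<alpha> * ?T \<alpha>)"
      by (simp add: infsumI)
    then have "?L \<beta>
      = (\<Sum>\<alpha> | \<alpha> \<le> \<beta>. complex_of_real (q ^ mi_abs \<beta>) * d \<beta> * (complex_of_real (?c \<beta> \<alpha>) * complex_of_real (?T \<alpha>)))"
      by (simp only: q_def of_real_sum of_real_mult sum_distrib_left)
    also have "\<dots> = (\<Sum>\<alpha> | \<alpha> \<le> \<beta>. ?R \<alpha> (\<beta> - \<alpha>))"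
    proof (rule sum.cong)
      fix \<alpha> assume "\<alpha> \<in> {\<alpha>. \<alpha> \<le> \<beta>}"
      then have ab: "\<alpha> + (\<beta> - \<alpha>) = \<beta>" by (auto simp: vec_eq_iff less_eq_vec_def)
      then have "mi_abs \<beta> = mi_abs \<alpha> + mi_abs (\<beta> - \<alpha>)" by (metis mi_abs_add)
      then have "q ^ mi_abs \<beta> * (1 / q) ^ mi_abs \<alpha> = q ^ mi_abs (\<beta> - \<alpha>)"
        using q by (simp add: power_add power_one_over)
      then have pw: "complex_of_real (q ^ mi_abs \<beta>) * complex_of_real ((1 / q) ^ mi_abs \<alpha>) = complex_of_real q ^ mi_abs (\<beta> - \<alpha>)"
        by (metis of_real_mult of_real_power)
      have "complex_of_real (?c \<beta> \<alpha>) * complex_of_real (?T \<alpha>) = complex_of_real (a_coeff (\<beta> - \<alpha>)) * complex_of_real ((1 / q) ^ mi_abs \<alpha>) * ?Q \<alpha>"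
        unfolding gauss_moment(2)[OF h D] q(2) using mi_fact_pos[of \<alpha>] by simp
      then show "complex_of_real (q ^ mi_abs \<beta>) * d \<beta> * (complex_of_real (?c \<beta> \<alpha>) * complex_of_real (?T \<alpha>)) = 
         ?R \<alpha> (\<beta> - \<alpha>)"
        unfolding ab pw[symmetric] by (simp only: mult_ac)
    qed simp
    finally show ?thesis .
  qed
  have "(\<Sum>\<beta> | mi_abs \<beta> \<le> K. \<Sum>\<alpha> | \<alpha> \<le> \<beta>. ?R \<alpha> (\<beta> - \<alpha>))
    = (\<Sum>(\<beta>, \<alpha>) \<in> (SIGMA \<beta> : {\<beta>. mi_abs \<beta> \<le> K}. {\<alpha>. \<alpha> \<le> \<beta>}). ?R \<alpha> (\<beta> - \<alpha>))"
    by (rule sum.Sigma) (auto simp: finite_mi_abs_le fin)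
  also have "\<dots> = (\<Sum>(\<alpha>, \<gamma>) \<in> (SIGMA \<alpha> : {\<alpha>. mi_abs \<alpha> \<le> K}. {\<gamma>. mi_abs \<gamma> \<le> K - mi_abs \<alpha>}). ?R \<alpha> \<gamma>)"
  proof (rule sum.reindex_bij_witness[where j = "\<lambda>(\<beta>, \<alpha>). (\<alpha>, \<beta> - \<alpha>)" and i = "\<lambda>(\<alpha>, \<gamma>). (\<alpha> + \<gamma>, \<alpha>)"])
    fix y :: "(nat ^ 'n) \<times> (nat ^ 'n)" assume "y \<in> (SIGMA \<beta> : {\<beta>. mi_abs \<beta> \<le> K}. {\<alpha>. \<alpha> \<le> \<beta>})"
    then obtain \<beta> \<alpha> where y: "y = (\<beta>, \<alpha>)" and le: "mi_abs \<beta> \<le> K" "\<alpha> \<le> \<beta>" by auto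
    have eq: "\<alpha> + (\<beta> - \<alpha>) = \<beta>" using le by (auto simp: vec_eq_iff less_eq_vec_def)
    then show "(\<lambda>(\<alpha>, \<gamma>). (\<alpha> + \<gamma>, \<alpha>)) ((\<lambda>(\<beta>, \<alpha>). (\<alpha>, \<beta> - \<alpha>)) y) = y" by (simp add: y)
    have "mi_abs \<beta> = mi_abs \<alpha> + mi_abs (\<beta> - \<alpha>)" using eq by (metis mi_abs_add)
    then show "(\<lambda>(\<beta>, \<alpha>). (\<alpha>, \<beta> - \<alpha>)) y \<in> (SIGMA \<alpha> : {\<alpha>. mi_abs \<alpha> \<le> K}. {\<gamma>. mi_abs \<gamma> \<le> K - mi_abs \<alpha>})"
      using le by (simp add: y)
  next
    fix y :: "(nat ^ 'n) \<times> (nat ^ 'n)" assume "y \<in> (SIGMA \<alpha> : {\<alpha>. mi_abs \<alpha> \<le> K}. {\<gamma>. mi_abs \<gamma> \<le> K - mi_abs \<alpha>})"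
    then show "(\<lambda>(\<alpha>, \<gamma>). (\<alpha> + \<gamma>, \<alpha>)) y \<in> (SIGMA \<beta> : {\<beta>. mi_abs \<beta> \<le> K}. {\<alpha>. \<alpha> \<le> \<beta>})"
      "(\<lambda>(\<beta>, \<alpha>). (\<alpha>, \<beta> - \<alpha>)) ((\<lambda>(\<alpha>, \<gamma>). (\<alpha> + \<gamma>, \<alpha>)) y) = y"
      by (auto simp: mi_abs_add less_eq_vec_def)
  qed auto
  also have "\<dots> = (\<Sum>\<alpha> | mi_abs \<alpha> \<le> K. \<Sum>\<gamma> | mi_abs \<gamma> \<le> K - mi_abs \<alpha>. ?R \<alpha> \<gamma>)"
    by (rule sum.Sigma[symmetric]) (auto simp: finite_mi_abs_le)
  also have "\<dots> = (\<Sum>\<alpha> | mi_abs \<alpha> \<le> K. d \<alpha> * ?Q \<alpha>)"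
    unfolding sum_distrib_left[symmetric] a_coeff_sum by (simp only: mult.commute)
  finally show ?thesis unfolding inner .
qed

end

section \<open>The analytic extension and the main result\<close>

lemma harmonic_coefficients_mi_deriv:
  fixes u :: "real ^ 'n \<Rightarrow> complex"
  assumes "harmonic u"
    and "\<And>y :: real ^ 'n.
      (\<lambda>\<beta>. norm (mi_deriv \<beta> u x / complex_of_real (sqrt (mi_fact \<beta>)) *
                 complex_of_real (mi_pow y \<beta>))) summable_on UNIV"
  shows "harmonic_coefficients (\<lambda>\<beta>. mi_deriv \<beta> u x)"
  using assms harmonic_derivs_sum_zero by unfold_locales auto

lemma mi_deriv_0:
  fixes u :: "real ^ 'n \<Rightarrow> complex"
  shows "mi_deriv 0 u = u"
proof -
  have "foldr (\<lambda>i g. (partial_deriv i ^^ ((0 :: nat ^ 'n) $ i)) g) xs u = u" for xs by (induction xs) auto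
  then show ?thesis by (simp add: mi_deriv_def)
qed

lemma taylor_term_eq:
  "taylor_term u p (complex_vec p + w) \<beta> = mi_deriv \<beta> u p * divided_power (\<lambda>i. w $ i) \<beta>"
  by (simp add: taylor_term_def mi_fact_def mi_pow_def prod_dividef)

lemma taylor_term_eq':
  "taylor_term u p \<zeta> \<beta> = mi_deriv \<beta> u p * divided_power (\<lambda>i. (\<zeta> - complex_vec p) $ i) \<beta>"
  using taylor_term_eq[of u p "\<zeta> - complex_vec p" \<beta>] by simp

lemma analytic_ext_real:
  assumes "harmonic u"
  shows "analytic_ext u p (complex_vec x) = u x"
proof -
  have x: "complex_vec x = complex_vec p + complex_vec (x - p)" by (simp add: complex_vec_def vec_eq_iff)
  have "complex_vec (x - p) $ i = complex_of_real ((x - p) $ i)" for i by (simp add: complex_vec_def)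
  then have "(taylor_term u p (complex_vec x) has_sum u x) UNIV"
    using mean_value_taylor[OF harmonic_mean_value[OF assms], of p "x - p"]
    unfolding x taylor_term_eq[abs_def] by simp
  then show ?thesis unfolding analytic_ext_def by (rule infsumI)
qed

text \<open>The partial sums are polynomials in \<open>s\<close> and converge uniformly on discs, with the Taylor series at a
real vector as majorant.\<close>
lemma analytic_ext_holomorphic:
  fixes u :: "real ^ 'n \<Rightarrow> complex"
  assumes "harmonic_coefficients (\<lambda>\<beta>. mi_deriv \<beta> u p)"
  shows "(\<lambda>s. analytic_ext u p (complex_vec x + s *s complex_vec y)) holomorphic_on ball 0 R"
proof -
  interpret harmonic_coefficients "\<lambda>\<beta>. mi_deriv \<beta> u p" by fact
  let ?f = "\<lambda>\<beta> s. taylor_term u p (complex_vec x + s *s complex_vec y) \<beta>"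
  have f: "?f \<beta> s = mi_deriv \<beta> u p * divided_power (\<lambda>i. complex_of_real (x $ i - p $ i) + s * complex_of_real (y $ i)) \<beta>" for \<beta> s
    unfolding taylor_term_eq' by (simp add: complex_vec_def algebra_simps)
  define b where "b i = \<bar>x $ i - p $ i\<bar> + R * \<bar>y $ i\<bar>" for i
  define M where "M \<beta> = norm (mi_deriv \<beta> u p * divided_power (\<lambda>i. complex_of_real (b i)) \<beta>)" for \<beta>
  have M: "M summable_on UNIV"
    unfolding M_def[abs_def] using taylor_abs_summable[of "\<chi> i. complex_of_real (b i)"] by simp
  have le: "norm (?f \<beta> s) \<le> M \<beta>" if s: "s \<in> cball 0 R" for \<beta> s
  proof -
    have b0: "norm (complex_of_real (x $ i - p $ i) + s * complex_of_real (y $ i)) \<le> b i" for i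
    proof -
      have "norm (complex_of_real (x $ i - p $ i) + s * complex_of_real (y $ i)) \<le> \<bar>x $ i - p $ i\<bar> + norm s * \<bar>y $ i\<bar>"
        by (rule order_trans[OF norm_triangle_ineq]) (simp only: norm_mult norm_of_real order_refl)
      also have "\<dots> \<le> b i" using s by (auto simp: b_def mult_right_mono)
      finally show ?thesis .
    qed
    have "b i \<ge> 0" for i using b0[of i] norm_ge_zero order_trans by blast
    then show ?thesis unfolding f M_def norm_mult prod_norm[symmetric] norm_divide norm_power norm_of_real
      using b0 by (intro mult_left_mono prod_mono conjI divide_right_mono power_mono) auto
  qed
  have sum: "(\<lambda>\<beta>. ?f \<beta> s) summable_on UNIV" for s
    unfolding taylor_term_eq' by (rule abs_summable_summable[OF taylor_abs_summable])
  have "uniform_limit (cball 0 R) (\<lambda>X s. \<Sum>\<beta>\<in>X. ?f \<beta> s) (\<lambda>s. analytic_ext u p (complex_vec x + s *s complex_vec y)) (finite_subsets_at_top UNIV)"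
    by (rule Weierstrass_m_test_general'[OF _ _ M]) (use le sum in \<open>auto simp: analytic_ext_def\<close>)
  then show ?thesis
  proof (rule holomorphic_uniform_limit[rotated])
    show "\<forall>\<^sub>F X in finite_subsets_at_top UNIV. continuous_on (cball 0 R) (\<lambda>s. \<Sum>\<beta>\<in>X. ?f \<beta> s) \<and> (\<lambda>s. \<Sum>\<beta>\<in>X. ?f \<beta> s) holomorphic_on ball 0 R"
      unfolding f by (intro always_eventually allI conjI continuous_intros holomorphic_intros) auto
  qed auto
qed

text \<open>On the complex line through \<open>x\<close> in direction \<open>y\<close> both expansions are entire functions of \<open>s\<close>, and for real \<open>s\<close>
both equal \<open>u(x + s y)\<close>.\<close>
lemma analytic_ext_independent:
  fixes u :: "real ^ 'n \<Rightarrow> complex"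
  assumes u: "harmonic u" and c: "\<And>p. harmonic_coefficients (\<lambda>\<beta>. mi_deriv \<beta> u p)"
  shows "analytic_ext u p (complex_vec x + s *s complex_vec y) = analytic_ext u q (complex_vec x + s *s complex_vec y)"
proof -
  let ?f = "\<lambda>p s. analytic_ext u p (complex_vec x + s *s complex_vec y)"
  define R where "R = norm s + 1"
  have R: "R > 0" "s \<in> ball 0 R" by (auto simp: R_def add_nonneg_pos)
  have "?f p s - ?f q s = 0"
  proof (rule analytic_continuation[of "\<lambda>s. ?f p s - ?f q s" "ball 0 R" "\<real> \<inter> ball 0 R" 0])
    show "(\<lambda>s. ?f p s - ?f q s) holomorphic_on ball 0 R"
      by (intro holomorphic_intros analytic_ext_holomorphic c)
    show "(0 :: complex) islimpt \<real> \<inter> ball 0 R"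
      unfolding islimpt_approachable
    proof (intro allI impI)
      fix e :: real assume e: "e > 0"
      show "\<exists>z\<in>\<real> \<inter> ball 0 R. z \<noteq> (0 :: complex) \<and> dist z 0 < e"
        by (rule bexI[where x = "complex_of_real (min e R / 2)"]) (use R e in \<open>auto simp: min_def\<close>)
    qed
    show "?f p z - ?f q z = 0" if "z \<in> \<real> \<inter> ball 0 R" for z
    proof -
      obtain t where z: "z = complex_of_real t" using \<open>z \<in> \<real> \<inter> ball 0 R\<close> by (auto elim: Reals_cases)
      have "complex_vec x + z *s complex_vec y = complex_vec (x + t *\<^sub>R y)"
        by (simp add: z complex_vec_def vec_eq_iff)
      then show ?thesis by (simp only: analytic_ext_real[OF u]) simp
    qed
  qed (use R in auto)
  then show ?thesis by simp
qed

theorem theorem5p1: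
  fixes u :: "real ^ 'n \<Rightarrow> complex" and h D :: real
  assumes "harmonic u"
    and "\<And>x y :: real ^ 'n.
      (\<lambda>\<beta>. norm (mi_deriv \<beta> u x / complex_of_real (sqrt (mi_fact \<beta>)) *
                 complex_of_real (mi_pow y \<beta>))) summable_on UNIV"
    and "h > 0" and "D > 0" and "sqrt D * h < 1"
  shows "(\<forall>p \<zeta>. taylor_term u p \<zeta> summable_on UNIV) \<and>
    (\<forall>x. (\<lambda>m. u (h *\<^sub>R int_vec m) * complex_of_real (gauss h D x m)) summable_on UNIV \<and>
      (\<lambda>M. saturation_error h D M u x) \<longlonglongrightarrow> quasi_interp h D u x - u x \<and>
      (\<forall>p. ((\<lambda>m. analytic_ext u p
                   (complex_vec x + (pi * \<i> * h * D) *s complex_vec (int_vec m)) *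
                 complex_of_real (exp (- pi\<^sup>2 * D * (norm (int_vec m))\<^sup>2)) *
                 exp (2 * pi * \<i> * complex_of_real (int_vec m \<bullet> x) / h))
              has_sum (quasi_interp h D u x - u x)) (UNIV - {0})))"
proof (intro conjI allI)
  note u = assms(1) and h = assms(3) and D = assms(4)
  have hc: "harmonic_coefficients (\<lambda>\<beta>. mi_deriv \<beta> u p)" for p
    by (rule harmonic_coefficients_mi_deriv[OF assms(1,2)])
  show "taylor_term u p \<zeta> summable_on UNIV" for p \<zeta>
    unfolding taylor_term_eq'[abs_def]
    by (rule abs_summable_summable[OF harmonic_coefficients.taylor_abs_summable[OF hc]])
  fix x :: "real ^ 'n"
  interpret harmonic_coefficients "\<lambda>\<beta>. mi_deriv \<beta> u x" by (rule hc)
  obtain S where S1: "((\<lambda>m. u (h *\<^sub>R int_vec m) * complex_of_real (gauss h D x m)) has_sum S) UNIV"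
    and S2: "((\<lambda>\<beta>. mi_deriv \<beta> u x * poisson_moment h D x \<beta>) has_sum S) UNIV"
    using gauss_side[OF h D mean_value_taylor[OF harmonic_mean_value[OF u]]] by blast
  then show "(\<lambda>m. u (h *\<^sub>R int_vec m) * complex_of_real (gauss h D x m)) summable_on UNIV"
    by (auto simp: summable_on_def)
  define N where "N = (pi * D) powr (- (real CARD('n) / 2))"
  have qi: "quasi_interp h D u x = complex_of_real N * S"
    unfolding quasi_interp_def N_def infsumI[OF S1] ..
  have sat: "saturation_error h D M u x = complex_of_real N * (\<Sum>\<alpha> | mi_abs \<alpha> \<le> 2 * M - 1. mi_deriv \<alpha> u x * poisson_moment h D x \<alpha>) - u x" for M
  proof -
    let ?K = "2 * M - 1"
    let ?t = "\<lambda>\<beta> :: nat ^ 'n. complex_of_real ((- h * sqrt D) ^ mi_abs \<beta>) * mi_deriv \<beta> u x *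
       complex_of_real
         (\<Sum>\<^sub>\<infinity>m. gauss h D x m *
            (\<Sum>\<alpha> | \<alpha> \<le> \<beta>. a_coeff (\<beta> - \<alpha>) / mi_fact \<alpha> *
               mi_pow ((1 / (h * sqrt D)) *\<^sub>R (x - h *\<^sub>R int_vec m)) \<alpha>))"
    (* The leading term of the saturation error, without the subtracted 1, is the term beta = 0 of the sum. *)
    have z: "{\<alpha> :: nat ^ 'n. \<alpha> \<le> 0} = {0}" by (auto simp: less_eq_vec_def vec_eq_iff)
    have "?t 0 = u x * complex_of_real (\<Sum>\<^sub>\<infinity>m :: int ^ 'n. gauss h D x m)"
      unfolding z by (simp add: mi_deriv_0 mi_abs_def mi_fact_def mi_pow_def a_coeff_def)
    moreover have "(\<Sum>\<beta> | mi_abs \<beta> \<le> ?K. ?t \<beta>) = ?t 0 + (\<Sum>\<beta> | 1 \<le> mi_abs \<beta> \<and> mi_abs \<beta> \<le> ?K. ?t \<beta>)"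
    proof -
      have split: "{\<beta> :: nat ^ 'n. mi_abs \<beta> \<le> ?K} = insert 0 {\<beta>. 1 \<le> mi_abs \<beta> \<and> mi_abs \<beta> \<le> ?K}"
        by (auto simp: Suc_le_eq mi_abs_eq_0_iff[symmetric] mi_abs_eq_0_iff[of 0, simplified])
      show ?thesis unfolding split
        by (rule sum.insert) (auto simp: mi_abs_eq_0_iff[of 0, simplified] intro: finite_subset[OF _ finite_mi_abs_le[of ?K]])
    qed
    ultimately have eq: "(\<Sum>\<beta> | 1 \<le> mi_abs \<beta> \<and> mi_abs \<beta> \<le> ?K. ?t \<beta>) = 
        (\<Sum>\<alpha> | mi_abs \<alpha> \<le> ?K. mi_deriv \<alpha> u x * poisson_moment h D x \<alpha>) - u x * complex_of_real (\<Sum>\<^sub>\<infinity>m :: int ^ 'n. gauss h D x m)"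
      unfolding saturation_sum[OF h D] by simp
    show ?thesis unfolding saturation_error_def N_def[symmetric] eq by (simp add: algebra_simps)
  qed
  have "filterlim (\<lambda>M :: nat. 2 * M - 1) at_top sequentially"
    by (rule filterlim_at_top_mono[OF filterlim_ident]) (auto intro: eventually_sequentiallyI[of 1])
  from filterlim_compose[OF S2[unfolded has_sum_def] filterlim_mi_abs_le[OF this]]
  have "(\<lambda>M. \<Sum>\<alpha> | mi_abs \<alpha> \<le> 2 * M - 1. mi_deriv \<alpha> u x * poisson_moment h D x \<alpha>) \<longlonglongrightarrow> S" .
  then show "(\<lambda>M. saturation_error h D M u x) \<longlonglongrightarrow> quasi_interp h D u x - u x"
    unfolding sat qi by (intro tendsto_intros)
  fix p :: "real ^ 'n"
  let ?F = "\<lambda>m. analytic_ext u p (complex_vec x + (pi * \<i> * h * D) *s complex_vec (int_vec m)) *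
                 complex_of_real (exp (- pi\<^sup>2 * D * (norm (int_vec m))\<^sup>2)) *
                 exp (2 * pi * \<i> * complex_of_real (int_vec m \<bullet> x) / h)"
  let ?A = "\<lambda>m :: int ^ 'n. (\<Sum>\<^sub>\<infinity>\<alpha>. mi_deriv \<alpha> u x * divided_power (\<lambda>i. \<i> * complex_of_real (pi * h * D * of_int (m $ i))) \<alpha>)"
  have N: "N * sqrt (pi * D) ^ CARD('n) = 1"
  proof -
    have "sqrt (pi * D) ^ CARD('n) = (pi * D) powr (real CARD('n) / 2)"
      using D by (simp add: powr_half_sqrt[symmetric] powr_realpow[symmetric] powr_powr)
    then show ?thesis using D by (simp add: N_def powr_add[symmetric])
  qed
  have F: "complex_of_real N * ((\<Prod>i\<in>UNIV. theta_coeff h D (x $ i) (m $ i)) *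
    ?A m) = ?F m" for m :: "int ^ 'n"
  proof -
    let ?w = "(pi * \<i> * h * D) *s complex_vec (int_vec m)"
    have "?w $ i = \<i> * complex_of_real (pi * h * D * of_int (m $ i))" for i
      by (simp add: complex_vec_def int_vec_def)
    then have "?A m = analytic_ext u x (complex_vec x + ?w)"
      unfolding analytic_ext_def taylor_term_eq by (simp only:)
    also have "\<dots> = analytic_ext u p (complex_vec x + ?w)"
      by (rule analytic_ext_independent[OF u hc])
    finally have ext: "?A m = analytic_ext u p (complex_vec x + ?w)" .
    let ?E = "exp (- pi\<^sup>2 * D * (norm (int_vec m))\<^sup>2)" and ?X = "exp (2 * pi * \<i> * complex_of_real (int_vec m \<bullet> x) / h)"
    have theta: "(\<Prod>i\<in>UNIV. theta_coeff h D (x $ i) (m $ i)) = complex_of_real (sqrt (pi * D) ^ CARD('n) * exp (- pi\<^sup>2 * D * (norm (int_vec m))\<^sup>2)) * exp (2 * pi * \<i> * complex_of_real (int_vec m \<bullet> x) / h)"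
    proof -
      have "(\<Prod>i\<in>UNIV. cis (2 * pi * of_int (m $ i) * (x $ i / h))) = exp (\<Sum>i\<in>UNIV. \<i> * complex_of_real (2 * pi * of_int (m $ i) * (x $ i / h)))"
        by (simp only: exp_sum[OF finite_class.finite_UNIV] cis_conv_exp)
      also have "(\<Sum>i\<in>UNIV. \<i> * complex_of_real (2 * pi * of_int (m $ i) * (x $ i / h))) = 2 * pi * \<i> * complex_of_real (int_vec m \<bullet> x) / h"
        unfolding inner_vec_def by (simp add: int_vec_def sum_distrib_left sum_divide_distrib mult_ac)
      finally have 1: "(\<Prod>i\<in>UNIV. cis (2 * pi * of_int (m $ i) * (x $ i / h))) = exp (2 * pi * \<i> * complex_of_real (int_vec m \<bullet> x) / h)" .
      have "(\<Prod>i\<in>UNIV. exp (- pi\<^sup>2 * D * (of_int (m $ i))\<^sup>2)) = exp (\<Sum>i\<in>UNIV. - pi\<^sup>2 * D * (of_int (m $ i))\<^sup>2)"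
        by (simp only: exp_sum[OF finite_class.finite_UNIV])
      also have "(\<Sum>i\<in>UNIV. - pi\<^sup>2 * D * (of_int (m $ i))\<^sup>2) = - pi\<^sup>2 * D * (norm (int_vec m))\<^sup>2"
        unfolding power2_norm_eq_inner inner_vec_def sum_distrib_left by (simp add: int_vec_def power2_eq_square)
      finally have 2: "(\<Prod>i\<in>UNIV. exp (- pi\<^sup>2 * D * (of_int (m $ i))\<^sup>2)) = exp (- pi\<^sup>2 * D * (norm (int_vec m))\<^sup>2)" .
      show ?thesis unfolding theta_coeff_def prod.distrib of_real_prod[symmetric] 1 2 by simp
    qed
    have norm: "complex_of_real N * complex_of_real (sqrt (pi * D) ^ CARD('n) * ?E) = complex_of_real ?E"
      unfolding of_real_mult[symmetric] mult.assoc[symmetric] N by simp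
    have "complex_of_real N * ((\<Prod>i\<in>UNIV. theta_coeff h D (x $ i) (m $ i)) * analytic_ext u p (complex_vec x + ?w))
      = (complex_of_real N * complex_of_real (sqrt (pi * D) ^ CARD('n) * ?E)) * (?X * analytic_ext u p (complex_vec x + ?w))"
      unfolding theta by (simp only: mult_ac)
    also have "\<dots> = ?F m"
      unfolding norm by (simp only: mult_ac)
    finally show ?thesis unfolding ext .
  qed
  from has_sum_cmult_right[OF dual_side[OF h D S2], of "complex_of_real N"]
  have total: "(?F has_sum quasi_interp h D u x) UNIV" unfolding F qi .
  have F0: "?F 0 = u x"
  proof -
    have "int_vec (0 :: int ^ 'n) = 0" "complex_vec (0 :: real ^ 'n) = 0" by (simp_all add: int_vec_def complex_vec_def vec_eq_iff)
    then show ?thesis by (simp add: analytic_ext_real[OF u])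
  qed
  have "(?F has_sum u x) {0}"
    unfolding F0[symmetric] using has_sum_finite[of "{0 :: int ^ 'n}" ?F] by (simp only: sum.insert sum.empty finite.intros empty_iff not_False_eq_True add_0_right)
  from has_sum_Diff[OF total this] show "(?F has_sum (quasi_interp h D u x - u x)) (UNIV - {0})"
    by simp
qed

end
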